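(* Let $A$ be a singular semi-primary integer of $K$ (negative or positive) as in the context, assume that $A$ is primary, let $\omega$ be a $p$th root of $A$, $S=K(\omega)$, and let $M=\mathbb{Q}(\Omega)\subset S$ be the corresponding singular primary $\mathbb{Q}$-field. Let $d$ be the order of $v\mu^{-1}$ modulo $p$ in $\mathbf{F}_p^*$. Then there are exactly $\frac{p-1}{d}+1$ prime ideals of $M$ lying over $p$, and they can be indexed as $\mathfrak{P}_0,\mathfrak{P}_1,\dots,\mathfrak{P}_{(p-1)/d}$ so that the ramification indices are: (1) $e(\mathfrak{P}_0/p\mathbb{Z})=1$; (2) $e(\mathfrak{P}_j/p\mathbb{Z})=d$ for all $j=1,\dots,\frac{p-1}{d}$, with $d>1$.
   Context: Let $p$ be an odd irregular prime, $\zeta$ a primitive $p$th root of unity, $K=\mathbb{Q}(\zeta)$ with ring of integers $\mathbb{Z}_K$ and maximal totally real subfield $K^+$, $\lambda=\zeta-1$, and $\pi=\lambda\mathbb{Z}_K$ the prime of $K$ over $p$. Let $v$ be a primitive root mod $p$, $\sigma:\zeta\mapsto\zeta^v$ the corresponding generator of $G=\mathrm{Gal}(K/\mathbb{Q})$, and $\mathbf{F}_p$ the field with $p$ elements. Let $C_p$ be the subgroup of the class group of $K$ of elements killed by $p$; $C_p=C_p^+\oplus C_p^-$, where $C_p^+$ is the part coming from $K^+$ (complex conjugation acts trivially) and $C_p^-$ is the relative part (complex conjugation acts by inversion). $C_p$ is a direct sum of subgroups of order $p$, each annihilated by some $\sigma-\mu$ with $\mu\in\mathbf{F}_p^*$;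 let $\Gamma$ be one of them. We also write $\mu$ for a fixed natural integer representing $\mu$. A number $A\in\mathbb{Z}_K$ is singular if $v_\pi(A)=0$, $A^{1/p}\notin K$ and $A\mathbb{Z}_K=\mathfrak{a}^p$ for some ideal $\mathfrak{a}$ of $K$. A number $A\in K$ with $v_\pi(A)=0$ is semi-primary if $A\equiv a \bmod \pi^2$ for some natural integer $a$, and primary if $A\equiv a^p\bmod \pi^p$ for some natural integer $a$. Standing data: $A\in\mathbb{Z}_K$ is a singular semi-primary integer with $A\mathbb{Z}_K=\mathfrak{a}^p$, $\mathfrak{a}$ a non-principal ideal, $Cl(\mathfrak{a})\in\Gamma$, $Cl(\mathfrak{a}^{\sigma-\mu})=1$, $\sigma(A)=A^\mu\alpha^p$ with $\alpha\in K$, and one of the following holds: - (negative) $\Gamma\subset C_p^-$, $\mu\equiv v^{2m+1}\bmod p$ with $1\le m\le\frac{p-3}{2}$, and $\pi^{2m+1}\mid A-a^p$ for some integer $1\le a\le p-1$; - (positive) $\Gamma\subset C_p^+$, $\mu\equiv v^{2m}\bmod p$ with $1\le m\le \frac{p-3}{2}$, and $\pi^{2m}\mid A-a^p$ for some integer $1\le a\le p-1$. Moreover $A\equiv 1\bmod\pi^2$ and $A$ is a primitive element of $K$ (degree $p-1$ over $\mathbb{Q}$). Put $\omega=A^{1/p}$ (a fixed $p$th root) and $S=K(\omega)=\mathbb{Q}(\omega)$, with ring of integers $\mathbb{Z}_S$; $S/K$ is cyclic of degree $p$ and $S/\mathbb{Q}$ is Galois of degree $p(p-1)$. $S/K$ is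 called a singular extension, negative or positive according to $A$, and primary or non-primary according to whether $A$ is primary or not. For $x,y\in S$, $x\equiv y\bmod \pi^2$ means $v_P(x-y)\ge 2v_P(\pi)$ for every prime $P$ of $S$ over $\pi$. The automorphism $\sigma_\mu$ is the unique automorphism of $S/\mathbb{Q}$ extending $\sigma$ with $\sigma_\mu(\omega)\,\omega^{-\mu}\equiv 1\bmod\pi^2$. Put $\Omega=\sum_{i=0}^{p-2}\sigma_\mu^i(\omega)$. The field $M=\mathbb{Q}(\Omega)$, which satisfies $[M:\mathbb{Q}]=p$ and is the fixed field of $\sigma_\mu$ in $S$, is called a singular $\mathbb{Q}$-field, and is called primary if $S/K$ is primary. $e(\mathfrak{P}/p\mathbb{Z})$ denotes the ramification index of $\mathfrak{P}$ over $p$. *)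

theory Defs
  imports
    Complex_Main
    "HOL-Library.Extended_Real"
    "HOL-Computational_Algebra.Computational_Algebra"
    "HOL-Number_Theory.Number_Theory"
    "HOL-Algebra.Algebra"
    "HOL-Algebra.Algebraic_Closure_Type"
begin

hide_const (open) Divisibility.prime

text \<open>Number fields are subfields of the complex numbers, given by their carrier sets.\<close>

definition field_gen :: "complex set \<Rightarrow> complex set" where
  "field_gen B = generate_field ring_of_type_algebra B"

definition fld :: "complex set \<Rightarrow> complex ring" where
  "fld F = ring_of_type_algebra\<lparr>carrier := F\<rparr>"

definition ints_of :: "complex set \<Rightarrow> complex ring" where
  "ints_of F = ring_of_type_algebra\<lparr>carrier := {x \<in> F. algebraic_int x}\<rparr>"


section \<open>Fractional ideals and class groups\<close>

text \<open>Nonzero fractional ideals; the nonzero ideals of \<open>ints_of F\<close> are those contained in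
  \<open>carrier (ints_of F)\<close>.\<close>

definition frac_ideals :: "complex set \<Rightarrow> complex set monoid" where
  "frac_ideals F =
    \<lparr>carrier = {I. I \<noteq> {0} \<and>
        (\<exists>d \<in> carrier (ints_of F) - {0}. ideal ((\<lambda>x. d * x) ` I) (ints_of F))},
     mult = ideal_prod ring_of_type_algebra,
     one = carrier (ints_of F)\<rparr>"

definition princ :: "complex set \<Rightarrow> complex \<Rightarrow> complex set" where
  "princ F x = (\<lambda>y. x * y) ` carrier (ints_of F)"

definition princ_ideals :: "complex set \<Rightarrow> complex set set" where
  "princ_ideals F = princ F ` (F - {0})"

definition class_group :: "complex set \<Rightarrow> complex set set monoid" where
  "class_group F = frac_ideals F Mod princ_ideals F"

definition ideal_class :: "complex set \<Rightarrow> complex set \<Rightarrow> complex set set" where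
  "ideal_class F I = princ_ideals F #>\<^bsub>frac_ideals F\<^esub> I"

definition irregular_prime :: "nat \<Rightarrow> bool" where
  "irregular_prime p \<longleftrightarrow> prime p \<and>
     p dvd card (carrier (class_group (field_gen {cis (2 * pi / real p)})))"

text \<open>A class is a coset, i.e. a set of fractional ideals; an automorphism acts on it through
  its images of these ideals.\<close>

definition class_act :: "(complex \<Rightarrow> complex) \<Rightarrow> complex set set \<Rightarrow> complex set set" where
  "class_act s c = (\<lambda>I. s ` I) ` c"

definition class_torsion :: "complex set \<Rightarrow> nat \<Rightarrow> complex set set set" where
  "class_torsion F p =
    {c \<in> carrier (class_group F). c [^]\<^bsub>class_group F\<^esub> p = \<one>\<^bsub>class_group F\<^esub>}"

definition class_torsion_plus :: "complex set \<Rightarrow> nat \<Rightarrow> complex set set set" where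
  "class_torsion_plus F p = {c \<in> class_torsion F p. class_act cnj c = c}"

definition class_torsion_minus :: "complex set \<Rightarrow> nat \<Rightarrow> complex set set set" where
  "class_torsion_minus F p =
    {c \<in> class_torsion F p. class_act cnj c = inv\<^bsub>class_group F\<^esub> c}"

definition annihilated_by ::
  "complex set \<Rightarrow> (complex \<Rightarrow> complex) \<Rightarrow> nat \<Rightarrow> complex set set set \<Rightarrow> bool" where
  "annihilated_by F s \<mu> H \<longleftrightarrow> (\<forall>c \<in> H. class_act s c = c [^]\<^bsub>class_group F\<^esub> \<mu>)"

text \<open>The bijection says that the \<open>p\<close>-torsion is the internal direct product of the
  members of \<open>D\<close>.\<close>

definition eigen_decomposition ::
  "complex set \<Rightarrow> (complex \<Rightarrow> complex) \<Rightarrow> nat \<Rightarrow> complex set set set set \<Rightarrow> bool" where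
  "eigen_decomposition F s p D \<longleftrightarrow> finite D \<and>
    (\<forall>H \<in> D. subgroup H (class_group F) \<and> card H = p \<and>
       (\<exists>\<mu>. \<not> p dvd \<mu> \<and> annihilated_by F s \<mu> H)) \<and>
    bij_betw (\<lambda>f. finprod (class_group F) f D) (\<Pi>\<^sub>E H \<in> D. H) (class_torsion F p)"


section \<open>Valuations and primes\<close>

text \<open>The normalised valuation of \<open>x \<in> F\<close> at the prime \<open>P\<close>, with value \<open>\<infinity>\<close> at 0.\<close>

definition val :: "complex set \<Rightarrow> complex set \<Rightarrow> complex \<Rightarrow> ereal" where
  "val F P x = (SUP k \<in> {k::int. x \<in> P [^]\<^bsub>frac_ideals F\<^esub> k}. ereal (real_of_int k))"

definition primes_over ::
  "complex set \<Rightarrow> complex set \<Rightarrow> complex set \<Rightarrow> complex set set" where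
  "primes_over E F q = {P. primeideal P (ints_of E) \<and> P \<inter> F = q}"

text \<open>For an ideal \<open>q\<close> of a subfield, \<open>q \<subseteq> P^e\<close> is the same as \<open>P^e\<close> dividing the extension
  of \<open>q\<close> to \<open>E\<close>.\<close>

definition ram_index :: "complex set \<Rightarrow> complex set \<Rightarrow> complex set \<Rightarrow> nat" where
  "ram_index E P q = (GREATEST e::nat. q \<subseteq> P [^]\<^bsub>frac_ideals E\<^esub> e)"


section \<open>Singular and primary numbers\<close>

text \<open>Here \<open>K\<close> is the \<open>p\<close>-th cyclotomic field and \<open>P\<close> its prime over \<open>p\<close>.\<close>

definition singular :: "nat \<Rightarrow> complex set \<Rightarrow> complex set \<Rightarrow> complex \<Rightarrow> bool" where
  "singular p K P A \<longleftrightarrow> A \<in> carrier (ints_of K) \<and> val K P A = 0 \<and>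
     \<not> (\<exists>x \<in> K. x ^ p = A) \<and>
     (\<exists>I. ideal I (ints_of K) \<and> princ K A = I [^]\<^bsub>frac_ideals K\<^esub> p)"

definition semi_primary :: "complex set \<Rightarrow> complex set \<Rightarrow> complex \<Rightarrow> bool" where
  "semi_primary K P A \<longleftrightarrow> A \<in> K \<and> val K P A = 0 \<and>
     (\<exists>a::nat. val K P (A - of_nat a) \<ge> 2)"

definition primary :: "nat \<Rightarrow> complex set \<Rightarrow> complex set \<Rightarrow> complex \<Rightarrow> bool" where
  "primary p K P A \<longleftrightarrow> A \<in> K \<and> val K P A = 0 \<and>
     (\<exists>a::nat. val K P (A - of_nat a ^ p) \<ge> ereal (real p))"

end

theory Submission
  imports Defs "Jordan_Normal_Form.Char_Poly"
begin

text \<open>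
  Let \<open>\<theta>\<close> be the automorphism of \<open>S\<close> over \<open>K\<close> with \<open>\<theta> \<omega> = \<zeta> \<omega>\<close> and write \<open>\<sigma>\<close> for
  \<open>\<sigma>\<^sub>\<mu>\<close>. Comparing both sides on \<open>\<omega>\<close> gives \<open>\<sigma> \<theta> = \<theta>\<^sup>k \<sigma>\<close> with \<open>k \<equiv> v / \<mu>\<close> modulo \<open>p\<close>, and
  \<open>k\<close> is not congruent to 1 because \<open>\<mu>\<close> is congruent to a power of the primitive root \<open>v\<close> with
  exponent between 2 and \<open>p - 2\<close>. The group of \<open>S\<close> over the rationals is thus the semidirect
  product of the groups generated by \<open>\<theta>\<close>, of order \<open>p\<close>, and by \<open>\<sigma>\<close>, of order \<open>p - 1\<close>.

  The prime \<open>lam\<close> splits completely in \<open>S\<close>, for the following reason. Being primary and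
  congruent to 1 modulo \<open>lam\<^sup>2\<close>, the number \<open>A\<close> has the form \<open>1 + lam\<^sup>p t\<close> with \<open>t\<close> integral. So \<open>\<eta> = (\<omega> - 1) / lam\<close> is integral, and because
  \<open>p / lam\<^sup>p\<^sup>-\<^sup>1 \<equiv> -1\<close>, the Kummer equation becomes the Artin-Schreier equation
  \<open>\<eta>\<^sup>p - \<eta> \<equiv> t\<close> modulo \<open>lam\<close>, on whose roots \<open>\<theta>\<close> acts by \<open>\<eta> \<mapsto> \<eta> + 1\<close>. The integers of \<open>S\<close> are
  integer polynomials in \<open>\<eta>\<close> modulo \<open>lam\<close> (lemma \<open>integers_S_residue\<close>). With \<open>\<kappa> = 1 / k\<close>, the
  commutation rule forces \<open>\<sigma> \<eta> \<equiv> \<kappa> \<eta> + b\<close> for an integer \<open>b\<close>, and applying \<open>\<sigma>\<close> to the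
  Artin-Schreier equation shows \<open>\<kappa> t \<equiv> t\<close>, hence \<open>t \<equiv> 0\<close> (lemma \<open>eta_frobenius\<close>).

  Consequently the integers of \<open>S\<close> modulo \<open>lam\<close> are the functions on the field
  with \<open>p\<close> elements, \<open>\<eta>\<close> being the coordinate. After a translation to a coordinate \<open>\<epsilon>\<close> whose
  origin is the fixed point of \<open>\<sigma>\<close>, the action of \<open>\<sigma>\<close> on the points is multiplication by \<open>k\<close>.
  The primes over \<open>p\<close> of the fixed ring of \<open>\<sigma>\<close> are the contractions \<open>Q c\<close> of the points
  (lemma \<open>prime_over_p_is_Q\<close>), and two of them agree exactly if the points lie in one orbit (lemmas
  \<open>Q_orbit\<close> and \<open>Q_eq_imp_orbit\<close>). The orbits are the origin and \<open>(p - 1) / d\<close> orbits of length \<open>d\<close>,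
  where \<open>d\<close> is the order of \<open>k\<close>.

  As to ramification, let \<open>n\<close> be the length of the orbit of \<open>c\<close>. The stabiliser of \<open>c\<close>, generated by
  \<open>\<sigma>\<^sup>n\<close>, multiplies \<open>lam\<close> by \<open>v\<^sup>n\<close> modulo \<open>lam\<^sup>2\<close>, so the order in \<open>lam\<close> of a fixed element at the
  point \<open>c\<close> is divisible by \<open>(p - 1) / n\<close> (lemma \<open>Q_subset_Fil\<close>). The order
  \<open>(p - 1) / n\<close> is attained by the trace of that power of \<open>lam\<close> times an element which is 1 at \<open>c\<close>
  and 0 at the other points (lemma \<open>uniformizer_exists\<close>). As \<open>p\<close> has order
  \<open>p - 1\<close>, the ramification index is \<open>n\<close>.

  Finally \<open>\<rat>(\<Omega>)\<close> is the whole fixed field of \<open>\<sigma>\<close> (lemma \<open>Fix_eq_field_gen\<close>), since the conjugates of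
  \<open>\<Omega>\<close> under \<open>\<theta>\<close> are pairwise different.
\<close>

section \<open>Congruences modulo a prime\<close>

lemma coprime_int_prime: "prime p \<Longrightarrow> \<not> int p dvd a \<Longrightarrow> coprime a (int p)"
  using prime_imp_coprime[of "int p" a] by (simp add: coprime_commute)

lemma coprime_nat_prime: "prime p \<Longrightarrow> \<not> p dvd a \<Longrightarrow> coprime a (p :: nat)"
  using prime_imp_coprime[of p a] by (simp add: coprime_commute)

lemma prime_dvd_binomial:
  assumes "prime p" "0 < j" "j < p"
  shows "p dvd (p choose j)"
proof -
  have "p dvd j * (p choose j)" using times_binomial_minus1_eq[OF assms(2), of p] by simp
  moreover have "\<not> p dvd j" using assms by (auto dest: dvd_imp_le)
  ultimately show ?thesis using assms(1) prime_dvd_mult_iff by blast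
qed

lemma int_fermat:
  assumes prime_p: "prime p"
  shows "[n ^ p = n] (mod int p)"
proof (cases "int p dvd n")
  case True
  moreover have "int p dvd n ^ p" using prime_gt_0_nat[OF prime_p] by (intro dvd_trans[OF True dvd_power]) simp
  ultimately show ?thesis by (simp add: cong_iff_dvd_diff)
next
  case False
  define m where "m = nat (n mod int p)"
  have p0: "p > 0" using prime_p by (rule prime_gt_0_nat)
  have m: "int m = n mod int p" using p0 by (simp add: m_def)
  hence nm: "[n = int m] (mod int p)" by (simp add: Cong.cong_def)
  hence "\<not> p dvd m" using False m by (simp flip: int_dvd_int_iff add: dvd_mod_iff)
  hence "[m ^ (p - 1) = 1] (mod p)" by (rule fermat_theorem[OF prime_p])
  hence "[m * m ^ (p - 1) = m * 1] (mod p)" by (rule cong_scalar_left)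
  hence "[m ^ p = m] (mod p)" using p0 by (simp flip: power_Suc)
  hence "[int m ^ p = int m] (mod int p)" by (metis cong_int_iff of_nat_power)
  thus ?thesis using nm by (meson cong_pow cong_sym cong_trans)
qed

lemma int_pow_fermat:
  assumes "prime p" "\<not> int p dvd a"
  shows "[a ^ (p - 1) = 1] (mod int p)"
proof -
  have "[a * a ^ (p - 1) = a * 1] (mod int p)"
    using int_fermat[OF assms(1), of a] prime_gt_0_nat[OF assms(1)] by (simp flip: power_Suc)
  thus ?thesis by (simp only: cong_mult_lcancel[OF coprime_int_prime[OF assms]])
qed

section \<open>Subrings and subfields of the complex numbers\<close>

locale subring_of_complex =
  fixes R :: "complex set"
  assumes one_closed [simp, intro]: "1 \<in> R"
    and diff_closed [intro]: "x \<in> R \<Longrightarrow> y \<in> R \<Longrightarrow> x - y \<in> R"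
    and mult_closed [intro]: "x \<in> R \<Longrightarrow> y \<in> R \<Longrightarrow> x * y \<in> R"
begin

lemma zero_closed [simp, intro]: "0 \<in> R"
  using diff_closed[OF one_closed one_closed] by simp

lemma uminus_closed [intro]: "x \<in> R \<Longrightarrow> - x \<in> R"
  using diff_closed[OF zero_closed] by simp

lemma add_closed [intro]: "x \<in> R \<Longrightarrow> y \<in> R \<Longrightarrow> x + y \<in> R"
  using diff_closed[OF _ uminus_closed] by simp

lemma of_nat_closed [simp, intro]: "of_nat n \<in> R"
  by (induction n) auto

lemma of_int_closed [simp, intro]: "of_int n \<in> R"
  by (cases n) auto

lemma power_closed [intro]: "x \<in> R \<Longrightarrow> x ^ n \<in> R"
  by (induction n) auto

lemma sum_closed [intro]: "(\<And>i. i \<in> I \<Longrightarrow> f i \<in> R) \<Longrightarrow> sum f I \<in> R"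
  by (induction I rule: infinite_finite_induct) auto

lemma prod_closed [intro]: "(\<And>i. i \<in> I \<Longrightarrow> f i \<in> R) \<Longrightarrow> prod f I \<in> R"
  by (induction I rule: infinite_finite_induct) auto

lemma poly_closed: "(\<And>i. coeff g i \<in> R) \<Longrightarrow> x \<in> R \<Longrightarrow> poly g x \<in> R"
  by (auto simp: poly_altdef)

lemma coeff_mult_closed:
  "(\<And>i. coeff f i \<in> R) \<Longrightarrow> (\<And>i. coeff g i \<in> R) \<Longrightarrow> coeff (f * g) i \<in> R"
  by (auto simp: coeff_mult)

end

locale subfield_of_complex = subring_of_complex +
  assumes inverse_closed [intro]: "x \<in> R \<Longrightarrow> inverse x \<in> R"
begin

lemma divide_closed [intro]: "x \<in> R \<Longrightarrow> y \<in> R \<Longrightarrow> x / y \<in> R"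
  by (simp add: divide_inverse mult_closed inverse_closed)

lemma Rats_subset: "\<rat> \<subseteq> R"
proof
  fix x :: complex assume "x \<in> \<rat>"
  then obtain a b where "x = of_int a / of_int b"
    by (metis Rats_cases')
  thus "x \<in> R" by auto
qed

end

text \<open>Every element of the ring generated by \<open>x\<close> over \<open>R\<close> is a polynomial in \<open>x\<close>. For algebraic \<open>x\<close> over
  a field this ring is the generated field.\<close>

definition adjoin :: "complex set \<Rightarrow> complex \<Rightarrow> complex set" where
  "adjoin R x = {poly g x | g. \<forall>i. coeff g i \<in> R}"

context subring_of_complex
begin

lemma adjoinI: "(\<And>i. coeff g i \<in> R) \<Longrightarrow> poly g x \<in> adjoin R x"
  by (auto simp: adjoin_def)

lemma subring_adjoin: "subring_of_complex (adjoin R x)"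
proof
  show "1 \<in> adjoin R x"
    using adjoinI[of 1 x] by (simp add: coeff_pCons split: nat.split flip: one_pCons)
next
  fix a b assume "a \<in> adjoin R x" "b \<in> adjoin R x"
  then obtain f g where fg: "a = poly f x" "b = poly g x" "\<And>i. coeff f i \<in> R" "\<And>i. coeff g i \<in> R"
    by (auto simp: adjoin_def)
  show "a - b \<in> adjoin R x"
    using adjoinI[of "f - g" x] fg by auto
  show "a * b \<in> adjoin R x"
    using adjoinI[of "f * g" x] coeff_mult_closed[of f g] fg by auto
qed

lemma base_subset_adjoin: "R \<subseteq> adjoin R x"
proof
  fix a assume "a \<in> R"
  thus "a \<in> adjoin R x"
    using adjoinI[of "[:a:]" x] by (simp add: coeff_pCons split: nat.split)
qed

lemma generator_in_adjoin: "x \<in> adjoin R x"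
  using adjoinI[of "[:0, 1:]" x] by (simp add: coeff_pCons split: nat.split)

text \<open>Unlike the division of polynomials over a field, division by a monic polynomial never leaves the
  ring of coefficients. It is used over the rationals, over rings of integers and over fields given as
  subsets of the complex numbers.\<close>

lemma monic_division:
  assumes g: "\<And>i. coeff g i \<in> R" "lead_coeff g = 1"
    and f: "\<And>i. coeff f i \<in> R"
  shows "\<exists>q r. f = q * g + r \<and> (\<forall>i. coeff q i \<in> R) \<and> (\<forall>i. coeff r i \<in> R) \<and>
    (r = 0 \<or> degree r < degree g)"
  using f
proof (induction "degree f" arbitrary: f rule: less_induct)
  case less
  show ?case
  proof (cases "f = 0 \<or> degree f < degree g")
    case True
    thus ?thesis using less.prems by (intro exI[of _ 0] exI[of _ f]) auto
  next
    case False
    define h where "h = monom (lead_coeff f) (degree f - degree g)"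
    have hR: "coeff h i \<in> R" for i
      using less.prems by (auto simp: h_def)
    define f' where "f' = f - h * g"
    have f'R: "coeff f' i \<in> R" for i
      unfolding f'_def using less.prems coeff_mult_closed[of h g] hR g by auto
    have g0: "g \<noteq> 0" using g by auto
    have dh: "degree (h * g) = degree f"
      using False g0 by (simp add: h_def degree_mult_eq degree_monom_eq)
    have lh: "coeff (h * g) (degree f) = lead_coeff f"
    proof -
      have "coeff (h * g) (degree f) = lead_coeff (h * g)" using dh by simp
      also have "\<dots> = lead_coeff f"
        using False by (simp add: lead_coeff_mult g h_def degree_monom_eq)
      finally show ?thesis .
    qed
    show ?thesis
    proof (cases "f' = 0")
      case True
      thus ?thesis using hR by (intro exI[of _ h] exI[of _ 0]) (auto simp: f'_def)
    next
      case f'0: False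
      have "degree f' \<le> degree f"
        unfolding f'_def using dh by (simp add: degree_diff_le)
      moreover have "coeff f' (degree f) = 0"
        by (simp add: f'_def lh)
      ultimately have "degree f' < degree f"
        using f'0 by (metis le_neq_implies_less leading_coeff_0_iff)
      from less.hyps[OF this] f'R obtain q r where
        qr: "f' = q * g + r" "\<forall>i. coeff q i \<in> R" "\<forall>i. coeff r i \<in> R" "r = 0 \<or> degree r < degree g"
        by blast
      show ?thesis
        using qr hR by (intro exI[of _ "q + h"] exI[of _ r]) (auto simp: f'_def algebra_simps)
    qed
  qed
qed

end

section \<open>Integrality\<close>

definition int_span :: "complex set \<Rightarrow> complex set" where
  "int_span B = {\<Sum>b\<in>B. of_int (c b) * b | c. True}"

lemma int_span_incl: "finite B \<Longrightarrow> b \<in> B \<Longrightarrow> b \<in> int_span B"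
  unfolding int_span_def by (rule CollectI, rule exI[of _ "\<lambda>x. if x = b then 1 else 0"])
    (auto simp: if_distrib[of of_int] if_distrib[of "\<lambda>x. x * _"] cong: if_cong)

lemma int_span_add: "x \<in> int_span B \<Longrightarrow> y \<in> int_span B \<Longrightarrow> x + y \<in> int_span B"
proof -
  assume "x \<in> int_span B" "y \<in> int_span B"
  then obtain c d where "x = (\<Sum>b\<in>B. of_int (c b) * b)" "y = (\<Sum>b\<in>B. of_int (d b) * b)"
    by (auto simp: int_span_def)
  hence "x + y = (\<Sum>b\<in>B. of_int (c b + d b) * b)"
    by (simp add: sum.distrib algebra_simps)
  thus ?thesis unfolding int_span_def by (intro CollectI exI[of _ "\<lambda>b. c b + d b"]) simp
qed

lemma int_span_scale: "x \<in> int_span B \<Longrightarrow> of_int n * x \<in> int_span B"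
proof -
  assume "x \<in> int_span B"
  then obtain c where "x = (\<Sum>b\<in>B. of_int (c b) * b)" by (auto simp: int_span_def)
  hence "of_int n * x = (\<Sum>b\<in>B. of_int (n * c b) * b)"
    by (simp add: sum_distrib_left algebra_simps)
  thus ?thesis unfolding int_span_def by (intro CollectI exI[of _ "\<lambda>b. n * c b"]) simp
qed

lemma int_span_sum: "(\<And>i. i \<in> I \<Longrightarrow> f i \<in> int_span B) \<Longrightarrow> sum f I \<in> int_span B"
proof (induction I rule: infinite_finite_induct)
  case (insert x F)
  thus ?case by (auto intro: int_span_add)
qed (auto simp: int_span_def intro!: exI[of _ "\<lambda>_. 0"])

text \<open>The determinant trick: multiplication by \<open>x\<close> on the generators is given by an integer matrix with
  eigenvalue \<open>x\<close>, and the characteristic polynomial of that matrix is monic with integer coefficients.\<close>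

lemma algebraic_int_if_module_stable:
  assumes B: "finite B" "b0 \<in> B" "b0 \<noteq> 0"
    and stable: "\<And>b. b \<in> B \<Longrightarrow> x * b \<in> int_span B"
  shows "algebraic_int x"
proof -
  obtain xs where xs: "set xs = B" "distinct xs"
    using finite_distinct_list B by blast
  define n where "n = length xs"
  have "\<forall>b\<in>B. \<exists>c. x * b = (\<Sum>a\<in>B. of_int (c a) * a)"
    using stable by (auto simp: int_span_def)
  then obtain c where c: "\<And>b. b \<in> B \<Longrightarrow> x * b = (\<Sum>a\<in>B. of_int (c b a) * a)"
    by metis
  define M where "M = mat n n (\<lambda>(i, j). c (xs ! i) (xs ! j))"
  have M: "M \<in> carrier_mat n n" by (simp add: M_def)
  define v where "v = vec_of_list xs"
  have v: "v \<in> carrier_vec n" by (simp add: v_def n_def carrier_vecI)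
  have "map_mat of_int M *\<^sub>v v = x \<cdot>\<^sub>v v"
  proof
    show "dim_vec (map_mat of_int M *\<^sub>v v) = dim_vec (x \<cdot>\<^sub>v v)"
      using M v by auto
    fix i assume "i < dim_vec (x \<cdot>\<^sub>v v)"
    hence i: "i < n" using v by simp
    have "(map_mat of_int M *\<^sub>v v) $ i = (\<Sum>j = 0..<n. of_int (c (xs ! i) (xs ! j)) * xs ! j)"
      using i M v by (simp add: M_def scalar_prod_def v_def n_def vec_of_list_index)
    also have "\<dots> = (\<Sum>a\<in>B. of_int (c (xs ! i) a) * a)"
      unfolding n_def using xs
      by (subst sum_list_distinct_conv_sum_set[symmetric, of xs, unfolded xs(1)])
         (auto simp: sum_list_sum_nth)
    also have "\<dots> = x * xs ! i"
      using i xs by (subst c) (auto simp: n_def)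
    finally show "(map_mat of_int M *\<^sub>v v) $ i = (x \<cdot>\<^sub>v v) $ i"
      using i v by (simp add: v_def n_def vec_of_list_index)
  qed
  moreover have "v \<noteq> 0\<^sub>v n"
  proof -
    obtain i where "i < n" "xs ! i = b0"
      using B xs by (metis in_set_conv_nth n_def)
    hence "v $ i \<noteq> 0\<^sub>v n $ i" using B by (simp add: v_def n_def vec_of_list_index)
    thus ?thesis by auto
  qed
  ultimately have "eigenvector (map_mat of_int M) v x"
    using M v by (auto simp: eigenvector_def)
  hence "eigenvalue (map_mat of_int M) x"
    by (auto simp: eigenvalue_def)
  hence "poly (char_poly (map_mat of_int M)) x = 0"
    using eigenvalue_root_char_poly[of "map_mat of_int M" n x] M by auto
  hence "poly (map_poly of_int (char_poly M)) x = 0"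
    using of_int_hom.char_poly_hom[OF M] by metis
  thus ?thesis
    using degree_monic_char_poly[OF M] by (auto simp: algebraic_int_altdef_ipoly)
qed

text \<open>The closure properties of algebraic integers are read off from these rings, as every element of such
  a ring is integral and adjoining a root of a monic polynomial leads to such a ring again.\<close>

definition finite_subring :: "complex set \<Rightarrow> bool" where
  "finite_subring R \<longleftrightarrow> subring_of_complex R \<and> (\<exists>B. finite B \<and> R = int_span B)"

lemma algebraic_int_finite_subring:
  assumes "finite_subring R" "x \<in> R"
  shows "algebraic_int x"
proof -
  from assms obtain B where B: "finite B" "R = int_span B" and "subring_of_complex R"
    by (auto simp: finite_subring_def)
  then interpret subring_of_complex R by simp
  have BR: "B \<subseteq> R" using B int_span_incl by auto
  have "\<exists>b0\<in>B. b0 \<noteq> 0"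
  proof (rule ccontr)
    assume "\<not> ?thesis"
    hence "r = 0" if "r \<in> R" for r
      using that B by (auto simp: int_span_def intro!: sum.neutral)
    from this[OF one_closed] show False by simp
  qed
  then obtain b0 where "b0 \<in> B" "b0 \<noteq> 0" by blast
  thus ?thesis
    using B BR assms mult_closed by (intro algebraic_int_if_module_stable[of B b0]) auto
qed

lemma finite_subring_Ints: "finite_subring \<int>"
  unfolding finite_subring_def
proof (intro conjI exI[of _ "{1}"])
  show "subring_of_complex \<int>" by standard auto
  show "\<int> = int_span {1}"
    by (auto simp: int_span_def Ints_def)
qed simp

text \<open>Division by the monic polynomial bounds the degree in \<open>x\<close>, so the products of the generators of \<open>R\<close>
  with the powers of \<open>x\<close> below the degree suffice.\<close>

lemma finite_subring_adjoin:
  assumes R: "finite_subring R" and g: "\<And>i. coeff g i \<in> R" "lead_coeff g = 1" "poly g x = 0"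
  shows "finite_subring (adjoin R x)"
proof -
  from assms obtain B where B: "finite B" "R = int_span B" and "subring_of_complex R"
    by (auto simp: finite_subring_def)
  then interpret subring_of_complex R by simp
  interpret a: subring_of_complex "adjoin R x" by (rule subring_adjoin)
  have BR: "B \<subseteq> R" using B int_span_incl by auto
  define C where "C = (\<lambda>(b, j). b * x ^ j) ` (B \<times> {..<degree g})"
  have C: "finite C" using B by (simp add: C_def)
  have "adjoin R x = int_span C"
  proof
    show "int_span C \<subseteq> adjoin R x"
      using BR base_subset_adjoin generator_in_adjoin
      by (auto simp: int_span_def C_def intro!: a.sum_closed a.mult_closed a.power_closed)
    show "adjoin R x \<subseteq> int_span C"
    proof
      fix y assume "y \<in> adjoin R x"
      then obtain f where f: "y = poly f x" "\<And>i. coeff f i \<in> R" by (auto simp: adjoin_def)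
      obtain q r where qr: "f = q * g + r" "\<forall>i. coeff r i \<in> R" "r = 0 \<or> degree r < degree g"
        using monic_division[of g f] g f by blast
      have "y = poly r x" using f qr g by simp
      also have "\<dots> = (\<Sum>i\<le>degree r. coeff r i * x ^ i)" by (simp add: poly_altdef)
      also have "\<dots> \<in> int_span C"
      proof (rule int_span_sum)
        fix i assume i: "i \<in> {..degree r}"
        show "coeff r i * x ^ i \<in> int_span C"
        proof (cases "r = 0")
          case True thus ?thesis using int_span_sum[of "{}"] by simp
        next
          case False
          from qr(2) B have "coeff r i \<in> int_span B" by blast
          then obtain c where c: "coeff r i = (\<Sum>b\<in>B. of_int (c b) * b)"
            by (auto simp: int_span_def)
          have "coeff r i * x ^ i = (\<Sum>b\<in>B. of_int (c b) * (b * x ^ i))"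
            by (simp add: c sum_distrib_right mult.assoc)
          also have "\<dots> \<in> int_span C"
            using i qr False by (intro int_span_sum int_span_scale int_span_incl C) (force simp: C_def)
          finally show ?thesis .
        qed
      qed
      finally show "y \<in> int_span C" .
    qed
  qed
  thus ?thesis using C a.subring_of_complex_axioms by (auto simp: finite_subring_def)
qed

lemma finite_subring_containing:
  assumes "finite Y" "\<And>x. x \<in> Y \<Longrightarrow> algebraic_int x"
  shows "\<exists>R. finite_subring R \<and> Y \<subseteq> R"
  using assms
proof (induction Y)
  case empty
  thus ?case using finite_subring_Ints by auto
next
  case (insert x Y)
  then obtain R where R: "finite_subring R" "Y \<subseteq> R" by auto
  interpret subring_of_complex R using R by (simp add: finite_subring_def)
  obtain g where g: "poly (map_poly of_int g) x = 0" "lead_coeff g = 1"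
    using insert.prems by (auto simp: algebraic_int_altdef_ipoly)
  have "finite_subring (adjoin R x)"
    by (rule finite_subring_adjoin[OF R(1), of "map_poly of_int g"])
       (use g in \<open>auto simp: coeff_map_poly degree_map_poly\<close>)
  thus ?case using R base_subset_adjoin generator_in_adjoin by (intro exI[of _ "adjoin R x"]) auto
qed

lemma subring_algebraic_int: "subring_of_complex {x. algebraic_int x}"
proof
  show "1 \<in> {x :: complex. algebraic_int x}" by (auto intro: int_imp_algebraic_int)
next
  fix x y :: complex assume "x \<in> {x. algebraic_int x}" "y \<in> {x. algebraic_int x}"
  then obtain R where R: "finite_subring R" "{x, y} \<subseteq> R"
    using finite_subring_containing[of "{x, y}"] by auto
  interpret subring_of_complex R using R by (simp add: finite_subring_def)
  show "x - y \<in> {x. algebraic_int x}" "x * y \<in> {x. algebraic_int x}"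
    using R algebraic_int_finite_subring[OF R(1)] by auto
qed

text \<open>Integrality is transitive: the finitely many coefficients lie in one finitely generated ring, to which
  the root can be adjoined.\<close>

lemma algebraic_int_monic_root:
  assumes g: "\<And>i. algebraic_int (coeff g i)" "lead_coeff g = 1" "poly g (x :: complex) = 0"
  shows "algebraic_int x"
proof -
  obtain R where R: "finite_subring R" "coeff g ` {..degree g} \<subseteq> R"
    using finite_subring_containing[of "coeff g ` {..degree g}"] g by auto
  interpret subring_of_complex R using R by (simp add: finite_subring_def)
  have "coeff g i \<in> R" for i
    using R by (cases "i \<le> degree g") (auto simp: coeff_eq_0)
  hence "finite_subring (adjoin R x)" by (rule finite_subring_adjoin[OF R(1) _ g(2,3)])
  thus ?thesis using algebraic_int_finite_subring generator_in_adjoin by blast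
qed

section \<open>Generated fields and denominators\<close>

lemma ring_of_type_algebra_simps [simp]:
  "carrier (ring_of_type_algebra :: complex ring) = UNIV"
  "x \<otimes>\<^bsub>ring_of_type_algebra\<^esub> (y :: complex) = x * y"
  "\<one>\<^bsub>ring_of_type_algebra\<^esub> = (1 :: complex)"
  "\<zero>\<^bsub>ring_of_type_algebra\<^esub> = (0 :: complex)"
  "x \<oplus>\<^bsub>ring_of_type_algebra\<^esub> (y :: complex) = x + y"
  by (auto simp: ring_of_type_algebra_def)

lemma a_inv_ring_of_type_algebra: "\<ominus>\<^bsub>ring_of_type_algebra\<^esub> (x :: complex) = - x"
proof -
  interpret ring "ring_of_type_algebra :: complex ring" by (rule ring_from_type_algebra)
  show ?thesis using minus_equality[of "- x" x] by simp
qed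

lemma m_inv_ring_of_type_algebra:
  "x \<noteq> 0 \<Longrightarrow> inv\<^bsub>ring_of_type_algebra\<^esub> (x :: complex) = inverse x"
proof -
  assume "x \<noteq> 0"
  interpret cring "ring_of_type_algebra :: complex ring" by (rule cring_from_type_algebra)
  show ?thesis using comm_inv_char[of x "inverse x"] \<open>x \<noteq> 0\<close> by simp
qed

lemma subfield_field_gen: "subfield_of_complex (field_gen B)"
proof
  show "1 \<in> field_gen B"
    using generate_field.one[of ring_of_type_algebra B] by (simp add: field_gen_def)
next
  fix x y assume xy: "x \<in> field_gen B" "y \<in> field_gen B"
  show "x * y \<in> field_gen B"
    using xy generate_field.eng_mult[of x ring_of_type_algebra B y] by (simp add: field_gen_def)
  have "- y \<in> field_gen B"
    using xy generate_field.a_inv[of y ring_of_type_algebra B]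
    by (simp add: field_gen_def a_inv_ring_of_type_algebra)
  thus "x - y \<in> field_gen B"
    using xy generate_field.eng_add[of x ring_of_type_algebra B "- y"] by (simp add: field_gen_def)
next
  fix x assume x: "x \<in> field_gen B"
  show "inverse x \<in> field_gen B"
    using x generate_field.m_inv[of x ring_of_type_algebra B]
    by (cases "x = 0") (simp_all add: field_gen_def m_inv_ring_of_type_algebra)
qed

lemma field_gen_incl: "B \<subseteq> field_gen B"
  using generate_field.incl[of _ B ring_of_type_algebra] by (auto simp: field_gen_def)

lemma field_gen_minimal:
  assumes "subfield_of_complex F" "B \<subseteq> F"
  shows "field_gen B \<subseteq> F"
proof
  interpret subfield_of_complex F by fact
  fix x assume "x \<in> field_gen B"
  thus "x \<in> F" unfolding field_gen_def
  proof (induction rule: generate_field.induct)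
    case (m_inv h)
    thus ?case using inverse_closed[of h] by (simp add: m_inv_ring_of_type_algebra)
  next
    case (incl h)
    thus ?case using assms by auto
  qed (auto simp: a_inv_ring_of_type_algebra)
qed

text \<open>A relation of \<open>x\<close> with nonzero constant coefficient expresses the inverse of \<open>x\<close> as a polynomial
  in \<open>x\<close>. So rings such as \<open>\<rat>[\<zeta>]\<close> are fields without any use of minimal polynomials.\<close>

lemma subfield_of_algebraic_subring:
  assumes "subring_of_complex R" "\<rat> \<subseteq> R" "\<And>x. x \<in> R \<Longrightarrow> algebraic x"
  shows "subfield_of_complex R"
proof -
  interpret subring_of_complex R by fact
  have inv: "inverse x \<in> R" if "x \<in> R" "x \<noteq> 0" "poly f x = 0" "f \<noteq> 0" "\<forall>i. coeff f i \<in> \<int>" for x f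
    using that(3-5)
  proof (induction f)
    case (pCons a g)
    have aZ: "a \<in> \<int>" using pCons.prems(3)[THEN spec, of 0] by simp
    have gZ: "\<forall>i. coeff g i \<in> \<int>" using pCons.prems(3) by (metis coeff_pCons_Suc)
    show ?case
    proof (cases "a = 0")
      case True
      thus ?thesis using pCons gZ that(2) by auto
    next
      case False
      have "a + x * poly g x = 0" using pCons.prems by simp
      hence "inverse x = - (inverse a * poly g x)"
        using False that(2) by (simp add: field_simps eq_neg_iff_add_eq_0)
      moreover have "inverse a \<in> R"
        using aZ assms(2) Ints_subset_Rats Rats_inverse by blast
      moreover have "poly g x \<in> R"
      proof (intro poly_closed that(1))
        show "coeff g i \<in> R" for i
          using gZ[THEN spec, of i] by (auto elim!: Ints_cases)
      qed
      ultimately show ?thesis by auto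
    qed
  qed auto
  show ?thesis
  proof
    fix x assume x: "x \<in> R"
    show "inverse x \<in> R"
    proof (cases "x = 0")
      case False
      thus ?thesis using inv[OF x] assms(3)[OF x] by (auto elim!: algebraicE)
    qed auto
  qed
qed

lemma algebraic_if_multiple_algebraic_int:
  assumes "n > 0" "algebraic_int (of_nat n * x)"
  shows "algebraic (x :: complex)"
proof -
  obtain f where f: "poly (map_poly of_int f) (of_nat n * x) = 0" "lead_coeff f = 1"
    using assms by (auto simp: algebraic_int_altdef_ipoly)
  have "f \<circ>\<^sub>p [:0, int n:] \<noteq> 0"
    using assms f by (auto simp: pcompose_eq_0_iff)
  moreover have "poly (map_poly of_int (f \<circ>\<^sub>p [:0, int n:])) x = 0"
    using f by (simp add: of_int_hom.map_poly_pcompose poly_pcompose of_int_hom.map_poly_pCons_hom mult.commute)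
  ultimately show ?thesis
    by (intro algebraicI[of "map_poly of_int (f \<circ>\<^sub>p [:0, int n:])"]) (auto simp: coeff_map_poly)
qed

text \<open>Clearing denominators coefficient by coefficient. This provides the starting point for the
  determination of rings of integers up to \<open>lam\<close>.\<close>

lemma adjoin_denominator:
  assumes R0: "subring_of_complex R0"
    and den: "\<And>r. r \<in> R \<Longrightarrow> \<exists>n>0. of_nat n * r \<in> R0"
    and x: "x \<in> adjoin R y"
  shows "\<exists>n>0. of_nat n * x \<in> adjoin R0 y"
proof -
  interpret subring_of_complex R0 by fact
  interpret a: subring_of_complex "adjoin R0 y" by (rule subring_adjoin)
  obtain f where f: "x = poly f y" "\<forall>i. coeff f i \<in> R" using x by (auto simp: adjoin_def)
  have "\<exists>n>0. of_nat n * poly f y \<in> adjoin R0 y"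
    using f(2)
  proof (induction f)
    case 0
    thus ?case by (intro exI[of _ 1]) auto
  next
    case (pCons r f)
    have "r \<in> R" using pCons.prems[THEN spec, of 0] by simp
    then obtain m where m: "m > 0" "of_nat m * r \<in> R0" using den by blast
    have "\<forall>i. coeff f i \<in> R" using pCons.prems by (metis coeff_pCons_Suc)
    then obtain n where n: "n > 0" "of_nat n * poly f y \<in> adjoin R0 y"
      using pCons.IH by blast
    have "of_nat (m * n) * poly (pCons r f) y =
        of_nat n * (of_nat m * r) + of_nat m * (y * (of_nat n * poly f y))"
      by (simp add: algebra_simps)
    also have "\<dots> \<in> adjoin R0 y"
    proof -
      have "of_nat m * r \<in> adjoin R0 y" using m base_subset_adjoin by blast
      thus ?thesis
        by (intro a.add_closed[OF a.mult_closed[OF a.of_nat_closed]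
              a.mult_closed[OF a.of_nat_closed a.mult_closed[OF generator_in_adjoin n(2)]]])
    qed
    finally show ?case using m n by (intro exI[of _ "m * n"]) auto
  qed
  thus ?thesis using f by simp
qed

lemma Rats_denominator: "(x :: complex) \<in> \<rat> \<Longrightarrow> \<exists>n>0. of_nat n * x \<in> \<int>"
proof -
  assume "x \<in> \<rat>"
  then obtain a b where "b > 0" "x = of_int a / of_int b"
    by (metis Rats_cases')
  thus ?thesis by (intro exI[of _ "nat b"]) (auto simp: of_nat_nat)
qed

definition integers_of :: "complex set \<Rightarrow> complex set" where
  "integers_of F = {x \<in> F. algebraic_int x}"

lemma subring_integers_of:
  assumes "subring_of_complex F"
  shows "subring_of_complex (integers_of F)"
proof -
  interpret F: subring_of_complex F by fact
  interpret I: subring_of_complex "{x. algebraic_int x}" by (rule subring_algebraic_int)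
  show ?thesis
    by standard (use I.one_closed I.diff_closed I.mult_closed in \<open>auto simp: integers_of_def\<close>)
qed

lemma adjoin_subset:
  assumes "subring_of_complex T" "R \<subseteq> T" "x \<in> T"
  shows "adjoin R x \<subseteq> T"
proof
  fix y assume "y \<in> adjoin R x"
  then obtain f where "y = poly f x" "\<forall>i. coeff f i \<in> R" unfolding adjoin_def by blast
  thus "y \<in> T"
    using subring_of_complex.poly_closed[OF assms(1), of f x] assms(2,3) by blast
qed

section \<open>The cyclotomic field and its prime over \<open>p\<close>\<close>

locale cyclotomic =
  fixes p :: nat and \<zeta> lam :: complex
  assumes p_prime: "prime p" and p_odd: "odd p"
    and zeta_pow: "\<zeta> ^ p = 1" and zeta_ne_1: "\<zeta> \<noteq> 1"
    and lam_def: "lam = \<zeta> - 1"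
begin

lemma p_gt_2: "p > 2"
  using p_prime p_odd prime_ge_2_nat[OF p_prime] by (cases "p = 2") auto

lemma zeta_nonzero: "\<zeta> \<noteq> 0"
  using zeta_pow p_gt_2 by (auto simp: power_0_left)

lemma lam_nonzero: "lam \<noteq> 0"
  using zeta_ne_1 by (simp add: lam_def)

lemma zeta_pow_cong:
  assumes "[i = j] (mod p)"
  shows "\<zeta> ^ i = \<zeta> ^ j"
proof -
  have "\<zeta> ^ i = \<zeta> ^ (i mod p)" for i
  proof -
    have "\<zeta> ^ i = \<zeta> ^ (p * (i div p) + i mod p)" by simp
    also have "\<dots> = \<zeta> ^ (i mod p)" unfolding power_add power_mult zeta_pow by simp
    finally show ?thesis .
  qed
  thus ?thesis using assms by (metis Cong.cong_def)
qed

lemma zeta_pow_eq_1_iff: "\<zeta> ^ i = 1 \<longleftrightarrow> p dvd i"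
proof
  assume "p dvd i"
  thus "\<zeta> ^ i = 1" using zeta_pow by (auto simp: power_mult)
next
  assume i: "\<zeta> ^ i = 1"
  show "p dvd i"
  proof (rule ccontr)
    assume "\<not> p dvd i"
    hence "coprime i p" using coprime_nat_prime[OF p_prime] by blast
    then obtain x where "[i * x = 1] (mod p)" using cong_solve_coprime_nat by auto
    hence "\<zeta> ^ (i * x) = \<zeta> ^ 1" by (rule zeta_pow_cong)
    thus False using i zeta_ne_1 by (simp add: power_mult)
  qed
qed

lemma zeta_pow_eq_iff: "\<zeta> ^ i = \<zeta> ^ j \<longleftrightarrow> [i = j] (mod p)"
proof (induction i j rule: linorder_wlog)
  case (le i j)
  have "\<zeta> ^ j = \<zeta> ^ i * \<zeta> ^ (j - i)" using le by (simp flip: power_add)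
  hence "\<zeta> ^ i = \<zeta> ^ j \<longleftrightarrow> \<zeta> ^ (j - i) = 1" using zeta_nonzero by simp
  also have "\<dots> \<longleftrightarrow> [i = j] (mod p)"
    using le by (metis zeta_pow_eq_1_iff cong_altdef_nat cong_sym_eq)
  finally show ?case .
next
  case (sym i j)
  have "\<zeta> ^ i = \<zeta> ^ j \<longleftrightarrow> \<zeta> ^ j = \<zeta> ^ i" by (rule eq_commute)
  also have "\<dots> \<longleftrightarrow> [j = i] (mod p)" by (rule sym)
  also have "\<dots> \<longleftrightarrow> [i = j] (mod p)" by (rule cong_sym_eq)
  finally show ?case .
qed

definition Zzeta :: "complex set" where "Zzeta = adjoin \<int> \<zeta>"

lemma subring_Ints: "subring_of_complex \<int>"
  by standard auto

sublocale Zzeta: subring_of_complex Zzeta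
  unfolding Zzeta_def by (rule subring_of_complex.subring_adjoin[OF subring_Ints])

lemma zeta_in_Zzeta: "\<zeta> \<in> Zzeta"
  unfolding Zzeta_def by (rule subring_of_complex.generator_in_adjoin[OF subring_Ints])

lemma lam_in_Zzeta: "lam \<in> Zzeta"
  using zeta_in_Zzeta by (auto simp: lam_def)

lemma zeta_pow_minus_1: "\<zeta> ^ i - 1 = lam * (\<Sum>j<i. \<zeta> ^ j)"
  using geometric_sum[OF zeta_ne_1, of i] zeta_ne_1 by (simp add: lam_def)

lemma sum_zeta_pow_multiple: "(\<Sum>j<p. \<zeta> ^ (i * j)) = (if p dvd i then of_nat p else 0)"
proof (cases "p dvd i")
  case True
  hence "\<zeta> ^ (i * j) = 1" for j by (simp add: zeta_pow_eq_1_iff)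
  thus ?thesis using True by simp
next
  case False
  hence "\<zeta> ^ i \<noteq> 1" by (simp add: zeta_pow_eq_1_iff)
  moreover have "(\<zeta> ^ i) ^ p = 1" by (simp add: zeta_pow_eq_1_iff flip: power_mult)
  ultimately have "(\<Sum>j<p. (\<zeta> ^ i) ^ j) = 0" using geometric_sum[of "\<zeta> ^ i" p] by simp
  thus ?thesis using False by (simp add: power_mult)
qed

lemma all_roots_of_unity:
  assumes "x ^ p = 1"
  shows "\<exists>j<p. x = \<zeta> ^ j"
proof -
  have "inj_on (\<lambda>j. \<zeta> ^ j) {..<p}"
    by (auto simp: inj_on_def zeta_pow_eq_iff cong_less_modulus_unique_nat)
  hence "card ((\<lambda>j. \<zeta> ^ j) ` {..<p}) = p" by (simp add: card_image)
  moreover have "(\<lambda>j. \<zeta> ^ j) ` {..<p} \<subseteq> {z. z ^ p = 1}"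
    using zeta_pow by (auto simp: power_mult[symmetric] mult.commute[of _ p] power_mult)
  moreover have "card {z :: complex. z ^ p = 1} = p" "finite {z :: complex. z ^ p = 1}"
    using p_gt_2 by (auto intro: card_roots_unity_eq finite_roots_unity)
  ultimately have "(\<lambda>j. \<zeta> ^ j) ` {..<p} = {z. z ^ p = 1}"
    by (intro card_subset_eq) auto
  thus ?thesis using assms by auto
qed

text \<open>Evaluate the factorisation of \<open>1 + X + \<dots> + X\<^sup>p\<^sup>-\<^sup>1\<close> at 1.\<close>

lemma prod_one_minus_zeta_pow: "(\<Prod>i\<in>{1..<p}. 1 - \<zeta> ^ i) = of_nat p"
proof -
  define f where "f = (\<Prod>i\<in>{1..<p}. [:- (\<zeta> ^ i), 1:])"
  define g where "g = (\<Sum>i<p. monom (1 :: complex) i)"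
  have card: "card ((\<lambda>i. \<zeta> ^ i) ` {1..<p}) = p - 1"
    by (subst card_image) (auto simp: inj_on_def zeta_pow_eq_iff cong_less_modulus_unique_nat)
  have cg: "coeff g i = (if i < p then 1 else 0)" for i
    unfolding g_def by (simp add: coeff_sum)
  have dg: "degree g = p - 1"
  proof (rule antisym)
    show "degree g \<le> p - 1" using p_gt_2 by (intro degree_le) (auto simp: cg)
    show "p - 1 \<le> degree g" using p_gt_2 by (intro le_degree) (auto simp: cg)
  qed
  have df: "degree f = p - 1"
    unfolding f_def by (subst degree_prod_eq_sum_degree) auto
  have lf: "lead_coeff f = 1"
    unfolding f_def by (subst lead_coeff_prod) auto
  have "f = g"
  proof (rule ccontr)
    assume "f \<noteq> g"
    define h where "h = f - g"
    have h0: "h \<noteq> 0" using \<open>f \<noteq> g\<close> by (simp add: h_def)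
    have "degree h < p - 1"
    proof -
      have "degree h \<le> p - 1" unfolding h_def using df dg by (intro degree_diff_le) auto
      moreover have "coeff h (p - 1) = 0" using lf df cg p_gt_2 by (auto simp: h_def)
      ultimately show ?thesis using h0 by (metis le_neq_implies_less leading_coeff_0_iff)
    qed
    moreover have "(\<lambda>i. \<zeta> ^ i) ` {1..<p} \<subseteq> {x. poly h x = 0}"
    proof
      fix x assume "x \<in> (\<lambda>i. \<zeta> ^ i) ` {1..<p}"
      then obtain i where i: "i \<in> {1..<p}" "x = \<zeta> ^ i" by auto
      have "poly f x = 0" unfolding f_def using i by (auto simp: poly_prod)
      moreover have "poly g x = 0"
      proof -
        have "x \<noteq> 1" using i zeta_pow_eq_1_iff[of i] by (auto dest: dvd_imp_le)
        moreover have "x ^ p = 1" using i zeta_pow by (metis mult.commute power_mult power_one)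
        ultimately show ?thesis
          using geometric_sum[of x p] by (simp add: g_def poly_sum poly_monom)
      qed
      ultimately show "x \<in> {x. poly h x = 0}" by (simp add: h_def)
    qed
    hence "p - 1 \<le> card {x. poly h x = 0}"
      using card card_mono[OF poly_roots_finite[OF h0]] by metis
    hence "p - 1 \<le> degree h"
      using card_poly_roots_bound[OF h0] by linarith
    ultimately show False by linarith
  qed
  hence "poly f 1 = poly g 1" by simp
  thus ?thesis by (simp add: f_def g_def poly_prod poly_sum poly_monom)
qed

text \<open>The two numbers are inverse units. The first comes from the binomial expansion of \<open>(1 + lam)\<^sup>p = 1\<close>,
  which also shows its residue; the second from the product of the numbers \<open>1 - \<zeta>\<^sup>i\<close>. With the
  first, divisibility by \<open>lam\<^sup>p\<^sup>-\<^sup>1\<close> becomes divisibility by \<open>p\<close>; with the second, conversely. That \<open>u'\<close> is congruent to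
  \<open>-1\<close> is Wilson's theorem in disguise.\<close>

lemma unit_exists: "\<exists>u u'. u \<in> Zzeta \<and> u' \<in> Zzeta \<and> lam ^ (p - 1) = of_nat p * u \<and>
    of_nat p = lam ^ (p - 1) * u' \<and> (\<exists>s\<in>Zzeta. u' = lam * s - 1)"
proof -
  define u' where "u' = (\<Prod>i\<in>{1..<p}. - (\<Sum>j<i. \<zeta> ^ j))"
  have u'Z: "u' \<in> Zzeta"
    unfolding u'_def using zeta_in_Zzeta by auto
  have "of_nat p = (\<Prod>i\<in>{1..<p}. lam * (- (\<Sum>j<i. \<zeta> ^ j)))"
  proof -
    have "1 - \<zeta> ^ i = lam * (- (\<Sum>j<i. \<zeta> ^ j))" for i
      using zeta_pow_minus_1[of i] by (simp add: algebra_simps)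
    thus ?thesis using prod_one_minus_zeta_pow by simp
  qed
  also have "\<dots> = lam ^ (p - 1) * u'"
    by (simp add: prod.distrib u'_def del: mult_minus_right)
  finally have pu': "of_nat p = lam ^ (p - 1) * u'" .
  \<comment> \<open>the terms with \<open>2 \<le> j < p\<close> of the expansion, divided by \<open>p lam\<^sup>2\<close>\<close>
  define s where "s = (\<Sum>j\<in>{2..<p}. of_nat ((p choose j) div p) * lam ^ (j - 2))"
  have sZ: "s \<in> Zzeta" unfolding s_def using lam_in_Zzeta by auto
  define u where "u = - (1 + lam * s)"
  have uZ: "u \<in> Zzeta" unfolding u_def using sZ lam_in_Zzeta by auto
  have "1 = (lam + 1) ^ p" using zeta_pow by (simp add: lam_def)
  also have "\<dots> = (\<Sum>j\<le>p. of_nat (p choose j) * lam ^ j)"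
    by (subst binomial_ring) simp
  also have "{..p} = insert 0 (insert 1 (insert p {2..<p}))"
    using p_gt_2 by auto
  also have "(\<Sum>j\<in>insert 0 (insert 1 (insert p {2..<p})). of_nat (p choose j) * lam ^ j) =
      1 + (of_nat p * lam + (lam ^ p + (\<Sum>j\<in>{2..<p}. of_nat (p choose j) * lam ^ j)))"
    using p_gt_2 by (subst sum.insert; (subst sum.insert; (subst sum.insert)?)?) auto
  also have "(\<Sum>j\<in>{2..<p}. of_nat (p choose j) * lam ^ j) = of_nat p * lam * (lam * s)"
    unfolding s_def sum_distrib_left
  proof (rule sum.cong[OF refl])
    fix j assume j: "j \<in> {2..<p}"
    have "p dvd (p choose j)" using j by (intro prime_dvd_binomial p_prime) auto
    hence "(p choose j) = p * ((p choose j) div p)" by simp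
    hence "of_nat (p choose j) = (of_nat p * of_nat ((p choose j) div p) :: complex)"
      by (metis of_nat_mult)
    moreover have "lam ^ j = lam * lam * lam ^ (j - 2)"
      using j by (metis atLeastLessThan_iff le_add_diff_inverse power2_eq_square power_add)
    ultimately show "of_nat (p choose j) * lam ^ j =
        of_nat p * lam * (lam * (of_nat ((p choose j) div p) * lam ^ (j - 2)))"
      by simp
  qed
  finally have "lam ^ p = of_nat p * lam * u"
    by (simp add: u_def algebra_simps eq_neg_iff_add_eq_0)
  moreover have "lam ^ p = lam * lam ^ (p - 1)"
    using p_gt_2 by (metis less_nat_zero_code not_gr_zero power_eq_if)
  ultimately have pu: "lam ^ (p - 1) = of_nat p * u"
    using lam_nonzero by simp
  have "u * u' = 1"
    using pu pu' lam_nonzero p_gt_2 by (metis mult.assoc mult.commute mult_cancel_left1 power_not_zero)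
  hence "u' = lam * (- s * u') - 1"
    by (simp add: u_def algebra_simps) (metis add.commute diff_eq_eq minus_add_cancel)
  moreover have "- s * u' \<in> Zzeta" using sZ u'Z by auto
  ultimately show ?thesis using uZ u'Z pu pu' by blast
qed

definition u :: complex where "u = (SOME u. u \<in> Zzeta \<and> lam ^ (p - 1) = of_nat p * u)"
definition u' :: complex where
  "u' = (SOME u'. u' \<in> Zzeta \<and> of_nat p = lam ^ (p - 1) * u' \<and> (\<exists>s\<in>Zzeta. u' = lam * s - 1))"

lemma u: "u \<in> Zzeta" "lam ^ (p - 1) = of_nat p * u"
proof -
  have "\<exists>u. u \<in> Zzeta \<and> lam ^ (p - 1) = of_nat p * u" using unit_exists by blast
  from someI_ex[OF this] show "u \<in> Zzeta" "lam ^ (p - 1) = of_nat p * u"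
    unfolding u_def by simp_all
qed

lemma u': "u' \<in> Zzeta" "of_nat p = lam ^ (p - 1) * u'" "\<exists>s\<in>Zzeta. u' = lam * s - 1"
proof -
  have "\<exists>u'. u' \<in> Zzeta \<and> of_nat p = lam ^ (p - 1) * u' \<and> (\<exists>s\<in>Zzeta. u' = lam * s - 1)"
    using unit_exists by blast
  from someI_ex[OF this]
  show "u' \<in> Zzeta" "of_nat p = lam ^ (p - 1) * u'" "\<exists>s\<in>Zzeta. u' = lam * s - 1"
    unfolding u'_def by simp_all
qed

lemma algebraic_int_zeta: "algebraic_int \<zeta>"
proof (rule algebraic_int_monic_root[of "monom 1 p + [:- 1:]"])
  show "lead_coeff (monom 1 p + [:- 1:] :: complex poly) = 1"
  proof -
    have "degree (monom 1 p + [:- 1:] :: complex poly) = p"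
      using p_gt_2 by (subst degree_add_eq_left) (auto simp: degree_monom_eq)
    thus ?thesis using p_gt_2 by (simp add: coeff_pCons split: nat.split)
  qed
  show "algebraic_int (coeff (monom 1 p + [:- 1:] :: complex poly) i)" for i
    by (intro int_imp_algebraic_int) (auto simp: coeff_pCons split: nat.split)
  show "poly (monom 1 p + [:- 1:]) \<zeta> = 0" by (simp add: poly_monom zeta_pow)
qed

lemma Zzeta_algebraic_int: "x \<in> Zzeta \<Longrightarrow> algebraic_int x"
proof -
  have "Zzeta \<subseteq> {x. algebraic_int x}"
    unfolding Zzeta_def
    by (rule adjoin_subset[OF subring_algebraic_int])
       (auto intro: int_imp_algebraic_int algebraic_int_zeta)
  thus "x \<in> Zzeta \<Longrightarrow> algebraic_int x" by blast
qed

text \<open>The power \<open>n\<^sup>p\<^sup>-\<^sup>1\<close> is \<open>p\<close> times an algebraic integer; the quotient is rational, hence an integer.\<close>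

lemma p_dvd_if_lam_dvd:
  assumes "of_int n = lam * z" "algebraic_int z"
  shows "int p dvd n"
proof -
  interpret I: subring_of_complex "{x. algebraic_int x}" by (rule subring_algebraic_int)
  define q where "q = u * z ^ (p - 1)"
  have q: "of_int (n ^ (p - 1)) = of_nat p * q"
  proof -
    have "of_int (n ^ (p - 1)) = lam ^ (p - 1) * z ^ (p - 1)"
      using assms by (simp add: power_mult_distrib)
    thus ?thesis by (simp only: u(2) q_def mult.assoc)
  qed
  have "algebraic_int q"
    using I.mult_closed[of u "z ^ (p - 1)"] I.power_closed[of z "p - 1"] assms Zzeta_algebraic_int u
    unfolding q_def by blast
  moreover have "q = of_int (n ^ (p - 1)) / of_nat p"
    using p_gt_2 unfolding q by simp
  hence "q \<in> \<rat>" by (metis Rats_divide Rats_of_int Rats_of_nat)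
  ultimately obtain m where "q = of_int m"
    using rational_algebraic_int_is_int[of q] by (auto elim: Ints_cases)
  hence "of_int (n ^ (p - 1)) = (of_int (int p * m) :: complex)"
    using q by simp
  hence "n ^ (p - 1) = int p * m" by (simp only: of_int_eq_iff)
  hence "int p dvd n ^ (p - 1)" by simp
  moreover have "prime (int p)" using p_prime by simp
  ultimately show ?thesis by (rule prime_dvd_power[rotated])
qed

lemma lam_dvd_p: "of_nat p = lam * (lam ^ (p - 2) * u')"
proof -
  have "p - 1 = Suc (p - 2)" using p_gt_2 by linarith
  hence "lam ^ (p - 1) = lam * lam ^ (p - 2)" by simp
  thus ?thesis using u'(2) by (simp only: mult.assoc)
qed

text \<open>An order \<open>R\<close> in a ring of integers \<open>C\<close> represents all residues modulo \<open>lam\<close> as soon as it is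
  saturated at \<open>lam\<close>: in a multiple \<open>n x\<close> lying in \<open>R\<close> the part of \<open>n\<close> that is a power of \<open>p\<close> can be
  cancelled by saturation, and the part prime to \<open>p\<close> is invertible modulo \<open>p\<close>. This replaces
  discriminants, for \<open>K\<close> as well as for \<open>S\<close>.\<close>

lemma residues_from_order:
  assumes R: "subring_of_complex R" and C: "subring_of_complex C"
    and sub: "Zzeta \<subseteq> R" "R \<subseteq> C"
    and den: "\<And>x. x \<in> C \<Longrightarrow> \<exists>n>0. of_nat n * x \<in> R"
    and sat: "\<And>y. y \<in> C \<Longrightarrow> lam * y \<in> R \<Longrightarrow> y \<in> R"
    and x: "x \<in> C"
  shows "\<exists>r\<in>R. \<exists>z\<in>C. x = r + lam * z"
proof -
  interpret R: subring_of_complex R by fact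
  interpret C: subring_of_complex C by fact
  have lamR: "lam \<in> R" and lamC: "lam \<in> C" and uR: "u \<in> R" and u'C: "u' \<in> C"
    using lam_in_Zzeta u u' sub by auto
  have sat': "y \<in> C \<Longrightarrow> lam ^ k * y \<in> R \<Longrightarrow> y \<in> R" for y k
  proof (induction k)
    case (Suc k)
    have "lam ^ k * y \<in> C" by (rule C.mult_closed[OF C.power_closed[OF lamC] Suc.prems(1)])
    moreover have "lam * (lam ^ k * y) \<in> R" using Suc.prems(2) by (simp add: mult.assoc)
    ultimately have "lam ^ k * y \<in> R" by (rule sat)
    thus ?case by (rule Suc.IH[OF Suc.prems(1)])
  qed simp
  have satp: "y \<in> C \<Longrightarrow> of_nat p ^ k * y \<in> R \<Longrightarrow> y \<in> R" for y k
  proof (induction k)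
    case (Suc k)
    have "lam ^ (p - 1) * (of_nat p ^ k * y) = u * (of_nat p ^ Suc k * y)"
      by (subst u(2)) (simp add: algebra_simps)
    also have "\<dots> \<in> R" by (rule R.mult_closed[OF uR Suc.prems(2)])
    finally have "of_nat p ^ k * y \<in> R"
      by (rule sat'[OF C.mult_closed[OF C.power_closed[OF C.of_nat_closed] Suc.prems(1)]])
    thus ?case by (rule Suc.IH[OF Suc.prems(1)])
  qed simp
  obtain n where n: "n > 0" "of_nat n * x \<in> R" using den[OF x] by blast
  have "n \<noteq> 0" "\<not> is_unit p" using n p_prime not_prime_unit by auto
  then obtain m where km: "n = p ^ multiplicity p n * m" "\<not> p dvd m"
    using multiplicity_decompose'[of n p] by blast
  have mx: "of_nat m * x \<in> R"
  proof (rule satp)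
    show "of_nat m * x \<in> C" using x by blast
    have "of_nat p ^ multiplicity p n * (of_nat m * x) = of_nat (p ^ multiplicity p n * m) * x"
      by simp
    thus "of_nat p ^ multiplicity p n * (of_nat m * x) \<in> R"
      using n(2) km(1) by metis
  qed
  have "coprime (int m) (int p)"
    using km p_prime by (metis coprime_commute coprime_int_iff prime_imp_coprime)
  then obtain a b where ab: "a * int m + b * int p = 1"
    by (metis bezout_int coprime_imp_gcd_eq_1)
  have "x = of_int (a * int m + b * int p) * x" by (simp only: ab) simp
  also have "\<dots> = of_int a * (of_nat m * x) + lam * (lam ^ (p - 2) * u' * (of_int b * x))"
    using lam_dvd_p by (simp add: algebra_simps)
  finally show ?thesis
    by (metis R.mult_closed[OF R.of_int_closed mx] C.mult_closed[OF C.mult_closed[OF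
        C.power_closed[OF lamC] u'C] C.mult_closed[OF C.of_int_closed x]])
qed

definition K :: "complex set" where "K = adjoin \<rat> \<zeta>"

lemma subring_Rats: "subring_of_complex \<rat>"
  by standard auto

lemma K_denominator: "x \<in> K \<Longrightarrow> \<exists>n>0. of_nat n * x \<in> Zzeta"
  unfolding Zzeta_def K_def by (rule adjoin_denominator[OF subring_Ints Rats_denominator])

sublocale K: subfield_of_complex K
proof (rule subfield_of_algebraic_subring)
  show "subring_of_complex K"
    unfolding K_def by (rule subring_of_complex.subring_adjoin[OF subring_Rats])
  show "\<rat> \<subseteq> K"
    unfolding K_def by (rule subring_of_complex.base_subset_adjoin[OF subring_Rats])
  show "algebraic x" if "x \<in> K" for x
    using K_denominator[OF that] algebraic_if_multiple_algebraic_int Zzeta_algebraic_int by blast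
qed

lemma zeta_in_K: "\<zeta> \<in> K"
  unfolding K_def by (rule subring_of_complex.generator_in_adjoin[OF subring_Rats])

lemma Zzeta_subset_K: "Zzeta \<subseteq> K"
  unfolding Zzeta_def
proof (rule adjoin_subset[OF K.subring_of_complex_axioms _ zeta_in_K])
  show "\<int> \<subseteq> K" using K.of_int_closed by (auto elim!: Ints_cases)
qed

lemma K_eq_field_gen: "field_gen {\<zeta>} = K"
proof
  show "field_gen {\<zeta>} \<subseteq> K"
    by (rule field_gen_minimal[OF K.subfield_of_complex_axioms]) (use zeta_in_K in auto)
  interpret F: subfield_of_complex "field_gen {\<zeta>}" by (rule subfield_field_gen)
  show "K \<subseteq> field_gen {\<zeta>}"
    unfolding K_def using F.Rats_subset field_gen_incl[of "{\<zeta>}"]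
    by (intro adjoin_subset F.subring_of_complex_axioms) auto
qed

sublocale OK: subring_of_complex "integers_of K"
  by (rule subring_integers_of[OF K.subring_of_complex_axioms])

text \<open>The prime \<open>lam\<close> of \<open>K\<close> has residue field of \<open>p\<close> elements. The order \<open>\<int>[\<zeta>]\<close> is saturated because
  its elements are integers modulo \<open>lam\<close>, and an integer divisible by \<open>lam\<close> is divisible by \<open>p\<close>.\<close>

lemma integers_K_residue:
  assumes "x \<in> integers_of K"
  shows "\<exists>n. \<exists>z\<in>integers_of K. x = of_int n + lam * z"
proof -
  have ZO: "Zzeta \<subseteq> integers_of K"
    using Zzeta_subset_K Zzeta_algebraic_int by (auto simp: integers_of_def)
  have Zzeta_res: "\<exists>n. \<exists>z\<in>Zzeta. x = of_int n + lam * z" if xZ: "x \<in> Zzeta" for x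
  proof -
    obtain f where f: "x = poly f \<zeta>" "\<forall>i. coeff f i \<in> \<int>"
      using xZ unfolding Zzeta_def adjoin_def by blast
    have "\<exists>n. \<exists>z\<in>Zzeta. poly f \<zeta> = of_int n + lam * z"
      using f(2)
    proof (induction f)
      case 0
      thus ?case by (intro exI[of _ 0] bexI[of _ 0]) auto
    next
      case (pCons a f)
      have "a \<in> \<int>" using pCons.prems[THEN spec, of 0] by simp
      then obtain m where m: "a = of_int m" by (auto elim: Ints_cases)
      have "\<forall>i. coeff f i \<in> \<int>" using pCons.prems by (metis coeff_pCons_Suc)
      then obtain n z where nz: "z \<in> Zzeta" "poly f \<zeta> = of_int n + lam * z"
        using pCons.IH by blast
      have "poly (pCons a f) \<zeta> = of_int (m + n) + lam * (of_int n + \<zeta> * z)"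
        by (simp add: m nz lam_def algebra_simps)
      moreover have "of_int n + \<zeta> * z \<in> Zzeta" using nz zeta_in_Zzeta by auto
      ultimately show ?case by blast
    qed
    thus ?thesis using f by simp
  qed
  have "\<exists>r\<in>Zzeta. \<exists>z\<in>integers_of K. x = r + lam * z"
  proof (rule residues_from_order[OF Zzeta.subring_of_complex_axioms OK.subring_of_complex_axioms subset_refl ZO _ _ assms])
    show "\<exists>n>0. of_nat n * x \<in> Zzeta" if "x \<in> integers_of K" for x
      using that K_denominator by (auto simp: integers_of_def)
    fix y assume y: "y \<in> integers_of K" "lam * y \<in> Zzeta"
    obtain n z where nz: "z \<in> Zzeta" "lam * y = of_int n + lam * z" using Zzeta_res[OF y(2)] by blast
    have "of_int n = lam * (y - z)" using nz by (simp add: algebra_simps)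
    moreover have "y - z \<in> integers_of K" using y nz ZO by auto
    ultimately have "int p dvd n" using p_dvd_if_lam_dvd by (auto simp: integers_of_def)
    then obtain m where "n = int p * m" by auto
    hence "lam * y = lam * (lam ^ (p - 2) * u' * of_int m + z)"
      using nz lam_dvd_p by (simp add: algebra_simps)
    hence "y = lam ^ (p - 2) * u' * of_int m + z" using lam_nonzero by simp
    thus "y \<in> Zzeta" using u' lam_in_Zzeta nz by auto
  qed
  then obtain r z where rz: "r \<in> Zzeta" "z \<in> integers_of K" "x = r + lam * z" by blast
  obtain n z' where "z' \<in> Zzeta" "r = of_int n + lam * z'" using Zzeta_res[OF rz(1)] by blast
  hence "x = of_int n + lam * (z + z')" "z + z' \<in> integers_of K"
    using rz ZO by (auto simp: algebra_simps)
  thus ?thesis by blast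
qed

end

section \<open>Endomorphisms of a field\<close>

text \<open>A map on all complex numbers that is a ring homomorphism on the set \<open>F\<close>; nothing is known about it
  elsewhere, and therefore every law carries membership assumptions.\<close>

locale subfield_endo = subfield_of_complex F for F +
  fixes f :: "complex \<Rightarrow> complex"
  assumes closed [intro]: "x \<in> F \<Longrightarrow> f x \<in> F"
    and add: "x \<in> F \<Longrightarrow> y \<in> F \<Longrightarrow> f (x + y) = f x + f y"
    and mult: "x \<in> F \<Longrightarrow> y \<in> F \<Longrightarrow> f (x * y) = f x * f y"
    and one [simp]: "f 1 = 1"
begin

lemma zero [simp]: "f 0 = 0"
  using add[OF zero_closed zero_closed] by simp

lemma uminus: "x \<in> F \<Longrightarrow> f (- x) = - f x"
  using add[of x "- x"] uminus_closed[of x] by (simp add: add_eq_0_iff)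

lemma diff: "x \<in> F \<Longrightarrow> y \<in> F \<Longrightarrow> f (x - y) = f x - f y"
  using add[of x "- y"] uminus[of y] uminus_closed[of y] by simp

lemma of_nat [simp]: "f (of_nat n) = of_nat n"
  by (induction n) (simp_all add: add)

lemma of_int [simp]: "f (of_int n) = of_int n"
proof (cases n)
  case (neg m)
  hence "of_int n = (- of_nat (Suc m) :: complex)" by simp
  thus ?thesis using uminus[OF of_nat_closed, of "Suc m"] of_nat[of "Suc m"] by (simp only:)
qed simp

lemma power: "x \<in> F \<Longrightarrow> f (x ^ n) = f x ^ n"
  by (induction n) (simp_all add: mult power_closed)

lemma sum: "(\<And>i. i \<in> I \<Longrightarrow> g i \<in> F) \<Longrightarrow> f (sum g I) = (\<Sum>i\<in>I. f (g i))"
  by (induction I rule: infinite_finite_induct) (simp_all add: add sum_closed)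

lemma prod: "(\<And>i. i \<in> I \<Longrightarrow> g i \<in> F) \<Longrightarrow> f (prod g I) = (\<Prod>i\<in>I. f (g i))"
  by (induction I rule: infinite_finite_induct) (simp_all add: mult prod_closed)

lemma inverse: "x \<in> F \<Longrightarrow> f (inverse x) = inverse (f x)"
proof (cases "x = 0")
  case False
  assume x: "x \<in> F"
  have "f x * f (inverse x) = f (x * inverse x)" by (rule mult[symmetric, OF x inverse_closed[OF x]])
  also have "\<dots> = 1" using False by simp
  finally show ?thesis by (metis inverse_unique)
qed simp

lemma divide: "x \<in> F \<Longrightarrow> y \<in> F \<Longrightarrow> f (x / y) = f x / f y"
  using mult[of x "inverse y"] inverse[of y] inverse_closed[of y] by (simp add: divide_inverse)

lemma poly: "(\<And>i. coeff g i \<in> F) \<Longrightarrow> (\<And>i. f (coeff g i) = coeff g i) \<Longrightarrow> x \<in> F \<Longrightarrow>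
    f (poly g x) = poly g (f x)"
  by (simp add: poly_altdef sum mult mult_closed power_closed power)

lemma Rats: "x \<in> \<rat> \<Longrightarrow> f x = x"
  by (erule Rats_cases') (simp add: divide)

lemma algebraic_int: "x \<in> F \<Longrightarrow> algebraic_int x \<Longrightarrow> algebraic_int (f x)"
proof -
  assume x: "x \<in> F" "algebraic_int x"
  then obtain g where g: "poly (map_poly of_int g) x = 0" "lead_coeff g = 1"
    by (auto simp: algebraic_int_altdef_ipoly)
  have "poly (map_poly of_int g) (f x) = f (poly (map_poly of_int g) x)"
    by (rule poly[symmetric]) (simp_all add: coeff_map_poly x)
  thus ?thesis using g by (auto simp: algebraic_int_altdef_ipoly)
qed

lemma funpow: "subfield_endo F (f ^^ n)"
proof (induction n)
  case 0
  show ?case by standard auto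
next
  case (Suc n)
  interpret g: subfield_endo F "f ^^ n" by fact
  show ?case
    by standard (simp_all add: closed g.closed add g.add mult g.mult)
qed

lemma compose:
  assumes "subfield_endo F g"
  shows "subfield_endo F (\<lambda>x. f (g x))"
proof -
  interpret g: subfield_endo F g by fact
  show ?thesis
    by standard (simp_all add: closed g.closed add g.add mult g.mult)
qed

lemma funpow_closed: "x \<in> F \<Longrightarrow> (f ^^ n) x \<in> F"
  by (induction n) auto

lemma funpow_fixed: "f x = x \<Longrightarrow> (f ^^ n) x = x"
  by (induction n) auto

text \<open>An endomorphism acts on the coefficients of a polynomial through its roots.\<close>

lemma coeff_prod_linear:
  assumes "finite J" "\<And>j. j \<in> J \<Longrightarrow> a j \<in> F"
  shows "coeff (\<Prod>j\<in>J. [:- a j, 1:]) i \<in> F \<and>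
    f (coeff (\<Prod>j\<in>J. [:- a j, 1:]) i) = coeff (\<Prod>j\<in>J. [:- f (a j), 1:]) i"
  using assms
proof (induction J arbitrary: i)
  case empty
  show ?case by (cases "i = 0") (simp_all add: coeff_1)
next
  case (insert x J)
  let ?P = "\<Prod>j\<in>J. [:- a j, 1:]" and ?Q = "\<Prod>j\<in>J. [:- f (a j), 1:]"
  have IH: "coeff ?P i \<in> F" "f (coeff ?P i) = coeff ?Q i" for i
    using insert by auto
  have ax: "a x \<in> F" using insert by auto
  have shift: "coeff ([:c, 1:] * P) i = c * coeff P i + (if i = 0 then 0 else coeff P (i - 1))"
    for c :: complex and P
    by (cases i) (simp_all add: coeff_pCons)
  have mF: "- a x * coeff ?P i \<in> F" for i
    by (rule mult_closed[OF uminus_closed[OF ax] IH(1)])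
  have fm: "f (- a x * coeff ?P i) = - f (a x) * coeff ?Q i" for i
    by (simp only: mult[OF uminus_closed[OF ax] IH(1)] uminus[OF ax] IH(2))
  have "coeff ([:- a x, 1:] * ?P) i \<in> F"
    unfolding shift using mF[of i] IH(1)[of "i - 1"]
    by (cases "i = 0") (simp_all only: simp_thms if_True if_False add_0_right add_closed)
  moreover have "f (coeff ([:- a x, 1:] * ?P) i) = coeff ([:- f (a x), 1:] * ?Q) i"
    unfolding shift using add[OF mF[of i] IH(1)[of "i - 1"]] fm[of i] IH(2)[of "i - 1"]
    by (cases "i = 0") (simp_all only: simp_thms if_True if_False add_0_right)
  ultimately show ?case using insert by simp
qed

end

lemma endo_unique:
  assumes f: "subfield_endo S f" and g: "subfield_endo S g"
    and K: "subring_of_complex K" "K \<subseteq> S" "w \<in> S"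
    and eq: "\<And>x. x \<in> K \<Longrightarrow> f x = g x" "f w = g w"
    and x: "x \<in> adjoin K w"
  shows "f x = g x"
proof -
  interpret f: subfield_endo S f by fact
  interpret g: subfield_endo S g by fact
  obtain h where h: "x = poly h w" "\<And>i. coeff h i \<in> K" using x by (auto simp: adjoin_def)
  have hS: "coeff h i \<in> S" for i using h K by auto
  have "f (poly h w) = (\<Sum>i\<le>degree h. f (coeff h i) * f w ^ i)"
    using hS K by (simp add: poly_altdef f.sum f.mult f.power_closed f.mult_closed f.power)
  moreover have "g (poly h w) = (\<Sum>i\<le>degree h. g (coeff h i) * g w ^ i)"
    using hS K by (simp add: poly_altdef g.sum g.mult f.power_closed f.mult_closed g.power)
  ultimately show ?thesis using h eq by simp
qed

text \<open>Conjugation by \<open>\<sigma>\<close> permutes the powers of \<open>\<theta>\<close> in this way.\<close>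

lemma bij_betw_mult_mod:
  fixes c p :: nat
  assumes "coprime c p" "p > 0"
  shows "bij_betw (\<lambda>i. (c * i + b) mod p) {..<p} {..<p}"
proof -
  have inj: "inj_on (\<lambda>i. (c * i + b) mod p) {..<p}"
  proof (rule inj_onI)
    fix i j assume ij: "i \<in> {..<p}" "j \<in> {..<p}" "(c * i + b) mod p = (c * j + b) mod p"
    hence "[c * i = c * j] (mod p)" by (metis Cong.cong_def cong_add_rcancel_nat)
    hence "[i = j] (mod p)" by (simp only: cong_mult_lcancel_nat[OF assms(1)])
    thus "i = j" using ij cong_less_modulus_unique_nat by auto
  qed
  moreover have "(\<lambda>i. (c * i + b) mod p) ` {..<p} \<subseteq> {..<p}" using assms by auto
  ultimately have "(\<lambda>i. (c * i + b) mod p) ` {..<p} = {..<p}"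
    by (intro card_subset_eq) (simp_all add: card_image)
  thus ?thesis using inj by (simp add: bij_betw_def)
qed

lemma funpow_mod_period: "f ^^ p = g \<Longrightarrow> (\<And>x. x \<in> Y \<Longrightarrow> g x = x) \<Longrightarrow> x \<in> Y \<Longrightarrow>
    (f ^^ i) x = (f ^^ (i mod p)) (x :: 'a)"
proof -
  assume fg: "f ^^ p = g" "\<And>x. x \<in> Y \<Longrightarrow> g x = x" "x \<in> Y"
  have "((f ^^ p) ^^ n) x = x" for n using fg by (induction n) auto
  moreover have "f ^^ i = (f ^^ (i mod p)) \<circ> ((f ^^ p) ^^ (i div p))"
    by (metis funpow_mult funpow_add mod_mult_div_eq mult.commute)
  ultimately show ?thesis by simp
qed

section \<open>The Kummer extension\<close>

locale kummer = cyclotomic +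
  fixes A \<omega> :: complex
  assumes A_in: "A \<in> integers_of K" and A_not_power: "\<not> (\<exists>x\<in>K. x ^ p = A)"
    and omega_pow: "\<omega> ^ p = A"
begin

definition S :: "complex set" where "S = adjoin K \<omega>"

lemma A_in_K: "A \<in> K" and A_algebraic_int: "algebraic_int A"
  using A_in by (auto simp: integers_of_def)

lemma A_nonzero: "A \<noteq> 0"
proof
  assume "A = 0"
  hence "0 \<in> K \<and> 0 ^ p = A" using p_gt_2 by simp
  thus False using A_not_power by blast
qed

lemma omega_nonzero: "\<omega> \<noteq> 0"
  using omega_pow A_nonzero p_gt_2 by (auto simp: power_0_left)

lemma degree_Kummer_poly: "degree (monom 1 p + [:- A:]) = p"
  and lead_coeff_Kummer_poly: "lead_coeff (monom 1 p + [:- A:]) = 1"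
  and coeff_Kummer_poly: "coeff (monom 1 p + [:- A:]) i \<in> integers_of K"
proof -
  show d: "degree (monom 1 p + [:- A:]) = p"
    using p_gt_2 by (subst degree_add_eq_left) (auto simp: degree_monom_eq)
  show "lead_coeff (monom 1 p + [:- A:]) = 1"
    using p_gt_2 unfolding d by (simp add: coeff_pCons split: nat.split)
  show "coeff (monom 1 p + [:- A:]) i \<in> integers_of K"
    using OK.uminus_closed[OF A_in] p_gt_2 by (cases i) (simp_all add: coeff_pCons)
qed

lemma coeff_Kummer_poly_K: "coeff (monom 1 p + [:- A:]) i \<in> K"
  using coeff_Kummer_poly by (simp add: integers_of_def)

lemma omega_algebraic_int: "algebraic_int \<omega>"
  by (rule algebraic_int_monic_root[OF _ lead_coeff_Kummer_poly])
     (use coeff_Kummer_poly in \<open>auto simp: integers_of_def poly_monom omega_pow\<close>)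

lemma S_denominator: "x \<in> S \<Longrightarrow> \<exists>n>0. of_nat n * x \<in> adjoin Zzeta \<omega>"
  unfolding S_def by (rule adjoin_denominator[OF Zzeta.subring_of_complex_axioms K_denominator])

sublocale S: subfield_of_complex S
proof (rule subfield_of_algebraic_subring)
  show "subring_of_complex S" unfolding S_def by (rule K.subring_adjoin)
  show "\<rat> \<subseteq> S" unfolding S_def using K.Rats_subset K.base_subset_adjoin by blast
  show "algebraic x" if "x \<in> S" for x
  proof -
    have "adjoin Zzeta \<omega> \<subseteq> {x. algebraic_int x}"
      by (rule adjoin_subset[OF subring_algebraic_int]) (auto intro: Zzeta_algebraic_int omega_algebraic_int)
    thus ?thesis using S_denominator[OF that] algebraic_if_multiple_algebraic_int by blast
  qed
qed

lemma K_subset_S: "K \<subseteq> S"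
  unfolding S_def by (rule K.base_subset_adjoin)

lemma omega_in_S: "\<omega> \<in> S"
  unfolding S_def by (rule K.generator_in_adjoin)

lemma S_eq_field_gen: "field_gen (insert \<omega> K) = S"
proof
  show "field_gen (insert \<omega> K) \<subseteq> S"
    by (rule field_gen_minimal[OF S.subfield_of_complex_axioms]) (use omega_in_S K_subset_S in auto)
  interpret F: subfield_of_complex "field_gen (insert \<omega> K)" by (rule subfield_field_gen)
  show "S \<subseteq> field_gen (insert \<omega> K)"
    unfolding S_def using field_gen_incl[of "insert \<omega> K"]
    by (intro adjoin_subset F.subring_of_complex_axioms) auto
qed

text \<open>A polynomial of minimal degree \<open>m\<close> over \<open>K\<close> with root \<open>\<omega>\<close> divides \<open>X\<^sup>p - A\<close>, so its
  constant coefficient is up to sign a product of \<open>m\<close> roots of \<open>X\<^sup>p - A\<close> and its \<open>p\<close>-th power is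
  up to sign \<open>A\<^sup>m\<close>. If \<open>0 < m < p\<close>, then \<open>A\<close> itself would be a \<open>p\<close>-th power in \<open>K\<close>.\<close>

lemma omega_independent:
  assumes "\<And>i. coeff f i \<in> K" "poly f \<omega> = 0" "degree f < p"
  shows "f = 0"
proof (rule ccontr)
  assume f0: "f \<noteq> 0"
  let ?P = "\<lambda>h. (\<forall>i. coeff h i \<in> K) \<and> poly h \<omega> = 0 \<and> h \<noteq> 0"
  have "?P f" using assms f0 by blast
  then obtain h where h: "?P h" "\<And>h'. ?P h' \<Longrightarrow> degree h \<le> degree h'"
    using ex_has_least_nat[of ?P f degree] by blast
  have dh: "degree h < p" using h(2)[OF \<open>?P f\<close>] assms by linarith
  define g where "g = smult (inverse (lead_coeff h)) h"
  have gK: "coeff g i \<in> K" for i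
    unfolding g_def using h K.mult_closed K.inverse_closed by simp
  have g1: "lead_coeff g = 1" and g\<omega>: "poly g \<omega> = 0" and dg: "degree g = degree h"
    unfolding g_def using h by simp_all
  have "degree g > 0"
  proof (rule ccontr)
    assume "\<not> degree g > 0"
    then obtain c where "g = [:c:]" by (auto elim: degree_eq_zeroE)
    thus False using g1 g\<omega> by simp
  qed
  obtain q r where qr: "monom 1 p + [:- A:] = q * g + r" "\<forall>i. coeff r i \<in> K"
      "r = 0 \<or> degree r < degree g"
    using K.monic_division[of g "monom 1 p + [:- A:]"] gK g1 coeff_Kummer_poly_K by blast
  have "poly r \<omega> = poly (monom 1 p + [:- A:]) \<omega> - poly q \<omega> * poly g \<omega>"
    unfolding qr(1) by simp
  also have "\<dots> = 0" using g\<omega> by (simp add: poly_monom omega_pow)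
  finally have "r = 0" using h(2)[of r] qr dg by fastforce
  hence roots: "a ^ p = A" if "poly g a = 0" for a
  proof -
    have "poly (monom 1 p + [:- A:]) a = 0" using \<open>r = 0\<close> qr that by simp
    thus ?thesis by (simp add: poly_monom)
  qed
  define m where "m = degree g"
  obtain as where as: "smult (coeff g m) (\<Prod>a\<leftarrow>as. [:- a, 1:]) = g" "length as = m"
    using fundamental_theorem_algebra_factorized[of g] unfolding m_def by auto
  have g_as: "g = (\<Prod>a\<leftarrow>as. [:- a, 1:])" using as g1 by (simp add: m_def)
  have "a ^ p = A" if "a \<in> set as" for a
  proof -
    have "poly g a = 0" unfolding g_as using that
      by (induction as) auto
    thus ?thesis by (rule roots)
  qed
  hence "(\<Prod>a\<leftarrow>as. - a) ^ p = (- A) ^ length as"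
    using p_odd by (induction as) (auto simp: power_mult_distrib)
  moreover have "poly g 0 = (\<Prod>a\<leftarrow>as. - a)"
    unfolding g_as by (induction as) auto
  ultimately have gp: "poly g 0 ^ p = (- A) ^ m" using as by simp
  \<comment> \<open>the sign absorbs \<open>(-1)\<^sup>m\<close>, as \<open>p\<close> is odd\<close>
  define B where "B = (- 1) ^ m * poly g 0"
  have BK: "B \<in> K"
    unfolding B_def poly_0_coeff_0 by (rule K.mult_closed[OF K.power_closed[OF K.uminus_closed[OF K.one_closed]] gK])
  have "B ^ p = ((- 1) ^ p) ^ m * (- A) ^ m"
    unfolding B_def power_mult_distrib gp by (simp add: mult.commute flip: power_mult)
  also have "\<dots> = A ^ m" using p_odd by (simp flip: power_mult_distrib)
  finally have Bp: "B ^ p = A ^ m" .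
  have "\<not> p dvd m" using \<open>degree g > 0\<close> dh dg by (auto simp: m_def dest: dvd_imp_le)
  hence "coprime m p" using coprime_nat_prime[OF p_prime] by blast
  then obtain x where x: "[m * x = 1] (mod p)" using cong_solve_coprime_nat by auto
  have "m * x \<noteq> 0"
  proof
    assume "m * x = 0"
    hence "[0 = 1] (mod p)" using x by metis
    thus False using p_gt_2 by (simp add: Cong.cong_def)
  qed
  hence "1 \<le> m * x" by simp
  then obtain y where y: "m * x = 1 + p * y"
    using x cong_le_nat[of 1 "m * x" p] by (metis cong_sym_eq mult.commute add.commute)
  have "(B ^ x) ^ p = A ^ (m * x)" by (metis Bp mult.commute power_mult)
  also have "\<dots> = A * (A ^ y) ^ p" by (simp only: y power_add power_one_right mult.commute[of p] power_mult)
  finally have "(B ^ x / A ^ y) ^ p = A" using A_nonzero by (simp add: power_divide)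
  moreover have "B ^ x / A ^ y \<in> K"
    by (rule K.divide_closed[OF K.power_closed[OF BK] K.power_closed[OF A_in_K]])
  ultimately show False using A_not_power by blast
qed

lemma root_conjugate:
  assumes "\<And>i. coeff f i \<in> K" "poly f \<omega> = 0" "x ^ p = A"
  shows "poly f x = 0"
proof -
  obtain q r where qr: "f = q * (monom 1 p + [:- A:]) + r" "\<forall>i. coeff r i \<in> K"
      "r = 0 \<or> degree r < p"
    using K.monic_division[OF coeff_Kummer_poly_K lead_coeff_Kummer_poly assms(1)]
    unfolding degree_Kummer_poly by blast
  have "poly r \<omega> = 0" using assms(2) unfolding qr(1) by (simp add: poly_monom omega_pow)
  hence "r = 0" using omega_independent[of r] qr by blast
  thus ?thesis unfolding qr(1) using assms(3) by (simp add: poly_monom)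
qed

text \<open>The automorphism over \<open>K\<close> with \<open>\<omega> \<mapsto> \<zeta> \<omega>\<close>. Independence of the representing polynomial is
  the content of \<open>root_conjugate\<close>.\<close>

definition \<theta> :: "complex \<Rightarrow> complex" where
  "\<theta> x = poly (SOME f. (\<forall>i. coeff f i \<in> K) \<and> poly f \<omega> = x) (\<zeta> * \<omega>)"

lemma zeta_omega_pow: "(\<zeta> * \<omega>) ^ p = A"
  by (simp add: power_mult_distrib zeta_pow omega_pow)

lemma theta_poly: "(\<And>i. coeff f i \<in> K) \<Longrightarrow> \<theta> (poly f \<omega>) = poly f (\<zeta> * \<omega>)"
proof -
  assume f: "\<And>i. coeff f i \<in> K"
  define g where "g = (SOME g. (\<forall>i. coeff g i \<in> K) \<and> poly g \<omega> = poly f \<omega>)"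
  have "\<exists>g. (\<forall>i. coeff g i \<in> K) \<and> poly g \<omega> = poly f \<omega>" using f by blast
  from someI_ex[OF this] have g: "\<And>i. coeff g i \<in> K" "poly g \<omega> = poly f \<omega>"
    by (simp_all add: g_def)
  have "coeff (g - f) i \<in> K" for i using f g(1) K.diff_closed by simp
  hence "poly (g - f) (\<zeta> * \<omega>) = 0"
    by (rule root_conjugate[OF _ _ zeta_omega_pow]) (simp add: g)
  thus ?thesis by (simp add: \<theta>_def g_def)
qed

lemma S_cases:
  "x \<in> S \<Longrightarrow> \<exists>f. (\<forall>i. coeff f i \<in> K) \<and> x = poly f \<omega>"
  unfolding S_def adjoin_def by blast

sublocale \<theta>: subfield_endo S \<theta>
proof
  fix x assume "x \<in> S"
  then obtain f where f: "\<And>i. coeff f i \<in> K" "x = poly f \<omega>" using S_cases by blast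
  have "\<zeta> * \<omega> \<in> S" using zeta_in_K K_subset_S omega_in_S S.mult_closed by blast
  thus "\<theta> x \<in> S"
    unfolding f(2) theta_poly[OF f(1)] using f(1) K_subset_S by (intro S.poly_closed) auto
  fix y assume "y \<in> S"
  then obtain g where g: "\<And>i. coeff g i \<in> K" "y = poly g \<omega>" using S_cases by blast
  show "\<theta> (x + y) = \<theta> x + \<theta> y"
    using theta_poly[of "f + g"] theta_poly[OF f(1)] theta_poly[OF g(1)] f g K.add_closed by simp
  show "\<theta> (x * y) = \<theta> x * \<theta> y"
    using theta_poly[OF K.coeff_mult_closed[OF f(1) g(1)]] theta_poly[OF f(1)] theta_poly[OF g(1)] f g
    by simp
next
  have "coeff 1 i \<in> K" for i by (cases "i = 0") (simp_all add: coeff_1)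
  from theta_poly[of 1, OF this] show "\<theta> 1 = 1" by simp
qed

lemma theta_K: "x \<in> K \<Longrightarrow> \<theta> x = x"
  using theta_poly[of "[:x:]"] by (simp add: coeff_pCons split: nat.splits)

lemma theta_omega: "\<theta> \<omega> = \<zeta> * \<omega>"
  using theta_poly[of "[:0, 1:]"] by (simp add: coeff_pCons split: nat.splits)

lemma zeta_in_S: "\<zeta> \<in> S"
  using zeta_in_K K_subset_S by blast

lemma eigen_funpow:
  assumes "subfield_endo S f" "f \<zeta> = \<zeta>" "x \<in> S" "f x = \<zeta> ^ e * x"
  shows "(f ^^ i) x = \<zeta> ^ (e * i) * x"
proof (induction i)
  case (Suc i)
  interpret f: subfield_endo S f by fact
  have "(f ^^ Suc i) x = f (\<zeta> ^ (e * i) * x)" using Suc by simp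
  also have "\<dots> = \<zeta> ^ (e * i) * f x"
    by (simp add: f.mult f.power S.power_closed zeta_in_S assms(2,3))
  finally show ?case using assms(4) by (simp add: power_add)
qed simp

lemma theta_eigen: "x \<in> S \<Longrightarrow> \<theta> x = \<zeta> ^ e * x \<Longrightarrow> (\<theta> ^^ i) x = \<zeta> ^ (e * i) * x"
  by (rule eigen_funpow[OF \<theta>.subfield_endo_axioms theta_K[OF zeta_in_K]])

lemma theta_pow_omega: "(\<theta> ^^ i) \<omega> = \<zeta> ^ i * \<omega>"
  using theta_eigen[of \<omega> 1 i] theta_omega omega_in_S by simp

lemma endo_unique_S:
  assumes "subfield_endo S f" "subfield_endo S g" "\<And>x. x \<in> K \<Longrightarrow> f x = g x" "f \<omega> = g \<omega>" "x \<in> S"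
  shows "f x = g x"
  by (rule endo_unique[OF assms(1,2) K.subring_of_complex_axioms K_subset_S omega_in_S assms(3,4)])
     (use assms(5) S_def in auto)

lemma theta_period: "x \<in> S \<Longrightarrow> (\<theta> ^^ p) x = x"
proof (rule endo_unique_S[OF \<theta>.funpow[of p] \<theta>.funpow[of 0], simplified])
  show "(\<theta> ^^ p) x = x" if "x \<in> K" for x
    by (rule \<theta>.funpow_fixed[OF theta_K[OF that]])
  show "(\<theta> ^^ p) \<omega> = \<omega>" by (simp add: theta_pow_omega zeta_pow)
qed

lemma theta_pow_mod: "x \<in> S \<Longrightarrow> (\<theta> ^^ i) x = (\<theta> ^^ (i mod p)) x"
  by (rule funpow_mod_period[where f = \<theta> and p = p and Y = S, OF refl theta_period])

lemma theta_pow_cong: "x \<in> S \<Longrightarrow> [i = j] (mod p) \<Longrightarrow> (\<theta> ^^ i) x = (\<theta> ^^ j) x"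
  using theta_pow_mod[of x i] theta_pow_mod[of x j] by (simp add: Cong.cong_def)

text \<open>Averaging over the powers of \<open>\<theta>\<close> kills the powers of \<open>\<omega>\<close> whose exponent is prime to \<open>p\<close>.\<close>

lemma theta_fixed_in_K: "x \<in> S \<Longrightarrow> \<theta> x = x \<Longrightarrow> x \<in> K"
proof -
  assume x: "x \<in> S" "\<theta> x = x"
  obtain f where f: "\<And>i. coeff f i \<in> K" "x = poly f \<omega>" using S_cases[OF x(1)] by blast
  have fix_pow: "\<zeta> ^ j * \<omega> \<in> S" for j
    using S.mult_closed[OF S.power_closed[OF zeta_in_S] omega_in_S] .
  have "of_nat p * x = (\<Sum>j<p. (\<theta> ^^ j) x)"
    using \<theta>.funpow_fixed[OF x(2)] by simp
  also have "\<dots> = (\<Sum>j<p. poly f (\<zeta> ^ j * \<omega>))"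
  proof (rule sum.cong[OF refl])
    fix j
    interpret t: subfield_endo S "\<theta> ^^ j" by (rule \<theta>.funpow)
    have fS: "coeff f i \<in> S" for i using f K_subset_S by blast
    show "(\<theta> ^^ j) x = poly f (\<zeta> ^ j * \<omega>)"
      unfolding f(2) theta_pow_omega[symmetric]
      by (rule t.poly[OF fS \<theta>.funpow_fixed[OF theta_K[OF f(1)]] omega_in_S])
  qed
  also have "\<dots> = (\<Sum>j<p. \<Sum>i\<le>degree f. coeff f i * \<omega> ^ i * \<zeta> ^ (i * j))"
    unfolding poly_altdef by (simp add: power_mult_distrib mult_ac flip: power_mult)
  also have "\<dots> = (\<Sum>i\<le>degree f. coeff f i * \<omega> ^ i * (\<Sum>j<p. \<zeta> ^ (i * j)))"
    by (subst sum.swap) (simp only: sum_distrib_left)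
  also have "\<dots> = (\<Sum>i\<le>degree f. coeff f i * (if p dvd i then of_nat p * A ^ (i div p) else 0))"
  proof (rule sum.cong[OF refl])
    fix i
    have "\<omega> ^ i = A ^ (i div p)" if "p dvd i"
      using that by (metis dvd_mult_div_cancel omega_pow power_mult)
    thus "coeff f i * \<omega> ^ i * (\<Sum>j<p. \<zeta> ^ (i * j)) =
        coeff f i * (if p dvd i then of_nat p * A ^ (i div p) else 0)"
      by (simp add: sum_zeta_pow_multiple)
  qed
  also have "\<dots> \<in> K"
    by (rule K.sum_closed, rule K.mult_closed[OF f(1)])
       (auto intro!: K.mult_closed[OF K.of_nat_closed K.power_closed[OF A_in_K]])
  finally have "of_nat p * x / of_nat p \<in> K" using K.divide_closed[OF _ K.of_nat_closed] by blast
  thus ?thesis using p_gt_2 by simp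
qed

end

section \<open>The Galois group of \<open>S\<close> over the rationals\<close>

lemma cyclic_sum:
  fixes F :: "nat \<Rightarrow> 'a :: comm_monoid_add"
  assumes "F n = F 0"
  shows "(\<Sum>i<n. F (Suc i)) = (\<Sum>i<n. F i)"
proof (cases n)
  case (Suc m)
  have "(\<Sum>i<Suc m. F (Suc i)) = (\<Sum>i<m. F (Suc i)) + F (Suc m)" by simp
  also have "\<dots> = F 0 + (\<Sum>i<m. F (Suc i))" using assms Suc by (simp add: add.commute)
  also have "\<dots> = (\<Sum>i<Suc m. F i)" by (rule sum.lessThan_Suc_shift[symmetric])
  finally show ?thesis using Suc by simp
qed simp

lemma cyclic_prod:
  fixes F :: "nat \<Rightarrow> 'a :: comm_monoid_mult"
  assumes "F n = F 0"
  shows "(\<Prod>i<n. F (Suc i)) = (\<Prod>i<n. F i)"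
proof (cases n)
  case (Suc m)
  have "(\<Prod>i<Suc m. F (Suc i)) = (\<Prod>i<m. F (Suc i)) * F (Suc m)" by simp
  also have "\<dots> = F 0 * (\<Prod>i<m. F (Suc i))" using assms Suc by (simp add: mult.commute)
  also have "\<dots> = (\<Prod>i<Suc m. F i)" by (rule prod.lessThan_Suc_shift[symmetric])
  finally show ?thesis using Suc by simp
qed simp

text \<open>Here \<open>k\<close> is \<open>v / \<mu>\<close> modulo \<open>p\<close> and \<open>\<kappa>\<close> its inverse; the equation for \<open>A\<close> is the normal form of a
  primary number.\<close>

locale kummer_galois = kummer +
  fixes \<sigma> :: "complex \<Rightarrow> complex" and v \<mu> k \<kappa> :: nat and \<alpha> t :: complex
  assumes sigma_endo: "subfield_endo S \<sigma>"
    and sigma_zeta: "\<sigma> \<zeta> = \<zeta> ^ v"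
    and alpha: "\<alpha> \<in> K" "\<sigma> A = A ^ \<mu> * \<alpha> ^ p"
    and k_mu: "[k * \<mu> = v] (mod p)"
    and k_kap: "[k * \<kappa> = 1] (mod p)"
    and k_ne_1: "\<not> [k = 1] (mod p)"
    and v_primroot: "residue_primroot p v"
    and A_t: "A = 1 + lam ^ p * t" "t \<in> integers_of K"

sublocale kummer_galois \<subseteq> \<sigma>: subfield_endo S \<sigma>
  by (rule sigma_endo)

context kummer_galois
begin

lemma coprime_v: "coprime v p"
  using v_primroot by (simp add: residue_primroot_def coprime_commute)

lemma coprime_k: "coprime k p"
proof (rule ccontr)
  assume "\<not> coprime k p"
  hence "p dvd k" using coprime_nat_prime[OF p_prime] by blast
  hence "p dvd k * \<kappa>" by simp
  hence "[0 = 1] (mod p)" using k_kap by (metis cong_0_iff cong_sym cong_trans)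
  thus False using p_gt_2 by (simp add: Cong.cong_def)
qed

lemma coprime_mu: "coprime \<mu> p"
proof (rule ccontr)
  assume "\<not> coprime \<mu> p"
  hence "p dvd \<mu>" using coprime_nat_prime[OF p_prime] by blast
  hence "p dvd k * \<mu>" by simp
  hence "p dvd v" using k_mu cong_dvd_iff by blast
  thus False using coprime_v p_gt_2 by (metis coprime_common_divisor_nat dvd_refl less_numeral_extra(4) nat_dvd_1_iff_1 one_less_numeral_iff semiring_norm(76) less_trans)
qed

lemma sigma_pow_zeta: "(\<sigma> ^^ n) \<zeta> = \<zeta> ^ (v ^ n)"
proof (induction n)
  case (Suc n)
  have "(\<sigma> ^^ Suc n) \<zeta> = \<sigma> (\<zeta> ^ (v ^ n))" using Suc by simp
  also have "\<dots> = (\<zeta> ^ v) ^ (v ^ n)" by (simp add: \<sigma>.power[OF zeta_in_S] sigma_zeta)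
  finally show ?case by (simp add: power_mult)
qed simp

lemma K_cases: "x \<in> K \<Longrightarrow> \<exists>f. (\<forall>i. coeff f i \<in> \<rat>) \<and> x = poly f \<zeta>"
  unfolding K_def adjoin_def by blast

lemma endo_K_poly:
  assumes "subfield_endo S f" "\<forall>i. coeff g i \<in> \<rat>"
  shows "f (poly g \<zeta>) = poly g (f \<zeta>)"
proof -
  interpret f: subfield_endo S f by fact
  show ?thesis
    by (rule f.poly[OF _ _ zeta_in_S]) (use assms(2) S.Rats_subset f.Rats in blast)+
qed

lemma sigma_K: "x \<in> K \<Longrightarrow> \<sigma> x \<in> K"
proof -
  assume "x \<in> K"
  then obtain f where f: "\<forall>i. coeff f i \<in> \<rat>" "x = poly f \<zeta>" using K_cases by blast
  have "\<sigma> x = poly f (\<zeta> ^ v)" unfolding f(2) endo_K_poly[OF sigma_endo f(1)] sigma_zeta ..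
  moreover have "coeff f i \<in> K" for i using f(1) K.Rats_subset by blast
  ultimately show ?thesis using K.poly_closed[OF _ K.power_closed[OF zeta_in_K]] by simp
qed

lemma sigma_omega_nonzero: "\<sigma> \<omega> \<noteq> 0"
proof
  assume "\<sigma> \<omega> = 0"
  hence "\<sigma> (\<omega> * inverse \<omega>) = 0"
    by (simp only: \<sigma>.mult[OF omega_in_S S.inverse_closed[OF omega_in_S]] mult_zero_left)
  thus False using omega_nonzero by simp
qed

lemma sigma_omega: "\<exists>j. \<sigma> \<omega> = \<zeta> ^ j * (\<omega> ^ \<mu> * \<alpha>)"
proof -
  have "\<sigma> \<omega> ^ p = (\<omega> ^ \<mu> * \<alpha>) ^ p"
  proof -
    have "\<sigma> \<omega> ^ p = \<sigma> A" using \<sigma>.power[OF omega_in_S, of p] omega_pow by simp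
    also have "A ^ \<mu> = (\<omega> ^ \<mu>) ^ p"
      by (metis omega_pow mult.commute power_mult)
    hence "\<sigma> A = (\<omega> ^ \<mu> * \<alpha>) ^ p"
      by (simp only: alpha(2) power_mult_distrib)
    finally show ?thesis .
  qed
  moreover have "\<omega> ^ \<mu> * \<alpha> \<noteq> 0"
  proof
    assume "\<omega> ^ \<mu> * \<alpha> = 0"
    hence "\<sigma> \<omega> ^ p = 0 ^ p" using calculation by (simp only:)
    hence "\<sigma> \<omega> = 0" using p_gt_2 by (simp add: power_0_left)
    thus False using sigma_omega_nonzero by blast
  qed
  ultimately have "(\<sigma> \<omega> / (\<omega> ^ \<mu> * \<alpha>)) ^ p = 1" by (simp add: power_divide)
  then obtain j where "\<sigma> \<omega> / (\<omega> ^ \<mu> * \<alpha>) = \<zeta> ^ j" using all_roots_of_unity by blast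
  thus ?thesis using \<open>\<omega> ^ \<mu> * \<alpha> \<noteq> 0\<close> by (metis nonzero_divide_eq_eq)
qed

lemma alpha_in_S: "\<alpha> \<in> S"
  using alpha(1) K_subset_S by blast

lemma theta_sigma_omega: "\<theta> (\<sigma> \<omega>) = \<zeta> ^ \<mu> * \<sigma> \<omega>"
proof -
  obtain j where j: "\<sigma> \<omega> = \<zeta> ^ j * (\<omega> ^ \<mu> * \<alpha>)" using sigma_omega by blast
  have "\<theta> (\<zeta> ^ j * (\<omega> ^ \<mu> * \<alpha>)) = \<zeta> ^ j * ((\<zeta> * \<omega>) ^ \<mu> * \<alpha>)"
    by (simp add: \<theta>.mult \<theta>.power S.mult_closed S.power_closed zeta_in_S omega_in_S alpha_in_S
        theta_K theta_omega alpha zeta_in_K)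
  thus ?thesis unfolding j by (simp add: power_mult_distrib)
qed

text \<open>It suffices to compare the two sides on \<open>K\<close>, where both are \<open>\<sigma>\<close>, and on \<open>\<omega>\<close>, which both send to
  \<open>\<zeta>\<^sup>v \<sigma> \<omega>\<close>: the number \<open>\<sigma> \<omega>\<close> is \<open>\<omega>\<^sup>\<mu>\<close> up to an element of \<open>K\<close>.\<close>

lemma sigma_theta: "x \<in> S \<Longrightarrow> \<sigma> (\<theta> x) = (\<theta> ^^ k) (\<sigma> x)"
proof (rule endo_unique_S[OF \<sigma>.compose[OF \<theta>.subfield_endo_axioms]
      subfield_endo.compose[OF \<theta>.funpow[of k] sigma_endo]])
  show "\<sigma> (\<theta> x) = (\<theta> ^^ k) (\<sigma> x)" if "x \<in> K" for x
    using theta_K[OF that] \<theta>.funpow_fixed[OF theta_K[OF sigma_K[OF that]]] by simp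
  have "\<sigma> (\<theta> \<omega>) = \<zeta> ^ v * \<sigma> \<omega>"
    by (simp add: theta_omega \<sigma>.mult zeta_in_S omega_in_S sigma_zeta)
  also have "\<zeta> ^ v = \<zeta> ^ (\<mu> * k)"
    by (rule zeta_pow_cong) (metis k_mu cong_sym mult.commute)
  also have "\<zeta> ^ (\<mu> * k) * \<sigma> \<omega> = (\<theta> ^^ k) (\<sigma> \<omega>)"
    by (rule theta_eigen[symmetric]) (auto simp: theta_sigma_omega omega_in_S)
  finally show "\<sigma> (\<theta> \<omega>) = (\<theta> ^^ k) (\<sigma> \<omega>)" .
qed

lemma sigma_theta_pow: "x \<in> S \<Longrightarrow> \<sigma> ((\<theta> ^^ i) x) = (\<theta> ^^ (k * i)) (\<sigma> x)"
proof (induction i)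
  case (Suc i)
  have "\<sigma> ((\<theta> ^^ Suc i) x) = (\<theta> ^^ k) (\<sigma> ((\<theta> ^^ i) x))"
    using sigma_theta[OF \<theta>.funpow_closed[OF Suc.prems]] by simp
  thus ?case using Suc by (simp add: funpow_add)
qed simp

text \<open>The power of \<open>\<sigma>\<close> fixes \<open>K\<close>, hence is a power \<open>\<theta>\<^sup>j\<close>. It commutes with \<open>\<sigma>\<close>, whereas conjugation by
  \<open>\<sigma>\<close> multiplies \<open>j\<close> by \<open>k\<close>, which is not congruent to 1.\<close>

lemma sigma_order: "x \<in> S \<Longrightarrow> (\<sigma> ^^ (p - 1)) x = x"
proof -
  assume x: "x \<in> S"
  interpret r: subfield_endo S "\<sigma> ^^ (p - 1)" by (rule \<sigma>.funpow)
  have "\<not> p dvd v"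
    using coprime_common_divisor[OF coprime_v _ dvd_refl] p_prime not_prime_unit by blast
  hence "[v ^ (p - 1) = 1] (mod p)"
    by (rule fermat_theorem[OF p_prime])
  hence r_zeta: "(\<sigma> ^^ (p - 1)) \<zeta> = \<zeta>"
    unfolding sigma_pow_zeta using zeta_pow_cong[of "v ^ (p - 1)" 1] by simp
  have r_K: "(\<sigma> ^^ (p - 1)) y = y" if yK: "y \<in> K" for y
  proof -
    obtain f where f: "\<forall>i. coeff f i \<in> \<rat>" "y = poly f \<zeta>" using K_cases[OF yK] by blast
    show ?thesis unfolding f(2) endo_K_poly[OF r.subfield_endo_axioms f(1)] r_zeta ..
  qed
  have "((\<sigma> ^^ (p - 1)) \<omega>) ^ p = A"
    using r.power[OF omega_in_S, of p] r_K[OF A_in_K] omega_pow by simp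
  hence "((\<sigma> ^^ (p - 1)) \<omega> / \<omega>) ^ p = 1"
    using omega_pow A_nonzero by (simp add: power_divide)
  then obtain j where "(\<sigma> ^^ (p - 1)) \<omega> / \<omega> = \<zeta> ^ j" using all_roots_of_unity by blast
  hence r_omega: "(\<sigma> ^^ (p - 1)) \<omega> = \<zeta> ^ j * \<omega>"
    using omega_nonzero by (metis nonzero_divide_eq_eq)
  have r_theta: "(\<sigma> ^^ (p - 1)) y = (\<theta> ^^ j) y" if "y \<in> S" for y
  proof (rule endo_unique_S[OF r.subfield_endo_axioms \<theta>.funpow _ _ that])
    show "(\<sigma> ^^ (p - 1)) y = (\<theta> ^^ j) y" if "y \<in> K" for y
      using r_K[OF that] \<theta>.funpow_fixed[OF theta_K[OF that]] by simp
    show "(\<sigma> ^^ (p - 1)) \<omega> = (\<theta> ^^ j) \<omega>" by (simp only: r_omega theta_pow_omega)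
  qed
  have s\<omega>: "\<sigma> \<omega> \<in> S" by (rule \<sigma>.closed[OF omega_in_S])
  have "(\<theta> ^^ j) (\<sigma> \<omega>) = \<sigma> ((\<sigma> ^^ (p - 1)) \<omega>)"
    by (simp only: r_theta[OF s\<omega>, symmetric] funpow_swap1)
  also have "\<dots> = (\<theta> ^^ (k * j)) (\<sigma> \<omega>)"
    by (simp only: r_theta[OF omega_in_S] sigma_theta_pow[OF omega_in_S])
  finally have "\<zeta> ^ (\<mu> * j) * \<sigma> \<omega> = \<zeta> ^ (\<mu> * (k * j)) * \<sigma> \<omega>"
    by (simp only: theta_eigen[OF s\<omega> theta_sigma_omega])
  moreover note sigma_omega_nonzero
  ultimately have "[\<mu> * j = \<mu> * (k * j)] (mod p)" by (simp add: zeta_pow_eq_iff)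
  hence "[1 * j = k * j] (mod p)" by (simp add: cong_mult_lcancel_nat[OF coprime_mu])
  have "p dvd j"
  proof (rule ccontr)
    assume "\<not> p dvd j"
    hence "coprime j p" using coprime_nat_prime[OF p_prime] by blast
    hence "[1 = k] (mod p)" using \<open>[1 * j = k * j] (mod p)\<close> by (simp only: cong_mult_rcancel_nat)
    thus False using k_ne_1 by (simp add: cong_sym_eq)
  qed
  hence "[j = 0] (mod p)" by (simp add: cong_0_iff)
  thus ?thesis using r_theta[OF x] theta_pow_cong[OF x, of j 0] by simp
qed

text \<open>By the previous averaging over \<open>\<theta>\<close> the element lies in \<open>K\<close>; averaging over \<open>\<sigma>\<close> turns each power of
  \<open>\<zeta>\<close> into a rational number, as the powers of \<open>v\<close> run through all nonzero residues.\<close>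

lemma galois_fixed_rational: 
  assumes x: "x \<in> S" "\<theta> x = x" "\<sigma> x = x"
  shows "x \<in> \<rat>"
proof -
  have "x \<in> K" by (rule theta_fixed_in_K[OF x(1,2)])
  then obtain f where f: "\<forall>i. coeff f i \<in> \<rat>" "x = poly f \<zeta>" using K_cases by blast
  have tot: "totient p = p - 1" using p_prime by (rule totient_prime)
  have period_sum: "(\<Sum>j<p - 1. \<zeta> ^ (i * v ^ j)) \<in> \<rat>" for i
  proof (cases "p dvd i")
    case True
    hence "\<zeta> ^ (i * v ^ j) = 1" for j by (simp add: zeta_pow_eq_1_iff)
    thus ?thesis by simp
  next
    case False
    have bij: "bij_betw (\<lambda>j. v ^ j mod p) {..<p - 1} (totatives p)"
      using residue_primroot_is_generator[OF _ v_primroot] p_gt_2 tot by simp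
    have "(\<Sum>j<p - 1. \<zeta> ^ (i * v ^ j)) = (\<Sum>j<p - 1. (\<zeta> ^ i) ^ (v ^ j mod p))"
      by (rule sum.cong[OF refl], unfold power_mult[symmetric], rule zeta_pow_cong)
         (metis cong_mod_right cong_refl cong_scalar_left)
    also have "\<dots> = (\<Sum>a\<in>totatives p. (\<zeta> ^ i) ^ a)"
      by (rule sum.reindex_bij_betw[OF bij])
    also have "totatives p = {..<p} - {0}"
      using p_prime by (auto simp: totatives_prime)
    also have "(\<Sum>a\<in>{..<p} - {0}. (\<zeta> ^ i) ^ a) = (\<Sum>a<p. (\<zeta> ^ i) ^ a) - 1"
      using p_gt_2 by (subst sum_diff1) auto
    also have "(\<Sum>a<p. (\<zeta> ^ i) ^ a) = 0"
      using sum_zeta_pow_multiple[of i] False by (simp only: power_mult if_False)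
    finally show ?thesis by simp
  qed
  have "of_nat (p - 1) * x = (\<Sum>j<p - 1. (\<sigma> ^^ j) x)"
    using \<sigma>.funpow_fixed[OF x(3)] by simp
  also have "\<dots> = (\<Sum>j<p - 1. poly f (\<zeta> ^ (v ^ j)))"
    unfolding f(2) endo_K_poly[OF \<sigma>.funpow f(1)] sigma_pow_zeta ..
  also have "\<dots> = (\<Sum>j<p - 1. \<Sum>i\<le>degree f. coeff f i * \<zeta> ^ (i * v ^ j))"
    unfolding poly_altdef by (simp add: mult.commute flip: power_mult)
  also have "\<dots> = (\<Sum>i\<le>degree f. coeff f i * (\<Sum>j<p - 1. \<zeta> ^ (i * v ^ j)))"
    by (subst sum.swap) (simp add: sum_distrib_left)
  also have "\<dots> \<in> \<rat>"
    by (rule subring_of_complex.sum_closed[OF subring_Rats]) (use f(1) period_sum in auto)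
  finally have "of_nat (p - 1) * x / of_nat (p - 1) \<in> \<rat>" by (rule Rats_divide) simp
  thus ?thesis using p_gt_2 by simp
qed

end

section \<open>Congruences modulo a divisor of \<open>p\<close>\<close>

text \<open>The axioms say that the residues of the integers modulo \<open>lam\<close> form the field with \<open>p\<close> elements.\<close>

locale lam_residues =
  fixes p :: nat and lam :: complex and R :: "complex set"
  assumes R_subring: "subring_of_complex R"
    and prime_p: "prime p"
    and lam_R: "lam \<in> R" and p_multiple: "\<exists>r\<in>R. of_nat p = lam * r"
    and int_divisible: "\<And>n z. of_int n = lam * z \<Longrightarrow> z \<in> R \<Longrightarrow> int p dvd n"

sublocale lam_residues \<subseteq> R: subring_of_complex R
  by (rule R_subring)

context lam_residues
begin

definition res_eq :: "complex \<Rightarrow> complex \<Rightarrow> bool" (infix "\<doteq>" 50) where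
  "x \<doteq> y \<longleftrightarrow> (\<exists>z\<in>R. x - y = lam * z)"

lemma res_eqI: "x - y = lam * z \<Longrightarrow> z \<in> R \<Longrightarrow> x \<doteq> y"
  by (auto simp: res_eq_def)

lemma res_refl [simp]: "x \<doteq> x"
  by (rule res_eqI[of _ _ 0]) simp_all

lemma res_sym: "x \<doteq> y \<Longrightarrow> y \<doteq> x"
proof -
  assume "x \<doteq> y"
  then obtain z where "z \<in> R" "x - y = lam * z" by (auto simp: res_eq_def)
  thus "y \<doteq> x" using R.uminus_closed by (intro res_eqI[of _ _ "- z"]) (auto simp: algebra_simps)
qed

lemma res_add: "x \<doteq> y \<Longrightarrow> x' \<doteq> y' \<Longrightarrow> x + x' \<doteq> y + y'"
proof -
  assume "x \<doteq> y" "x' \<doteq> y'"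
  then obtain z z' where "z \<in> R" "x - y = lam * z" "z' \<in> R" "x' - y' = lam * z'"
    by (auto simp: res_eq_def)
  thus ?thesis using R.add_closed by (intro res_eqI[of _ _ "z + z'"]) (auto simp: algebra_simps)
qed

lemma res_uminus: "x \<doteq> y \<Longrightarrow> - x \<doteq> - y"
proof -
  assume "x \<doteq> y"
  then obtain z where "z \<in> R" "x - y = lam * z" by (auto simp: res_eq_def)
  thus ?thesis using R.uminus_closed by (intro res_eqI[of _ _ "- z"]) (auto simp: algebra_simps)
qed

lemma res_diff: "x \<doteq> y \<Longrightarrow> x' \<doteq> y' \<Longrightarrow> x - x' \<doteq> y - y'"
  using res_add[OF _ res_uminus, of x y x' y'] by simp

lemma res_trans [trans]: "x \<doteq> y \<Longrightarrow> y \<doteq> z \<Longrightarrow> x \<doteq> z"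
proof -
  assume "x \<doteq> y" "y \<doteq> z"
  from res_diff[OF res_add[OF this] res_refl[of y]] show ?thesis by (simp add: add.commute)
qed

lemma res_mult:
  assumes "x \<doteq> y" "x' \<doteq> y'" "x' \<in> R" "y \<in> R"
  shows "x * x' \<doteq> y * y'"
proof -
  from assms obtain z z' where z: "z \<in> R" "x - y = lam * z" "z' \<in> R" "x' - y' = lam * z'"
    by (auto simp: res_eq_def)
  have "x * x' - y * y' = (x - y) * x' + y * (x' - y')" by (simp add: algebra_simps)
  also have "\<dots> = lam * (z * x' + y * z')" unfolding z by (simp add: algebra_simps)
  finally show ?thesis
    by (rule res_eqI) (use z assms in \<open>intro R.add_closed R.mult_closed\<close>)
qed

lemma res_scale: "x \<doteq> y \<Longrightarrow> a \<in> R \<Longrightarrow> a * x \<doteq> a * y"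
proof -
  assume a: "x \<doteq> y" "a \<in> R"
  then obtain z where "z \<in> R" "x - y = lam * z" by (auto simp: res_eq_def)
  thus ?thesis using a R.mult_closed by (intro res_eqI[of _ _ "a * z"]) (auto simp: algebra_simps)
qed

lemma res_power: "x \<doteq> y \<Longrightarrow> x \<in> R \<Longrightarrow> y \<in> R \<Longrightarrow> x ^ n \<doteq> y ^ n"
proof (induction n)
  case (Suc n)
  thus ?case using res_mult[of x y "x ^ n" "y ^ n"] R.power_closed[of x n] by simp
qed simp

lemma res_sum: "(\<And>i. i \<in> I \<Longrightarrow> f i \<doteq> g i) \<Longrightarrow> sum f I \<doteq> sum g I"
  by (induction I rule: infinite_finite_induct) (auto intro: res_add)

lemma res_int: "of_int m \<doteq> of_int n \<longleftrightarrow> [m = n] (mod int p)"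
proof
  assume "of_int m \<doteq> of_int n"
  then obtain z where "z \<in> R" "of_int (m - n) = lam * z" by (auto simp: res_eq_def)
  hence "int p dvd m - n" using int_divisible by blast
  thus "[m = n] (mod int p)" by (simp add: cong_iff_dvd_diff)
next
  assume "[m = n] (mod int p)"
  then obtain q where q: "m - n = int p * q" by (auto simp: cong_iff_dvd_diff)
  obtain r where r: "r \<in> R" "of_nat p = lam * r" using p_multiple by blast
  have "of_int m - of_int n = (of_int (m - n) :: complex)" by simp
  also have "\<dots> = lam * (r * of_int q)" unfolding q by (simp add: r)
  finally show "of_int m \<doteq> of_int n" by (rule res_eqI) (use r R.mult_closed R.of_int_closed in blast)
qed

lemma res_int_0: "of_int n \<doteq> 0 \<longleftrightarrow> int p dvd n"
  using res_int[of n 0] by (simp add: cong_0_iff)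

lemma res_p_multiple: "x \<in> R \<Longrightarrow> of_nat p * x \<doteq> 0"
proof -
  assume x: "x \<in> R"
  obtain r where r: "r \<in> R" "of_nat p = lam * r" using p_multiple by blast
  have "of_nat p * x - 0 = lam * (r * x)" by (simp add: r)
  thus ?thesis by (rule res_eqI) (rule R.mult_closed[OF r(1) x])
qed

lemma res_int_p_multiple: "int p dvd n \<Longrightarrow> x \<in> R \<Longrightarrow> of_int n * x \<doteq> 0"
  using res_p_multiple[OF R.mult_closed[OF R.of_int_closed]] by (auto simp: mult.assoc)

lemma res_freshman: 
  assumes "x \<in> R" "y \<in> R"
  shows "(x + y) ^ p \<doteq> x ^ p + y ^ p"
proof -
  have p0: "p > 0" using prime_p by (rule prime_gt_0_nat)
  have "(x + y) ^ p = (\<Sum>j\<le>p. of_nat (p choose j) * x ^ j * y ^ (p - j))"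
    by (rule binomial_ring)
  also have "\<dots> \<doteq> (\<Sum>j\<le>p. if j = 0 then y ^ p else if j = p then x ^ p else 0)"
  proof (rule res_sum)
    fix j assume j: "j \<in> {..p}"
    show "of_nat (p choose j) * x ^ j * y ^ (p - j) \<doteq> (if j = 0 then y ^ p else if j = p then x ^ p else 0)"
    proof (cases "j = 0 \<or> j = p")
      case False
      hence "int p dvd int (p choose j)" using j prime_dvd_binomial[OF prime_p, of j] by simp
      hence "of_int (int (p choose j)) * (x ^ j * y ^ (p - j)) \<doteq> 0"
        by (rule res_int_p_multiple[OF _ R.mult_closed[OF R.power_closed R.power_closed]]) fact+
      thus ?thesis using False by (simp add: mult.assoc)
    qed (use p0 in auto)
  qed
  also have "{..p} = insert 0 (insert p {1..<p})" using p0 by auto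
  also have "(\<Sum>j\<in>\<dots>. if j = 0 then y ^ p else if j = p then x ^ p else 0) = x ^ p + y ^ p"
    using p0 by (subst sum.insert; (subst sum.insert)?) auto
  finally show ?thesis .
qed

lemma res_int_frobenius: "of_int n ^ p \<doteq> of_int n"
  using int_fermat[OF prime_p, of n] res_int[of "n ^ p" n] by simp

abbreviation ev :: "int poly \<Rightarrow> complex \<Rightarrow> complex" where
  "ev h x \<equiv> poly (of_int_poly h) x"

lemma ev_closed: "x \<in> R \<Longrightarrow> ev h x \<in> R"
  by (rule R.poly_closed) (simp_all add: coeff_map_poly)

lemma ev_res: "x \<doteq> y \<Longrightarrow> x \<in> R \<Longrightarrow> y \<in> R \<Longrightarrow> ev h x \<doteq> ev h y"
  unfolding poly_altdef
  by (simp add: coeff_map_poly) (intro res_sum res_scale res_power R.of_int_closed; assumption)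

lemma ev_diff: "ev (f - g) x = ev f x - ev g x"
  by (simp add: of_int_poly_hom.hom_minus)

lemma ev_monom: "ev (monom a n) x = of_int a * x ^ n"
  by (simp add: poly_monom)

lemma ev_pcompose: "ev (f \<circ>\<^sub>p g) x = ev f (ev g x)"
  by (simp add: of_int_hom.map_poly_pcompose poly_pcompose)

lemma ev_const: "ev [:a:] x = of_int a"
  by (simp add: of_int_hom.map_poly_pCons_hom)

lemma ev_linear: "ev [:c, 1:] x = of_int c + x"
  by (simp add: of_int_hom.map_poly_pCons_hom)

lemma ev_cong_0:
  assumes "\<And>i. int p dvd coeff h i" "x \<in> R"
  shows "ev h x \<doteq> 0"
proof -
  have "(\<Sum>i\<le>degree h. of_int (coeff h i) * x ^ i) \<doteq> (\<Sum>i\<le>degree h. 0)"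
    by (intro res_sum res_int_p_multiple R.power_closed assms)
  thus ?thesis by (simp add: poly_altdef coeff_map_poly)
qed

end

section \<open>Integer polynomials modulo \<open>p\<close>\<close>

text \<open>The difference operator \<open>h(X + 1) - h(X)\<close> lowers the degree and multiplies the leading coefficient by
  the degree, like the derivative.\<close>

lemma coeff_shift_difference:
  fixes h :: "'a :: comm_ring_1 poly"
  assumes "degree h \<le> Suc m"
  shows "degree (h \<circ>\<^sub>p [:1, 1:] - h) \<le> m \<and> coeff (h \<circ>\<^sub>p [:1, 1:] - h) m = of_nat (Suc m) * coeff h (Suc m)"
proof -
  have "degree (h \<circ>\<^sub>p [:1, 1:]) \<le> n \<and> coeff (h \<circ>\<^sub>p [:1, 1:]) n = coeff h n \<and>
      (n > 0 \<longrightarrow> degree (h \<circ>\<^sub>p [:1, 1:] - h) \<le> n - 1 \<and>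
        coeff (h \<circ>\<^sub>p [:1, 1:] - h) (n - 1) = of_nat n * coeff h n) \<and>
      (n = 0 \<longrightarrow> h \<circ>\<^sub>p [:1, 1:] - h = 0)"
    if "degree h \<le> n" for n
    using that
  proof (induction h arbitrary: n)
    case (pCons a h)
    let ?c = "h \<circ>\<^sub>p [:1, 1:]"
    have e: "pCons a h \<circ>\<^sub>p [:1, 1:] = [:a:] + ?c + pCons 0 ?c"
      by (simp add: pcompose_pCons)
    have d: "pCons a h \<circ>\<^sub>p [:1, 1:] - pCons a h = ?c + pCons 0 (?c - h)"
      unfolding e by (simp add: poly_eq_iff coeff_pCons split: nat.split)
    show ?case
    proof (cases n)
      case 0
      hence "h = 0" using pCons.prems by (cases "h = 0") auto
      thus ?thesis using 0 by simp
    next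
      case (Suc m)
      have "degree h \<le> m" using pCons.prems Suc by (cases "h = 0") auto
      note IH = pCons.IH[OF this]
      have "degree ?c \<le> m" "coeff ?c m = coeff h m" using IH by blast+
      have c0: "coeff ?c (Suc m) = 0" using \<open>degree ?c \<le> m\<close> by (simp add: coeff_eq_0)
      have dd: "degree (?c + pCons 0 (?c - h)) \<le> m"
      proof (intro degree_add_le \<open>degree ?c \<le> m\<close>)
        show "degree (pCons 0 (?c - h)) \<le> m"
          using IH by (cases m) (auto simp: degree_pCons_eq_if)
      qed
      have dm: "coeff (?c + pCons 0 (?c - h)) m = of_nat (Suc m) * coeff h m"
        using IH by (cases m) (auto simp: algebra_simps)
      show ?thesis
        unfolding d unfolding e
        using dd dm Suc \<open>degree ?c \<le> m\<close> \<open>coeff ?c m = coeff h m\<close> c0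
        by (auto simp: degree_pCons_eq_if intro!: degree_add_le)
    qed
  qed simp
  from this[OF assms] show ?thesis by simp
qed

text \<open>A polynomial of degree below \<open>p\<close> becomes constant under repeated differences, and the leading
  coefficient only gains factors prime to \<open>p\<close>. So a property stable under differences which forces
  constants to vanish modulo \<open>p\<close> forces all coefficients to vanish. It is applied to vanishing at
  \<open>\<eta>\<close> modulo \<open>lam\<close>, where \<open>\<theta>\<close> realises the shift, and to vanishing at all integers modulo \<open>p\<close>.\<close>

lemma difference_descent:
  assumes p: "prime p"
    and shift: "\<And>h. P h \<Longrightarrow> P (h \<circ>\<^sub>p [:1, 1:] - h)"
    and drop: "\<And>h a n. P h \<Longrightarrow> int p dvd a \<Longrightarrow> P (h - monom a n)"
    and const: "\<And>a. P [:a:] \<Longrightarrow> int p dvd a"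
    and h: "degree h \<le> m" "m < p" "P h"
  shows "int p dvd coeff h i"
  using h
proof (induction m arbitrary: h i)
  case 0
  then obtain a where a: "h = [:a:]" by (auto elim: degree_eq_zeroE)
  have "int p dvd a" using 0 const unfolding a by blast
  thus ?case unfolding a by (simp add: coeff_pCons split: nat.split)
next
  case (Suc m)
  let ?D = "h \<circ>\<^sub>p [:1, 1:] - h"
  have "int p dvd coeff ?D m"
    by (rule Suc.IH[OF _ _ shift[OF Suc.prems(3)]])
       (use coeff_shift_difference[OF Suc.prems(1)] Suc.prems in auto)
  hence "int p dvd int (Suc m) * coeff h (Suc m)"
    using coeff_shift_difference[OF Suc.prems(1)] by metis
  moreover have "\<not> int p dvd int (Suc m)"
    using Suc.prems(2) by (metis int_dvd_int_iff dvd_imp_le linorder_not_le zero_less_Suc)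
  ultimately have top: "int p dvd coeff h (Suc m)"
    using p prime_dvd_multD[of "int p"] by (metis prime_nat_int_transfer)
  define g where "g = h - monom (coeff h (Suc m)) (Suc m)"
  have "degree g \<le> m"
  proof (rule degree_le, intro allI impI)
    fix i assume "m < i"
    thus "coeff g i = 0"
      using Suc.prems(1) by (cases "i = Suc m") (auto simp: g_def coeff_eq_0)
  qed
  moreover have "P g" unfolding g_def by (rule drop[OF Suc.prems(3) top])
  ultimately have "int p dvd coeff g i" for i
    using Suc.IH[of g i] Suc.prems(2) by simp
  from this[of i] show ?case
    using top by (cases "i = Suc m") (auto simp: g_def)
qed

lemma int_values_divisible:
  assumes p: "prime p" and h: "degree h < p" "\<And>c. int p dvd poly h c"
  shows "int p dvd coeff h i"
proof (rule difference_descent[of p "\<lambda>h. \<forall>c. int p dvd poly h c" h "p - 1"])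
  show "\<forall>c. int p dvd poly (f - monom a n) c" if "\<forall>c. int p dvd poly f c" "int p dvd a" for f a n
    using that by (simp add: poly_monom)
  show "\<forall>c. int p dvd poly (f \<circ>\<^sub>p [:1, 1:] - f) c" if "\<forall>c. int p dvd poly f c" for f
    using that by (simp add: poly_pcompose)
qed (use p h in auto)

lemma poly_dvd_if_coeffs_dvd:
  "(\<And>i. a dvd coeff h i) \<Longrightarrow> a dvd poly h (c :: 'a :: comm_ring_1)"
  unfolding poly_altdef by (intro dvd_sum dvd_mult2)

section \<open>The ring of integers of \<open>S\<close> modulo \<open>lam\<close>\<close>

context kummer
begin

abbreviation \<O>\<^sub>S :: "complex set" where "\<O>\<^sub>S \<equiv> integers_of S"

lemma OS_subring: "subring_of_complex \<O>\<^sub>S"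
  by (rule subring_integers_of[OF S.subring_of_complex_axioms])

lemma Zzeta_subset_OS: "Zzeta \<subseteq> \<O>\<^sub>S"
  using Zzeta_subset_K K_subset_S Zzeta_algebraic_int by (auto simp: integers_of_def)

lemma OK_subset_OS: "integers_of K \<subseteq> \<O>\<^sub>S"
  using K_subset_S by (auto simp: integers_of_def)

lemma OS_in_S: "x \<in> \<O>\<^sub>S \<Longrightarrow> x \<in> S"
  by (simp add: integers_of_def)

end

sublocale kummer \<subseteq> lam_residues p lam "integers_of S"
proof (rule lam_residues.intro)
  show "subring_of_complex \<O>\<^sub>S" by (rule OS_subring)
  show "prime p" by (rule p_prime)
  show "lam \<in> \<O>\<^sub>S" using lam_in_Zzeta Zzeta_subset_OS by blast
  have "lam ^ (p - 2) * u' \<in> \<O>\<^sub>S"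
    using Zzeta.mult_closed[OF Zzeta.power_closed[OF lam_in_Zzeta] u'(1)] Zzeta_subset_OS by blast
  thus "\<exists>r\<in>\<O>\<^sub>S. of_nat p = lam * r" using lam_dvd_p by blast
  show "int p dvd n" if "of_int n = lam * z" "z \<in> \<O>\<^sub>S" for n z
    using p_dvd_if_lam_dvd[OF that(1)] that(2) by (simp add: integers_of_def)
qed

context kummer_galois
begin

notation res_eq (infix "\<doteq>" 50)

lemma endo_OS: "subfield_endo S f \<Longrightarrow> x \<in> \<O>\<^sub>S \<Longrightarrow> f x \<in> \<O>\<^sub>S"
  by (simp add: integers_of_def subfield_endo.closed subfield_endo.algebraic_int)

lemma theta_OS: "x \<in> \<O>\<^sub>S \<Longrightarrow> \<theta> x \<in> \<O>\<^sub>S"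
  by (rule endo_OS[OF \<theta>.subfield_endo_axioms])

lemma sigma_OS: "x \<in> \<O>\<^sub>S \<Longrightarrow> \<sigma> x \<in> \<O>\<^sub>S"
  by (rule endo_OS[OF sigma_endo])

lemma lam_in_S: "lam \<in> S"
  using lam_R OS_in_S by blast

lemma theta_lam: "\<theta> lam = lam"
  using lam_in_Zzeta Zzeta_subset_K theta_K by blast

text \<open>The quotient of \<open>\<sigma>\<^sup>n lam\<close> by \<open>lam\<close>.\<close>

definition lamq :: "nat \<Rightarrow> complex" where "lamq n = (\<Sum>j<v ^ n. \<zeta> ^ j)"

lemma zeta_OS: "\<zeta> \<in> \<O>\<^sub>S"
  using zeta_in_Zzeta Zzeta_subset_OS by blast

lemma lamq_OS: "lamq n \<in> \<O>\<^sub>S"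
  unfolding lamq_def by (rule R.sum_closed, rule R.power_closed, rule zeta_OS)

lemma sigma_pow_lam: "(\<sigma> ^^ n) lam = lam * lamq n"
proof -
  interpret s: subfield_endo S "\<sigma> ^^ n" by (rule \<sigma>.funpow)
  have "(\<sigma> ^^ n) lam = \<zeta> ^ (v ^ n) - 1"
    unfolding lam_def using s.diff[OF zeta_in_S S.one_closed] sigma_pow_zeta by simp
  thus ?thesis unfolding lamq_def by (simp only: zeta_pow_minus_1)
qed

lemma zeta_res: "\<zeta> \<doteq> 1"
  by (rule res_eqI[of _ _ 1]) (simp_all add: lam_def)

lemma lamq_res: "lamq n \<doteq> of_int (int (v ^ n))"
proof -
  have "lamq n \<doteq> (\<Sum>j<v ^ n. 1 ^ j)"
    unfolding lamq_def by (intro res_sum res_power zeta_res zeta_OS R.one_closed)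
  thus ?thesis by simp
qed

lemma theta_res: "x \<doteq> y \<Longrightarrow> x \<in> \<O>\<^sub>S \<Longrightarrow> y \<in> \<O>\<^sub>S \<Longrightarrow> \<theta> x \<doteq> \<theta> y"
proof -
  assume xy: "x \<doteq> y" "x \<in> \<O>\<^sub>S" "y \<in> \<O>\<^sub>S"
  then obtain z where z: "z \<in> \<O>\<^sub>S" "x - y = lam * z" by (auto simp: res_eq_def)
  have "\<theta> x - \<theta> y = \<theta> (x - y)" using xy by (simp add: \<theta>.diff OS_in_S)
  also have "\<dots> = lam * \<theta> z" unfolding z using z by (simp add: \<theta>.mult OS_in_S lam_in_S theta_lam)
  finally show ?thesis by (rule res_eqI) (rule theta_OS[OF z(1)])
qed

lemma sigma_res: "x \<doteq> y \<Longrightarrow> x \<in> \<O>\<^sub>S \<Longrightarrow> y \<in> \<O>\<^sub>S \<Longrightarrow> \<sigma> x \<doteq> \<sigma> y"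
proof -
  assume xy: "x \<doteq> y" "x \<in> \<O>\<^sub>S" "y \<in> \<O>\<^sub>S"
  then obtain z where z: "z \<in> \<O>\<^sub>S" "x - y = lam * z" by (auto simp: res_eq_def)
  have "\<sigma> x - \<sigma> y = \<sigma> (x - y)" using xy by (simp add: \<sigma>.diff OS_in_S)
  also have "\<dots> = lam * (lamq 1 * \<sigma> z)"
    unfolding z using z sigma_pow_lam[of 1] by (simp add: \<sigma>.mult OS_in_S lam_in_S mult.assoc)
  finally show ?thesis by (rule res_eqI) (rule R.mult_closed[OF lamq_OS sigma_OS[OF z(1)]])
qed

lemma endo_ev: "subfield_endo S f \<Longrightarrow> x \<in> S \<Longrightarrow> f (ev h x) = ev h (f x)"
  by (rule subfield_endo.poly)
     (simp_all add: coeff_map_poly subfield_endo.of_int S.of_int_closed)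

definition \<eta> :: complex where "\<eta> = (\<omega> - 1) / lam"

lemma omega_eta: "\<omega> = 1 + lam * \<eta>"
  using lam_nonzero by (simp add: \<eta>_def)

text \<open>The coefficients of \<open>((1 + lam X)\<^sup>p - 1) / lam\<^sup>p\<close> below the leading one. Divided by \<open>lam\<^sup>p\<close>, the factor \<open>p\<close>
  of a binomial coefficient leaves the unit \<open>u'\<close> and a pole of order 1, which \<open>lam\<^sup>j\<close> compensates.\<close>

definition eta_coeff :: "nat \<Rightarrow> complex" where
  "eta_coeff j = of_nat ((p choose j) div p) * u' * lam ^ (j - 1)"

lemma eta_coeff_Zzeta: "eta_coeff j \<in> Zzeta"
  unfolding eta_coeff_def
  by (rule Zzeta.mult_closed[OF Zzeta.mult_closed[OF Zzeta.of_nat_closed u'(1)] Zzeta.power_closed[OF lam_in_Zzeta]])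

lemma eta_equation: "\<eta> ^ p + (\<Sum>j\<in>{1..<p}. eta_coeff j * \<eta> ^ j) = t"
proof -
  have "lam ^ p * t + 1 = (lam * \<eta> + 1) ^ p"
  proof -
    have "lam * \<eta> + 1 = \<omega>" by (rule trans[OF add.commute omega_eta[symmetric]])
    thus ?thesis using A_t(1) omega_pow by (simp add: add.commute)
  qed
  also have "\<dots> = (\<Sum>j\<le>p. of_nat (p choose j) * (lam * \<eta>) ^ j)"
    by (subst binomial_ring) simp
  also have "{..p} = insert 0 (insert p {1..<p})" using p_gt_2 by auto
  also have "(\<Sum>j\<in>\<dots>. of_nat (p choose j) * (lam * \<eta>) ^ j) =
      1 + ((lam * \<eta>) ^ p + (\<Sum>j\<in>{1..<p}. of_nat (p choose j) * (lam * \<eta>) ^ j))"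
    using p_gt_2 by (subst sum.insert; (subst sum.insert)?) auto
  also have "(\<Sum>j\<in>{1..<p}. of_nat (p choose j) * (lam * \<eta>) ^ j) =
      lam ^ p * (\<Sum>j\<in>{1..<p}. eta_coeff j * \<eta> ^ j)"
    unfolding sum_distrib_left
  proof (rule sum.cong[OF refl])
    fix j assume j: "j \<in> {1..<p}"
    have "(p choose j) = p * ((p choose j) div p)" using prime_dvd_binomial[OF p_prime, of j] j by simp
    hence "of_nat (p choose j) = (of_nat p * of_nat ((p choose j) div p) :: complex)"
      by (metis of_nat_mult)
    moreover have "lam ^ j = lam * lam ^ (j - 1)" using j by (simp flip: power_Suc)
    moreover have "lam ^ p = lam * lam ^ (p - 1)" using p_gt_2 by (simp flip: power_Suc)
    ultimately show "of_nat (p choose j) * (lam * \<eta>) ^ j = lam ^ p * (eta_coeff j * \<eta> ^ j)"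
      using u'(2) by (simp only: power_mult_distrib eta_coeff_def mult_ac)
  qed
  finally have "lam ^ p * t = lam ^ p * (\<eta> ^ p + (\<Sum>j\<in>{1..<p}. eta_coeff j * \<eta> ^ j))"
    by (simp add: power_mult_distrib algebra_simps)
  thus ?thesis using lam_nonzero by simp
qed

definition eta_tail :: "complex poly" where
  "eta_tail = (\<Sum>j\<in>{1..<p}. monom (eta_coeff j) j) - [:t:]"

definition eta_poly :: "complex poly" where
  "eta_poly = monom 1 p + eta_tail"

lemma coeff_eta_tail: "coeff eta_tail i = (if i = 0 then - t else if i < p then eta_coeff i else 0)"
  unfolding eta_tail_def by (cases i) (simp_all add: coeff_sum)

lemma degree_eta_poly: "degree eta_poly = p"
proof -
  have "degree eta_tail < p"
    using p_gt_2 by (intro degree_lessI) (auto simp: coeff_eta_tail)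
  thus ?thesis
    unfolding eta_poly_def by (subst degree_add_eq_left) (auto simp: degree_monom_eq)
qed

lemma lead_coeff_eta_poly: "lead_coeff eta_poly = 1"
  unfolding degree_eta_poly using p_gt_2 by (simp add: eta_poly_def coeff_eta_tail)

lemma coeff_eta_poly: "coeff eta_poly i \<in> integers_of K"
proof -
  have "eta_coeff i \<in> integers_of K"
    using eta_coeff_Zzeta Zzeta_subset_K Zzeta_algebraic_int by (auto simp: integers_of_def)
  hence "coeff eta_tail i \<in> integers_of K"
    using OK.uminus_closed[OF A_t(2)] by (simp add: coeff_eta_tail)
  moreover have "coeff (monom 1 p) i \<in> integers_of K"
    by simp
  ultimately show ?thesis
    unfolding eta_poly_def coeff_add by (rule OK.add_closed[rotated])
qed

lemma poly_eta_poly: "poly eta_poly \<eta> = 0"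
proof -
  have "poly eta_poly \<eta> = \<eta> ^ p + (\<Sum>j\<in>{1..<p}. eta_coeff j * \<eta> ^ j) - t"
    by (simp add: eta_poly_def eta_tail_def poly_monom poly_sum)
  thus ?thesis by (simp only: eta_equation diff_self)
qed

lemma eta_OS: "\<eta> \<in> \<O>\<^sub>S"
proof -
  have "\<eta> \<in> S" unfolding \<eta>_def
    by (rule S.divide_closed[OF S.diff_closed[OF omega_in_S S.one_closed] lam_in_S])
  moreover have "algebraic_int \<eta>"
    by (rule algebraic_int_monic_root[OF _ lead_coeff_eta_poly poly_eta_poly])
       (use coeff_eta_poly in \<open>auto simp: integers_of_def\<close>)
  ultimately show ?thesis by (simp add: integers_of_def)
qed

lemma eta_in_S: "\<eta> \<in> S"
  using eta_OS OS_in_S by blast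

lemma theta_eta: "\<theta> \<eta> = \<zeta> * \<eta> + 1"
proof -
  have "\<theta> \<eta> = (\<zeta> * \<omega> - 1) / lam"
    unfolding \<eta>_def
    by (simp add: \<theta>.divide \<theta>.diff S.diff_closed omega_in_S lam_in_S theta_lam theta_omega)
  also have "\<zeta> * \<omega> - 1 = \<zeta> * (1 + lam * \<eta>) - 1"
    by (rule arg_cong[OF omega_eta, of "\<lambda>x. \<zeta> * x - 1"])
  also have "\<dots> = lam * (\<zeta> * \<eta> + 1)"
    by (simp add: lam_def algebra_simps)
  also have "\<dots> / lam = \<zeta> * \<eta> + 1" using lam_nonzero by simp
  finally show ?thesis .
qed

lemma theta_eta_res: "\<theta> \<eta> \<doteq> \<eta> + 1"
proof -
  have "\<zeta> * \<eta> \<doteq> 1 * \<eta>"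
    by (rule res_mult[OF zeta_res res_refl eta_OS R.one_closed])
  from res_add[OF this res_refl[of 1]] show ?thesis unfolding theta_eta by simp
qed

lemma theta_pow_eta_res: "(\<theta> ^^ i) \<eta> \<doteq> \<eta> + of_nat i"
proof (induction i)
  case (Suc i)
  have "(\<theta> ^^ i) \<eta> \<in> \<O>\<^sub>S" by (rule endo_OS[OF \<theta>.funpow eta_OS])
  from theta_res[OF Suc this R.add_closed[OF eta_OS R.of_nat_closed]]
  have "(\<theta> ^^ Suc i) \<eta> \<doteq> \<theta> \<eta> + of_nat i"
    by (simp add: \<theta>.add eta_in_S)
  also have "\<theta> \<eta> + of_nat i \<doteq> (\<eta> + 1) + of_nat i"
    by (rule res_add[OF theta_eta_res res_refl])
  finally show ?case by (simp add: add_ac)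
qed simp

lemma ev_shift_res: "ev (h \<circ>\<^sub>p [:1, 1:]) \<eta> \<doteq> \<theta> (ev h \<eta>)"
proof -
  have "ev (h \<circ>\<^sub>p [:1, 1:]) \<eta> = ev h (\<eta> + 1)"
    by (simp only: ev_pcompose ev_linear of_int_1 add.commute)
  also have "\<dots> \<doteq> ev h (\<theta> \<eta>)"
    by (rule ev_res[OF res_sym[OF theta_eta_res] R.add_closed[OF eta_OS R.one_closed] theta_OS[OF eta_OS]])
  also have "ev h (\<theta> \<eta>) = \<theta> (ev h \<eta>)"
    by (rule endo_ev[OF \<theta>.subfield_endo_axioms eta_in_S, symmetric])
  finally show ?thesis .
qed

text \<open>The powers of \<open>\<eta>\<close> below \<open>p\<close> are linearly independent modulo \<open>lam\<close> over the field with \<open>p\<close>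
  elements: as \<open>\<theta> \<eta> \<equiv> \<eta> + 1\<close>, a relation yields the relations given by its differences.\<close>

lemma eta_independent:
  assumes "degree h < p" "ev h \<eta> \<doteq> 0"
  shows "int p dvd coeff h i"
proof (rule difference_descent[of p "\<lambda>h. ev h \<eta> \<doteq> 0"])
  show "prime p" by (rule p_prime)
  show "degree h \<le> p - 1" "p - 1 < p" using assms(1) p_gt_2 by simp_all
  show "ev h \<eta> \<doteq> 0" by fact
next
  fix h assume h: "ev h \<eta> \<doteq> 0"
  have "ev (h \<circ>\<^sub>p [:1, 1:]) \<eta> \<doteq> \<theta> (ev h \<eta>)" by (rule ev_shift_res)
  also have "\<dots> \<doteq> \<theta> 0"
    by (rule theta_res[OF h ev_closed[OF eta_OS] R.zero_closed])
  finally have "ev (h \<circ>\<^sub>p [:1, 1:]) \<eta> \<doteq> 0" by simp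
  hence "ev (h \<circ>\<^sub>p [:1, 1:] - h) \<eta> \<doteq> 0 - 0" unfolding ev_diff using h by (rule res_diff)
  thus "ev (h \<circ>\<^sub>p [:1, 1:] - h) \<eta> \<doteq> 0" by simp
next
  fix h a n assume "ev h \<eta> \<doteq> 0" "int p dvd a"
  hence "ev (h - monom a n) \<eta> \<doteq> 0 - 0"
    unfolding ev_diff ev_monom
    by (intro res_diff res_int_p_multiple R.power_closed eta_OS)
  thus "ev (h - monom a n) \<eta> \<doteq> 0" by simp
next
  fix a assume "ev [:a:] \<eta> \<doteq> 0"
  thus "int p dvd a" unfolding ev_const by (simp add: res_int_0)
qed

lemma adjoin_eta_residue:
  assumes "x \<in> adjoin (integers_of K) \<eta>"
  shows "\<exists>h. \<exists>r\<in>adjoin (integers_of K) \<eta>. degree h < p \<and> x = ev h \<eta> + lam * r"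
proof -
  obtain f where f: "x = poly f \<eta>" "\<forall>i. coeff f i \<in> integers_of K"
    using assms unfolding adjoin_def by blast
  obtain q r where qr: "f = q * eta_poly + r" "\<forall>i. coeff r i \<in> integers_of K" "r = 0 \<or> degree r < p"
    using OK.monic_division[OF coeff_eta_poly lead_coeff_eta_poly, of f] f(2) degree_eta_poly by metis
  have xr: "x = poly r \<eta>" using f(1) qr(1) poly_eta_poly by simp
  have "\<forall>i. \<exists>n z. z \<in> integers_of K \<and> coeff r i = of_int n + lam * z"
    using integers_K_residue qr(2) by blast
  then obtain n z where nz: "\<And>i. z i \<in> integers_of K" "\<And>i. coeff r i = of_int (n i) + lam * z i"
    by metis
  define h where "h = (\<Sum>i<p. monom (n i) i)"
  define g where "g = (\<Sum>i<p. monom (z i) i)"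
  have dh: "degree h < p"
  proof -
    have "degree h \<le> p - 1" unfolding h_def
      by (intro degree_sum_le) (auto intro: order_trans[OF degree_monom_le])
    thus ?thesis using p_gt_2 by linarith
  qed
  have cr: "coeff r i = 0" if "i \<ge> p" for i
    using qr(3) that by (cases "r = 0") (auto simp: coeff_eq_0)
  have "r = (\<Sum>i<p. monom (coeff r i) i)"
    by (rule poly_eqI) (use cr in \<open>auto simp: coeff_sum not_less\<close>)
  hence "x = (\<Sum>i<p. coeff r i * \<eta> ^ i)"
    unfolding xr by (metis (no_types, lifting) poly_monom poly_sum sum.cong)
  also have "\<dots> = ev h \<eta> + lam * poly g \<eta>"
    unfolding nz(2) h_def g_def
    by (simp add: poly_sum poly_monom of_int_poly_hom.hom_sum algebra_simps sum.distrib sum_distrib_left)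
  finally have "x = ev h \<eta> + lam * poly g \<eta>" .
  moreover have "coeff g i \<in> integers_of K" for i
    unfolding g_def using nz(1) by (auto simp: coeff_sum intro!: OK.sum_closed)
  hence "poly g \<eta> \<in> adjoin (integers_of K) \<eta>" by (rule OK.adjoinI)
  ultimately show ?thesis using dh by blast
qed

text \<open>The order generated by \<open>\<eta>\<close> over the integers of \<open>K\<close> is saturated at \<open>lam\<close>, because its residues are
  integer polynomials in \<open>\<eta>\<close>, and such a polynomial can only vanish modulo \<open>lam\<close> if \<open>p\<close> divides
  its coefficients.\<close>

lemma integers_S_residue:
  assumes "x \<in> \<O>\<^sub>S"
  shows "\<exists>h. degree h < p \<and> x \<doteq> ev h \<eta>"
proof -
  let ?R = "adjoin (integers_of K) \<eta>"
  interpret a: subring_of_complex ?R by (rule OK.subring_adjoin)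
  have ZR: "Zzeta \<subseteq> ?R"
    using Zzeta_subset_K Zzeta_algebraic_int OK.base_subset_adjoin[of \<eta>] by (auto simp: integers_of_def)
  have RO: "?R \<subseteq> \<O>\<^sub>S"
    by (rule adjoin_subset[OF OS_subring OK_subset_OS eta_OS])
  have etaR: "\<eta> \<in> ?R" by (rule OK.generator_in_adjoin)
  have "1 + lam * \<eta> \<in> ?R"
    using ZR lam_in_Zzeta a.add_closed[OF a.one_closed a.mult_closed[OF _ etaR]] by blast
  hence "\<omega> \<in> ?R" by (simp only: omega_eta[symmetric])
  hence "adjoin Zzeta \<omega> \<subseteq> ?R" by (rule adjoin_subset[OF a.subring_of_complex_axioms ZR])
  hence den: "\<exists>n>0. of_nat n * y \<in> ?R" if "y \<in> \<O>\<^sub>S" for y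
    using S_denominator[OF OS_in_S[OF that]] by blast
  have sat: "y \<in> ?R" if y: "y \<in> \<O>\<^sub>S" "lam * y \<in> ?R" for y
  proof -
    obtain h r where hr: "r \<in> ?R" "degree h < p" "lam * y = ev h \<eta> + lam * r"
      using adjoin_eta_residue[OF y(2)] by blast
    have "ev h \<eta> - 0 = lam * (y - r)" using hr(3) by (simp add: algebra_simps)
    hence "ev h \<eta> \<doteq> 0"
      by (rule res_eqI) (use y(1) hr(1) RO in \<open>blast intro: R.diff_closed\<close>)
    hence "int p dvd coeff h i" for i
      using eta_independent[of h i] hr(2) by simp
    hence "coeff h i = int p * (coeff h i div int p)" for i by simp
    hence "h = smult (int p) (map_poly (\<lambda>a. a div int p) h)"
      by (intro poly_eqI) (simp add: coeff_map_poly)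
    then obtain g where g: "h = smult (int p) g" by blast
    have "ev h \<eta> = of_nat p * ev g \<eta>"
      unfolding g by (simp add: of_int_hom.map_poly_hom_smult)
    hence "lam * y = lam * (lam ^ (p - 2) * u' * ev g \<eta> + r)"
      using hr(3) lam_dvd_p by (simp add: algebra_simps)
    hence "y = lam ^ (p - 2) * u' * ev g \<eta> + r" using lam_nonzero by simp
    moreover have "ev g \<eta> \<in> ?R"
      by (rule a.poly_closed[OF _ etaR]) (simp add: coeff_map_poly)
    moreover have "lam ^ (p - 2) * u' \<in> ?R"
      using Zzeta.mult_closed[OF Zzeta.power_closed[OF lam_in_Zzeta] u'(1)] ZR by blast
    ultimately show ?thesis using a.add_closed[OF a.mult_closed hr(1)] by simp
  qed
  obtain r z where rz: "r \<in> ?R" "z \<in> \<O>\<^sub>S" "x = r + lam * z"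
    using residues_from_order[OF a.subring_of_complex_axioms OS_subring ZR RO den sat assms] by blast
  obtain h r' where h: "r' \<in> ?R" "degree h < p" "r = ev h \<eta> + lam * r'"
    using adjoin_eta_residue[OF rz(1)] by blast
  have "x - ev h \<eta> = lam * (r' + z)" using rz(3) h(3) by (simp add: algebra_simps)
  hence "x \<doteq> ev h \<eta>"
    by (rule res_eqI) (use h(1) rz(2) RO in \<open>blast intro: R.add_closed\<close>)
  thus ?thesis using h(2) by blast
qed

text \<open>If \<open>h(\<eta>)\<close> is invariant, the polynomials \<open>h(X + 1)\<close> and \<open>h(X)\<close> agree modulo \<open>p\<close>; so \<open>h\<close> takes the value
  \<open>h(0)\<close> at all integers modulo \<open>p\<close> and is constant, its degree being below \<open>p\<close>.\<close>

lemma theta_invariant_residue: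
  assumes "z \<in> \<O>\<^sub>S" "\<theta> z \<doteq> z"
  shows "\<exists>n. z \<doteq> of_int n"
proof -
  obtain h where h: "degree h < p" "z \<doteq> ev h \<eta>" using integers_S_residue[OF assms(1)] by blast
  let ?D = "h \<circ>\<^sub>p [:1, 1:] - h"
  have "ev (h \<circ>\<^sub>p [:1, 1:]) \<eta> \<doteq> \<theta> (ev h \<eta>)" by (rule ev_shift_res)
  also have "\<dots> \<doteq> \<theta> z" by (rule theta_res[OF res_sym[OF h(2)] ev_closed[OF eta_OS] assms(1)])
  also have "\<dots> \<doteq> z" by (rule assms(2))
  also have "\<dots> \<doteq> ev h \<eta>" by (rule h(2))
  finally have "ev ?D \<eta> \<doteq> ev h \<eta> - ev h \<eta>" unfolding ev_diff by (rule res_diff[OF _ res_refl])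
  moreover have "degree ?D < p"
    using h(1) by (intro degree_diff_less) (simp_all add: degree_pcompose)
  ultimately have "int p dvd coeff ?D i" for i using eta_independent[of ?D] by simp
  hence "int p dvd poly ?D c" for c by (rule poly_dvd_if_coeffs_dvd)
  moreover have "poly ?D c = poly h (c + 1) - poly h c" for c
    by (simp add: poly_pcompose add.commute)
  ultimately have step: "[poly h (c + 1) = poly h c] (mod int p)" for c
    by (simp only: cong_iff_dvd_diff)
  have const: "[poly h c = poly h 0] (mod int p)" for c
  proof (induction c rule: int_induct[of _ 0])
    case (step1 c)
    thus ?case using step[of c] cong_trans by blast
  next
    case (step2 c)
    thus ?case using cong_trans[OF cong_sym[OF step[of "c - 1"]]] by simp
  qed simp
  define g where "g = h - [:poly h 0:]"
  have "degree g < p" unfolding g_def using h(1) p_gt_2 by (intro degree_diff_less) simp_all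
  moreover have "int p dvd poly g c" for c using const[of c] by (simp add: g_def cong_iff_dvd_diff)
  ultimately have "int p dvd coeff g i" for i using int_values_divisible[OF p_prime] by blast
  hence "ev g \<eta> \<doteq> 0" using ev_cong_0[OF _ eta_OS] by blast
  hence "ev h \<eta> - of_int (poly h 0) + of_int (poly h 0) \<doteq> 0 + of_int (poly h 0)"
    unfolding g_def ev_diff ev_const by (rule res_add[OF _ res_refl])
  hence "ev h \<eta> \<doteq> of_int (poly h 0)" by simp
  thus ?thesis using res_trans[OF h(2)] by blast
qed

text \<open>By the commutation rule, \<open>\<theta>\<close> changes \<open>\<sigma> \<eta>\<close> and \<open>\<kappa> \<eta>\<close> by the same amount \<open>\<kappa>\<close>, so their
  difference is an invariant residue.\<close>

lemma sigma_eta_res: "\<exists>b. \<sigma> \<eta> \<doteq> of_nat \<kappa> * \<eta> + of_int b"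
proof -
  have s: "\<sigma> \<eta> \<in> \<O>\<^sub>S" by (rule sigma_OS[OF eta_OS])
  have ke: "of_nat \<kappa> * \<eta> \<in> \<O>\<^sub>S" by (rule R.mult_closed[OF R.of_nat_closed eta_OS])
  let ?z = "\<sigma> \<eta> - of_nat \<kappa> * \<eta>"
  have zO: "?z \<in> \<O>\<^sub>S" by (rule R.diff_closed[OF s ke])
  have "\<theta> (\<sigma> \<eta>) = (\<theta> ^^ (k * \<kappa>)) (\<sigma> \<eta>)"
    using theta_pow_cong[OF OS_in_S[OF s], of 1 "k * \<kappa>"] k_kap by (simp add: cong_sym_eq)
  also have "\<dots> = \<sigma> ((\<theta> ^^ \<kappa>) \<eta>)" by (rule sigma_theta_pow[OF eta_in_S, symmetric])
  also have "\<dots> \<doteq> \<sigma> (\<eta> + of_nat \<kappa>)"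
    by (rule sigma_res[OF theta_pow_eta_res endo_OS[OF \<theta>.funpow eta_OS] R.add_closed[OF eta_OS R.of_nat_closed]])
  also have "\<sigma> (\<eta> + of_nat \<kappa>) = \<sigma> \<eta> + of_nat \<kappa>" by (simp add: \<sigma>.add eta_in_S)
  finally have 1: "\<theta> (\<sigma> \<eta>) \<doteq> \<sigma> \<eta> + of_nat \<kappa>" .
  have "\<theta> (of_nat \<kappa> * \<eta>) = of_nat \<kappa> * \<theta> \<eta>" by (simp add: \<theta>.mult eta_in_S)
  also have "\<dots> \<doteq> of_nat \<kappa> * (\<eta> + 1)" by (rule res_scale[OF theta_eta_res R.of_nat_closed])
  finally have 2: "\<theta> (of_nat \<kappa> * \<eta>) \<doteq> of_nat \<kappa> * \<eta> + of_nat \<kappa>" by (simp add: algebra_simps)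
  have "\<theta> ?z = \<theta> (\<sigma> \<eta>) - \<theta> (of_nat \<kappa> * \<eta>)" by (rule \<theta>.diff[OF OS_in_S[OF s] OS_in_S[OF ke]])
  also have "\<dots> \<doteq> (\<sigma> \<eta> + of_nat \<kappa>) - (of_nat \<kappa> * \<eta> + of_nat \<kappa>)" by (rule res_diff[OF 1 2])
  finally have "\<theta> ?z \<doteq> ?z" by simp
  then obtain n where n: "?z \<doteq> of_int n" using theta_invariant_residue[OF zO] by blast
  have "of_nat \<kappa> * \<eta> + ?z \<doteq> of_nat \<kappa> * \<eta> + of_int n" by (rule res_add[OF res_refl n])
  thus ?thesis by auto
qed

lemma kap_ne_1: "\<not> [int \<kappa> = 1] (mod int p)"
proof
  assume "[int \<kappa> = 1] (mod int p)"
  hence "[\<kappa> = 1] (mod p)" by (metis cong_int_iff of_nat_1)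
  hence "[k * \<kappa> = k * 1] (mod p)" by (rule cong_scalar_left)
  hence "[k = 1] (mod p)" using k_kap by (metis cong_sym cong_trans mult.right_neutral)
  thus False using k_ne_1 by blast
qed

text \<open>Complete splitting. Let \<open>c\<close> be the residue of \<open>t\<close>. Raising \<open>\<sigma> \<eta> \<equiv> \<kappa> \<eta> + b\<close> to the \<open>p\<close>-th power adds
  \<open>\<kappa> c\<close> to the right side, while \<open>\<sigma>\<close> of \<open>\<eta>\<^sup>p \<equiv> \<eta> + c\<close> adds \<open>c\<close>; since \<open>\<kappa>\<close> is not
  congruent to 1, the residue \<open>c\<close> is zero.\<close>

lemma eta_frobenius: "\<eta> ^ p \<doteq> \<eta>"
proof -
  obtain c z where c: "z \<in> integers_of K" "t = of_int c + lam * z"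
    using integers_K_residue[OF A_t(2)] by blast
  have t_res: "t \<doteq> of_int c"
    by (rule res_eqI[of _ _ z]) (use c OK_subset_OS in auto)
  have "(\<Sum>j\<in>{1..<p}. eta_coeff j * \<eta> ^ j) \<doteq> (\<Sum>j\<in>{1..<p}. if j = 1 then - \<eta> else 0)"
  proof (rule res_sum)
    fix j assume j: "j \<in> {1..<p}"
    show "eta_coeff j * \<eta> ^ j \<doteq> (if j = 1 then - \<eta> else 0)"
    proof (cases "j = 1")
      case True
      obtain s where s: "s \<in> Zzeta" "u' = lam * s - 1" using u'(3) by blast
      have "eta_coeff 1 * \<eta> ^ 1 - - \<eta> = lam * (s * \<eta>)"
        using p_gt_2 by (simp add: eta_coeff_def s(2) algebra_simps)
      hence "eta_coeff 1 * \<eta> ^ 1 \<doteq> - \<eta>"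
        by (rule res_eqI) (use s(1) Zzeta_subset_OS R.mult_closed[OF _ eta_OS] in blast)
      thus ?thesis using True by simp
    next
      case False
      hence "j - 1 = Suc (j - 2)" using j by auto
      hence "eta_coeff j * \<eta> ^ j - 0 = lam * (of_nat ((p choose j) div p) * u' * lam ^ (j - 2) * \<eta> ^ j)"
        by (simp add: eta_coeff_def)
      moreover have "of_nat ((p choose j) div p) * u' * lam ^ (j - 2) * \<eta> ^ j \<in> \<O>\<^sub>S"
        using Zzeta_subset_OS u'(1)
        by (intro R.mult_closed[OF R.mult_closed[OF R.mult_closed[OF R.of_nat_closed]
                R.power_closed[OF lam_R]] R.power_closed[OF eta_OS]]) blast
      ultimately have "eta_coeff j * \<eta> ^ j \<doteq> 0" by (rule res_eqI)
      thus ?thesis using False by simp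
    qed
  qed
  also have "(\<Sum>j\<in>{1..<p}. if j = 1 then - \<eta> else 0) = - \<eta>" using p_gt_2 by simp
  finally have "t - (\<Sum>j\<in>{1..<p}. eta_coeff j * \<eta> ^ j) \<doteq> of_int c - - \<eta>" by (rule res_diff[OF t_res])
  moreover have "t - (\<Sum>j\<in>{1..<p}. eta_coeff j * \<eta> ^ j) = \<eta> ^ p"
    using eta_equation by (metis add_diff_cancel_right')
  ultimately have frob: "\<eta> ^ p \<doteq> \<eta> + of_int c" by (simp add: add.commute)
  obtain b where b: "\<sigma> \<eta> \<doteq> of_nat \<kappa> * \<eta> + of_int b" using sigma_eta_res by blast
  have ke: "of_nat \<kappa> * \<eta> \<in> \<O>\<^sub>S" by (rule R.mult_closed[OF R.of_nat_closed eta_OS])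
  have keb: "of_nat \<kappa> * \<eta> + of_int b \<in> \<O>\<^sub>S" by (rule R.add_closed[OF ke R.of_int_closed])
  have "of_nat \<kappa> * \<eta> + of_int b + of_int c \<doteq> \<sigma> \<eta> + of_int c"
    by (rule res_add[OF res_sym[OF b] res_refl])
  also have "\<dots> = \<sigma> (\<eta> + of_int c)" by (simp add: \<sigma>.add eta_in_S)
  also have "\<dots> \<doteq> \<sigma> (\<eta> ^ p)"
    by (rule sigma_res[OF res_sym[OF frob] R.add_closed[OF eta_OS R.of_int_closed] R.power_closed[OF eta_OS]])
  also have "\<sigma> (\<eta> ^ p) = \<sigma> \<eta> ^ p" by (rule \<sigma>.power[OF eta_in_S])
  also have "\<dots> \<doteq> (of_nat \<kappa> * \<eta> + of_int b) ^ p"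
    by (rule res_power[OF b sigma_OS[OF eta_OS] keb])
  also have "\<dots> \<doteq> (of_nat \<kappa> * \<eta>) ^ p + of_int b ^ p"
    by (rule res_freshman[OF ke R.of_int_closed])
  also have "\<dots> \<doteq> of_nat \<kappa> * (\<eta> + of_int c) + of_int b"
  proof (rule res_add[OF _ res_int_frobenius])
    have "of_int (int \<kappa>) ^ p * \<eta> ^ p \<doteq> of_int (int \<kappa>) * (\<eta> + of_int c)"
      by (rule res_mult[OF res_int_frobenius frob R.power_closed[OF eta_OS] R.of_int_closed])
    thus "(of_nat \<kappa> * \<eta>) ^ p \<doteq> of_nat \<kappa> * (\<eta> + of_int c)" by (simp add: power_mult_distrib)
  qed
  finally have "of_nat \<kappa> * \<eta> + of_int b + of_int c - (of_nat \<kappa> * \<eta> + of_int b) \<doteq>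
      of_nat \<kappa> * (\<eta> + of_int c) + of_int b - (of_nat \<kappa> * \<eta> + of_int b)"
    by (rule res_diff[OF _ res_refl])
  hence "of_int (1 * c) \<doteq> of_int (int \<kappa> * c)" by (simp add: algebra_simps)
  hence cc: "[1 * c = int \<kappa> * c] (mod int p)" by (simp only: res_int)
  have "int p dvd c"
  proof (rule ccontr)
    assume "\<not> int p dvd c"
    hence "coprime c (int p)" using coprime_int_prime[OF p_prime] by blast
    hence "[1 = int \<kappa>] (mod int p)" using cc by (simp only: cong_mult_rcancel)
    thus False using kap_ne_1 by (simp add: cong_sym_eq)
  qed
  hence "of_int c \<doteq> 0" by (simp add: res_int_0)
  hence "\<eta> + of_int c \<doteq> \<eta> + 0" by (rule res_add[OF res_refl])
  thus ?thesis using res_trans[OF frob] by simp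
qed

text \<open>The affine map \<open>X \<mapsto> \<kappa> X + b\<close> has a fixed point modulo \<open>p\<close>, which becomes the new origin.\<close>

lemma adapted_shift:
  "\<exists>c. (\<eta> - of_int c) ^ p \<doteq> \<eta> - of_int c \<and> \<sigma> (\<eta> - of_int c) \<doteq> of_nat \<kappa> * (\<eta> - of_int c)"
proof -
  obtain b where b: "\<sigma> \<eta> \<doteq> of_nat \<kappa> * \<eta> + of_int b" using sigma_eta_res by blast
  have "\<not> int p dvd 1 - int \<kappa>"
    using kap_ne_1 by (simp add: cong_iff_dvd_diff dvd_diff_commute)
  hence "coprime (1 - int \<kappa>) (int p)" using coprime_int_prime[OF p_prime] by blast
  then obtain x where "[(1 - int \<kappa>) * x = 1] (mod int p)" using cong_solve_coprime_int by blast
  hence "[(1 - int \<kappa>) * x * b = 1 * b] (mod int p)" by (rule cong_scalar_right)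
  hence cb: "[int \<kappa> * (x * b) + b = x * b] (mod int p)"
    by (simp add: cong_iff_dvd_diff algebra_simps dvd_diff_commute)
  define c where "c = x * b"
  define \<epsilon> where "\<epsilon> = \<eta> - of_int c"
  have eO: "\<epsilon> \<in> \<O>\<^sub>S" unfolding \<epsilon>_def by (rule R.diff_closed[OF eta_OS R.of_int_closed])
  have "\<epsilon> ^ p = (\<eta> + of_int (- c)) ^ p" by (simp add: \<epsilon>_def)
  also have "\<dots> \<doteq> \<eta> ^ p + of_int (- c) ^ p" by (rule res_freshman[OF eta_OS R.of_int_closed])
  also have "\<dots> \<doteq> \<eta> + of_int (- c)" by (rule res_add[OF eta_frobenius res_int_frobenius])
  also have "\<dots> = \<epsilon>" by (simp add: \<epsilon>_def)
  finally have 1: "\<epsilon> ^ p \<doteq> \<epsilon>" .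
  have "\<sigma> \<epsilon> = \<sigma> \<eta> - of_int c" by (simp add: \<epsilon>_def \<sigma>.diff eta_in_S)
  also have "\<dots> \<doteq> (of_nat \<kappa> * \<eta> + of_int b) - of_int c" by (rule res_diff[OF b res_refl])
  also have "\<dots> = of_nat \<kappa> * \<epsilon> + (of_int (int \<kappa> * c + b) - of_int c)"
    by (simp add: \<epsilon>_def algebra_simps)
  also have "\<dots> \<doteq> of_nat \<kappa> * \<epsilon> + (of_int c - of_int c)"
    by (intro res_add res_refl res_diff) (use cb in \<open>simp only: res_int c_def\<close>)
  finally have 3: "\<sigma> \<epsilon> \<doteq> of_nat \<kappa> * \<epsilon>" by simp
  from 1 3 show ?thesis unfolding \<epsilon>_def by blast
qed

end

section \<open>Idempotents modulo \<open>lam\<close>\<close>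

context kummer_galois
begin

definition \<epsilon> :: complex where
  "\<epsilon> = \<eta> - of_int (SOME c. (\<eta> - of_int c) ^ p \<doteq> \<eta> - of_int c \<and>
     \<sigma> (\<eta> - of_int c) \<doteq> of_nat \<kappa> * (\<eta> - of_int c))"

lemma eps_frobenius: "\<epsilon> ^ p \<doteq> \<epsilon>"
  and sigma_eps: "\<sigma> \<epsilon> \<doteq> of_nat \<kappa> * \<epsilon>"
  and eps_shift: "\<exists>c. \<epsilon> = \<eta> - of_int c"
  using someI_ex[OF adapted_shift] unfolding \<epsilon>_def by blast+

lemma eps_OS: "\<epsilon> \<in> \<O>\<^sub>S"
  using eps_shift R.diff_closed[OF eta_OS R.of_int_closed] by metis

lemma eps_in_S: "\<epsilon> \<in> S"
  using eps_OS OS_in_S by blast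

lemma eps_residue: "x \<in> \<O>\<^sub>S \<Longrightarrow> \<exists>h. degree h < p \<and> x \<doteq> ev h \<epsilon>"
proof -
  assume x: "x \<in> \<O>\<^sub>S"
  obtain c where c: "\<epsilon> = \<eta> - of_int c" using eps_shift by blast
  obtain h where h: "degree h < p" "x \<doteq> ev h \<eta>" using integers_S_residue[OF x] by blast
  have "of_int c + \<epsilon> = \<eta>" using c by simp
  hence "ev (h \<circ>\<^sub>p [:c, 1:]) \<epsilon> = ev h \<eta>" by (simp only: ev_pcompose ev_linear)
  moreover have "degree (h \<circ>\<^sub>p [:c, 1:]) < p" using h(1) by (simp add: degree_pcompose)
  ultimately show ?thesis using h(2) by metis
qed

definition idem_poly :: "int \<Rightarrow> int poly" where
  "idem_poly c = 1 - [:- c, 1:] ^ (p - 1)"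

text \<open>Modulo \<open>lam\<close> this is the indicator function of the point \<open>\<epsilon> = c\<close>. The residue of \<open>x\<close> at that point is
  the integer \<open>n\<close> modulo \<open>p\<close> with \<open>x * idem c \<doteq> of_int n * idem c\<close>; in this way no quotient ring is needed.\<close>

definition idem :: "int \<Rightarrow> complex" where
  "idem c = 1 - (\<epsilon> - of_int c) ^ (p - 1)"

lemma ev_power: "ev (f ^ n) x = ev f x ^ n"
  by (simp add: of_int_poly_hom.hom_power)

lemma idem_ev: "idem c = ev (idem_poly c) \<epsilon>"
proof -
  have "ev 1 \<epsilon> = 1" by simp
  thus ?thesis unfolding idem_def idem_poly_def ev_diff ev_power ev_linear by simp
qed

lemma idem_OS: "idem c \<in> \<O>\<^sub>S"
  unfolding idem_ev by (rule ev_closed[OF eps_OS])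

lemma idem_in_S: "idem c \<in> S"
  using idem_OS OS_in_S by blast

lemma idem_cong: "[c = c'] (mod int p) \<Longrightarrow> idem c \<doteq> idem c'"
  unfolding idem_def
  by (intro res_diff res_refl res_power R.diff_closed eps_OS R.of_int_closed) (simp add: res_int)

lemma idem_nonzero: "\<not> idem c \<doteq> 0"
proof
  assume i0: "idem c \<doteq> 0"
  obtain b where b: "\<epsilon> = \<eta> - of_int b" using eps_shift by blast
  define h where "h = 1 - [:- (b + c), 1:] ^ (p - 1)"
  have "\<epsilon> - of_int c = of_int (- (b + c)) + \<eta>" unfolding b by simp
  hence "idem c = ev h \<eta>"
    unfolding idem_def h_def ev_diff ev_power ev_linear by (simp only:) simp
  hence h0: "ev h \<eta> \<doteq> 0" using i0 by simp
  have d: "degree ([:- (b + c), 1:] ^ (p - 1)) = p - 1" by (simp add: degree_power_eq)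
  have "degree h \<le> p - 1" unfolding h_def
    by (rule degree_diff_le[OF _ eq_imp_le[OF d]]) simp
  hence "degree h < p" using p_gt_2 by linarith
  from eta_independent[OF this h0] have "int p dvd coeff h (p - 1)" .
  moreover have "coeff ([:- (b + c), 1:] ^ (p - 1)) (p - 1) = 1"
    using lead_coeff_power[of "[:- (b + c), 1:]" "p - 1"] unfolding d by simp
  hence "coeff h (p - 1) = - 1" using p_gt_2 unfolding h_def by (simp add: coeff_1)
  ultimately show False using p_gt_2 by simp
qed

lemma idem_eps: "\<epsilon> * idem c \<doteq> of_int c * idem c"
proof -
  let ?x = "\<epsilon> + of_int (- c)"
  have xO: "?x \<in> \<O>\<^sub>S" by (rule R.add_closed[OF eps_OS R.of_int_closed])
  have "?x ^ p \<doteq> \<epsilon> ^ p + of_int (- c) ^ p" by (rule res_freshman[OF eps_OS R.of_int_closed])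
  also have "\<dots> \<doteq> ?x" by (rule res_add[OF eps_frobenius res_int_frobenius])
  finally have "?x - ?x ^ p \<doteq> ?x - ?x" by (rule res_diff[OF res_refl])
  moreover have "?x ^ p = ?x * ?x ^ (p - 1)"
    using p_gt_2 by (simp flip: power_Suc)
  ultimately have "?x * (1 - ?x ^ (p - 1)) \<doteq> 0" by (simp add: right_diff_distrib)
  hence "?x * idem c \<doteq> 0" unfolding idem_def by simp
  hence "?x * idem c + of_int c * idem c \<doteq> 0 + of_int c * idem c" by (rule res_add[OF _ res_refl])
  thus ?thesis by (simp add: algebra_simps)
qed

lemma idem_ev_mult: "ev h \<epsilon> * idem c \<doteq> of_int (poly h c) * idem c"
proof (induction h)
  case 0
  show ?case by simp
next
  case (pCons a h)
  have "\<epsilon> * (ev h \<epsilon> * idem c) \<doteq> \<epsilon> * (of_int (poly h c) * idem c)"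
    by (rule res_scale[OF pCons.IH eps_OS])
  also have "\<dots> = of_int (poly h c) * (\<epsilon> * idem c)" by simp
  also have "\<dots> \<doteq> of_int (poly h c) * (of_int c * idem c)"
    by (rule res_scale[OF idem_eps R.of_int_closed])
  finally have "of_int a * idem c + \<epsilon> * (ev h \<epsilon> * idem c) \<doteq>
      of_int a * idem c + of_int (poly h c) * (of_int c * idem c)"
    by (rule res_add[OF res_refl])
  thus ?case by (simp add: of_int_hom.map_poly_pCons_hom algebra_simps)
qed

lemma idem_integer: "x \<in> \<O>\<^sub>S \<Longrightarrow> \<exists>n. x * idem c \<doteq> of_int n * idem c"
proof -
  assume x: "x \<in> \<O>\<^sub>S"
  obtain h where h: "x \<doteq> ev h \<epsilon>" using eps_residue[OF x] by blast
  have "x * idem c \<doteq> ev h \<epsilon> * idem c"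
    by (rule res_mult[OF h res_refl idem_OS ev_closed[OF eps_OS]])
  also have "\<dots> \<doteq> of_int (poly h c) * idem c" by (rule idem_ev_mult)
  finally show ?thesis by blast
qed

lemma idem_integer_unique: "of_int n * idem c \<doteq> 0 \<longleftrightarrow> int p dvd n"
proof
  assume n0: "of_int n * idem c \<doteq> 0"
  show "int p dvd n"
  proof (rule ccontr)
    assume "\<not> int p dvd n"
    hence "coprime n (int p)" using coprime_int_prime[OF p_prime] by blast
    then obtain m where "[n * m = 1] (mod int p)" using cong_solve_coprime_int by blast
    hence "of_int 1 \<doteq> of_int (n * m)" by (simp only: res_int cong_sym_eq)
    hence "idem c * of_int 1 \<doteq> idem c * of_int (n * m)" by (rule res_scale[OF _ idem_OS])
    also have "\<dots> = of_int m * (of_int n * idem c)" by simp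
    also have "\<dots> \<doteq> of_int m * 0" by (rule res_scale[OF n0 R.of_int_closed])
    finally show False using idem_nonzero by simp
  qed
next
  assume "int p dvd n"
  thus "of_int n * idem c \<doteq> 0" by (rule res_int_p_multiple[OF _ idem_OS])
qed

lemma idem_idem: "idem c' * idem c \<doteq> (if [c = c'] (mod int p) then idem c else 0)"
proof -
  have "idem c' * idem c \<doteq> of_int (poly (idem_poly c') c) * idem c"
    unfolding idem_ev[of c'] by (rule idem_ev_mult)
  also have "poly (idem_poly c') c = 1 - (c - c') ^ (p - 1)"
    by (simp add: idem_poly_def)
  also have "of_int \<dots> * idem c \<doteq> (if [c = c'] (mod int p) then idem c else 0)"
  proof (cases "[c = c'] (mod int p)")
    case True
    hence "int p dvd (c - c') ^ (p - 1)"
      using p_gt_2 by (simp add: cong_iff_dvd_diff dvd_power_le dvd_trans[OF _ dvd_power])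
    hence "of_int ((c - c') ^ (p - 1)) * idem c \<doteq> 0" by (simp only: idem_integer_unique)
    hence "idem c - of_int ((c - c') ^ (p - 1)) * idem c \<doteq> idem c - 0" by (rule res_diff[OF res_refl])
    thus ?thesis using True by (simp add: algebra_simps)
  next
    case False
    hence "[(c - c') ^ (p - 1) = 1] (mod int p)"
      by (intro int_pow_fermat p_prime) (simp add: cong_iff_dvd_diff)
    hence "int p dvd 1 - (c - c') ^ (p - 1)" by (simp add: cong_iff_dvd_diff dvd_diff_commute)
    thus ?thesis using False by (simp only: idem_integer_unique if_False)
  qed
  finally show ?thesis .
qed

text \<open>The integers of \<open>S\<close> modulo \<open>lam\<close> embed into the functions on the \<open>p\<close> points: an element is \<open>h(\<epsilon>)\<close> with
  \<open>h\<close> of degree below \<open>p\<close>, and if all values \<open>h(c)\<close> vanish modulo \<open>p\<close> then so do the coefficients.\<close>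

lemma res_0_if_all_idem_0:
  assumes x: "x \<in> \<O>\<^sub>S" "\<And>c. x * idem c \<doteq> 0"
  shows "x \<doteq> 0"
proof -
  obtain h where h: "degree h < p" "x \<doteq> ev h \<epsilon>" using eps_residue[OF x(1)] by blast
  have "int p dvd poly h c" for c
  proof -
    have "of_int (poly h c) * idem c \<doteq> ev h \<epsilon> * idem c" by (rule res_sym[OF idem_ev_mult])
    also have "\<dots> \<doteq> x * idem c"
      by (rule res_mult[OF res_sym[OF h(2)] res_refl idem_OS x(1)])
    also have "\<dots> \<doteq> 0" by (rule x(2))
    finally show ?thesis by (simp only: idem_integer_unique)
  qed
  hence "int p dvd coeff h i" for i using int_values_divisible[OF p_prime h(1)] by blast
  hence "ev h \<epsilon> \<doteq> 0" using ev_cong_0[OF _ eps_OS] by blast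
  thus ?thesis using res_trans[OF h(2)] by blast
qed

lemma k_kap_int: "[int k * int \<kappa> = 1] (mod int p)"
  using k_kap by (metis cong_int_iff of_nat_1 of_nat_mult)

text \<open>As \<open>\<sigma> \<epsilon> \<equiv> \<kappa> \<epsilon>\<close>, the equation \<open>\<sigma> \<epsilon> = c\<close> describes the point \<open>c / \<kappa> = k c\<close>.\<close>

lemma sigma_idem: "\<sigma> (idem c) \<doteq> idem (int k * c)"
proof -
  let ?c = "int k * c"
  have e1: "\<epsilon> - of_int c \<in> S" using S.diff_closed[OF eps_in_S S.of_int_closed] .
  have O1: "of_int (int \<kappa>) * (\<epsilon> - of_int ?c) \<in> \<O>\<^sub>S"
    by (rule R.mult_closed[OF R.of_int_closed R.diff_closed[OF eps_OS R.of_int_closed]])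
  have O2: "\<epsilon> - of_int ?c \<in> \<O>\<^sub>S" by (rule R.diff_closed[OF eps_OS R.of_int_closed])
  have "[c = int k * int \<kappa> * c] (mod int p)"
    using cong_scalar_right[OF cong_sym[OF k_kap_int], of c] by simp
  hence "[c = int \<kappa> * ?c] (mod int p)" by (simp only: mult_ac)
  hence cc: "of_int c \<doteq> of_int (int \<kappa> * ?c)" by (simp only: res_int)
  have "\<sigma> (\<epsilon> - of_int c) = \<sigma> \<epsilon> - of_int c" by (simp add: \<sigma>.diff eps_in_S)
  also have "\<dots> \<doteq> of_nat \<kappa> * \<epsilon> - of_int (int \<kappa> * ?c)" by (rule res_diff[OF sigma_eps cc])
  also have "\<dots> = of_int (int \<kappa>) * (\<epsilon> - of_int ?c)" by (simp add: algebra_simps)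
  finally have s: "\<sigma> (\<epsilon> - of_int c) \<doteq> of_int (int \<kappa>) * (\<epsilon> - of_int ?c)" .
  have "\<not> int p dvd int \<kappa>"
  proof
    assume "int p dvd int \<kappa>"
    hence "int p dvd int k * int \<kappa>" by simp
    hence "[1 = 0] (mod int p)" using k_kap_int by (metis cong_0_iff cong_sym cong_trans)
    thus False using p_gt_2 by (simp add: Cong.cong_def)
  qed
  hence kf: "of_int (int \<kappa> ^ (p - 1)) \<doteq> of_int 1" unfolding res_int by (rule int_pow_fermat[OF p_prime])
  have "\<sigma> (idem c) = 1 - \<sigma> (\<epsilon> - of_int c) ^ (p - 1)"
    unfolding idem_def using \<sigma>.diff[OF S.one_closed S.power_closed[OF e1]] \<sigma>.power[OF e1] by simp
  also have "\<dots> \<doteq> 1 - (of_int (int \<kappa>) * (\<epsilon> - of_int ?c)) ^ (p - 1)"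
    by (rule res_diff[OF res_refl res_power[OF s _ O1]])
       (rule sigma_OS[OF R.diff_closed[OF eps_OS R.of_int_closed]])
  also have "\<dots> = 1 - of_int (int \<kappa> ^ (p - 1)) * (\<epsilon> - of_int ?c) ^ (p - 1)"
    by (simp add: power_mult_distrib)
  also have "\<dots> \<doteq> 1 - of_int 1 * (\<epsilon> - of_int ?c) ^ (p - 1)"
    by (rule res_diff[OF res_refl res_mult[OF kf res_refl R.power_closed[OF O2] R.of_int_closed]])
  finally show ?thesis by (simp add: idem_def)
qed

lemma sigma_pow_OS: "x \<in> \<O>\<^sub>S \<Longrightarrow> (\<sigma> ^^ n) x \<in> \<O>\<^sub>S"
  by (rule endo_OS[OF \<sigma>.funpow])

lemma sigma_pow_res: "x \<doteq> y \<Longrightarrow> x \<in> \<O>\<^sub>S \<Longrightarrow> y \<in> \<O>\<^sub>S \<Longrightarrow> (\<sigma> ^^ n) x \<doteq> (\<sigma> ^^ n) y"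
  by (induction n) (simp_all add: sigma_res sigma_pow_OS)

lemma sigma_pow_idem: "(\<sigma> ^^ n) (idem c) \<doteq> idem (int (k ^ n) * c)"
proof (induction n)
  case (Suc n)
  have "(\<sigma> ^^ Suc n) (idem c) \<doteq> \<sigma> (idem (int (k ^ n) * c))"
    using sigma_res[OF Suc sigma_pow_OS[OF idem_OS] idem_OS] by simp
  also have "\<dots> \<doteq> idem (int k * (int (k ^ n) * c))" by (rule sigma_idem)
  finally show ?case by (simp add: mult_ac)
qed simp

section \<open>Primes of the fixed ring\<close>

text \<open>The ring of integers of the fixed field of \<open>\<sigma>\<close>, see \<open>integers_of_M\<close>.\<close>

definition \<O>\<^sub>M :: "complex set" where "\<O>\<^sub>M = {x \<in> \<O>\<^sub>S. \<sigma> x = x}"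

sublocale OM: subring_of_complex \<O>\<^sub>M
proof
  show "1 \<in> \<O>\<^sub>M" by (simp add: \<O>\<^sub>M_def R.one_closed)
  fix x y assume "x \<in> \<O>\<^sub>M" "y \<in> \<O>\<^sub>M"
  hence xy: "x \<in> \<O>\<^sub>S" "\<sigma> x = x" "y \<in> \<O>\<^sub>S" "\<sigma> y = y" by (simp_all add: \<O>\<^sub>M_def)
  show "x - y \<in> \<O>\<^sub>M" "x * y \<in> \<O>\<^sub>M"
    using xy R.diff_closed[OF xy(1,3)] R.mult_closed[OF xy(1,3)]
    by (simp_all add: \<O>\<^sub>M_def \<sigma>.diff \<sigma>.mult OS_in_S)
qed

lemma OM_OS: "x \<in> \<O>\<^sub>M \<Longrightarrow> x \<in> \<O>\<^sub>S"
  by (simp add: \<O>\<^sub>M_def)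

lemma OM_fixed: "x \<in> \<O>\<^sub>M \<Longrightarrow> (\<sigma> ^^ n) x = x"
  by (rule \<sigma>.funpow_fixed) (simp add: \<O>\<^sub>M_def)

lemma OM_I: "x \<in> \<O>\<^sub>S \<Longrightarrow> \<sigma> x = x \<Longrightarrow> x \<in> \<O>\<^sub>M"
  by (simp add: \<O>\<^sub>M_def)

lemma norm_OM: "x \<in> \<O>\<^sub>S \<Longrightarrow> (\<Prod>j<p - 1. (\<sigma> ^^ j) x) \<in> \<O>\<^sub>M"
proof (rule OM_I)
  assume x: "x \<in> \<O>\<^sub>S"
  show "(\<Prod>j<p - 1. (\<sigma> ^^ j) x) \<in> \<O>\<^sub>S" by (rule R.prod_closed) (rule sigma_pow_OS[OF x])
  have "\<sigma> (\<Prod>j<p - 1. (\<sigma> ^^ j) x) = (\<Prod>j<p - 1. (\<sigma> ^^ Suc j) x)"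
    using OS_in_S[OF sigma_pow_OS[OF x]] by (simp add: \<sigma>.prod)
  also have "\<dots> = (\<Prod>j<p - 1. (\<sigma> ^^ j) x)"
    by (rule cyclic_prod) (use sigma_order[OF OS_in_S[OF x]] in simp)
  finally show "\<sigma> (\<Prod>j<p - 1. (\<sigma> ^^ j) x) = (\<Prod>j<p - 1. (\<sigma> ^^ j) x)" .
qed

lemma trace_OM: "x \<in> \<O>\<^sub>S \<Longrightarrow> (\<Sum>j<p - 1. (\<sigma> ^^ j) x) \<in> \<O>\<^sub>M"
proof (rule OM_I)
  assume x: "x \<in> \<O>\<^sub>S"
  show "(\<Sum>j<p - 1. (\<sigma> ^^ j) x) \<in> \<O>\<^sub>S" by (rule R.sum_closed) (rule sigma_pow_OS[OF x])
  have "\<sigma> (\<Sum>j<p - 1. (\<sigma> ^^ j) x) = (\<Sum>j<p - 1. (\<sigma> ^^ Suc j) x)"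
    using OS_in_S[OF sigma_pow_OS[OF x]] by (simp add: \<sigma>.sum)
  also have "\<dots> = (\<Sum>j<p - 1. (\<sigma> ^^ j) x)"
    by (rule cyclic_sum) (use sigma_order[OF OS_in_S[OF x]] in simp)
  finally show "\<sigma> (\<Sum>j<p - 1. (\<sigma> ^^ j) x) = (\<Sum>j<p - 1. (\<sigma> ^^ j) x)" .
qed

text \<open>The prime of the fixed ring below the point \<open>c\<close>.\<close>

definition Q :: "int \<Rightarrow> complex set" where
  "Q c = {x \<in> \<O>\<^sub>M. x * idem c \<doteq> 0}"

lemma Q_OM: "x \<in> Q c \<Longrightarrow> x \<in> \<O>\<^sub>M" and Q_vanish: "x \<in> Q c \<Longrightarrow> x * idem c \<doteq> 0"
  by (simp_all add: Q_def)

lemma Q_I: "x \<in> \<O>\<^sub>M \<Longrightarrow> x * idem c \<doteq> 0 \<Longrightarrow> x \<in> Q c"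
  by (simp add: Q_def)

lemma vanish_mult: "x * idem c \<doteq> 0 \<Longrightarrow> y \<in> \<O>\<^sub>S \<Longrightarrow> y * x * idem c \<doteq> 0"
  using res_scale[of "x * idem c" 0 y] by (simp add: mult.assoc)

lemma Q_diff: "x \<in> Q c \<Longrightarrow> y \<in> Q c \<Longrightarrow> x - y \<in> Q c"
  using res_diff[of "x * idem c" 0 "y * idem c" 0] OM.diff_closed[of x y]
  by (simp add: Q_def left_diff_distrib)

lemma Q_add: "x \<in> Q c \<Longrightarrow> y \<in> Q c \<Longrightarrow> x + y \<in> Q c"
  using res_add[of "x * idem c" 0 "y * idem c" 0] OM.add_closed[of x y]
  by (simp add: Q_def distrib_right)

lemma Q_zero: "0 \<in> Q c"
  by (simp add: Q_def OM.zero_closed)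

lemma Q_mult: "x \<in> Q c \<Longrightarrow> y \<in> \<O>\<^sub>M \<Longrightarrow> y * x \<in> Q c"
  using vanish_mult[of x c y] OM_OS[of y] OM.mult_closed[of y x] by (simp add: Q_def)

lemma Q_residue: "x \<in> \<O>\<^sub>M \<Longrightarrow> \<exists>n. x - of_int n \<in> Q c"
proof -
  assume x: "x \<in> \<O>\<^sub>M"
  obtain n where n: "x * idem c \<doteq> of_int n * idem c" using idem_integer[OF OM_OS[OF x]] by blast
  hence "x * idem c - of_int n * idem c \<doteq> of_int n * idem c - of_int n * idem c"
    by (rule res_diff[OF _ res_refl])
  hence "(x - of_int n) * idem c \<doteq> 0" by (simp add: left_diff_distrib)
  thus ?thesis using OM.diff_closed[OF x OM.of_int_closed] Q_I by blast
qed

lemma Q_int: "of_int n \<in> Q c \<longleftrightarrow> int p dvd n"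
  by (simp add: Q_def idem_integer_unique OM.of_int_closed)

lemma Q_prime: "x \<in> \<O>\<^sub>M \<Longrightarrow> y \<in> \<O>\<^sub>M \<Longrightarrow> x * y \<in> Q c \<Longrightarrow> x \<in> Q c \<or> y \<in> Q c"
proof -
  assume xy: "x \<in> \<O>\<^sub>M" "y \<in> \<O>\<^sub>M" "x * y \<in> Q c"
  obtain m where m: "x - of_int m \<in> Q c" using Q_residue[OF xy(1)] by blast
  obtain n where n: "y - of_int n \<in> Q c" using Q_residue[OF xy(2)] by blast
  have "of_int (m * n) = x * y - y * (x - of_int m) - of_int m * (y - of_int n)"
    by (simp add: algebra_simps)
  also have "\<dots> \<in> Q c"
    by (rule Q_diff[OF Q_diff[OF xy(3) Q_mult[OF m xy(2)]] Q_mult[OF n OM.of_int_closed]])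
  finally have "int p dvd m * n" by (simp only: Q_int)
  hence "int p dvd m \<or> int p dvd n" using p_prime by (simp add: prime_dvd_mult_iff)
  thus ?thesis
  proof
    assume "int p dvd m"
    hence "of_int m \<in> Q c" by (simp only: Q_int)
    from Q_add[OF m this] show ?thesis by simp
  next
    assume "int p dvd n"
    hence "of_int n \<in> Q c" by (simp only: Q_int)
    from Q_add[OF n this] show ?thesis by simp
  qed
qed

lemma idem_mult_cong: "[c = c'] (mod int p) \<Longrightarrow> x \<in> \<O>\<^sub>S \<Longrightarrow> x * idem c \<doteq> x * idem c'"
  by (rule res_scale[OF idem_cong])

lemma Q_cong: "[c = c'] (mod int p) \<Longrightarrow> Q c = Q c'"
proof -
  have "Q c \<subseteq> Q c'" if "[c = c'] (mod int p)" for c c'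
  proof
    fix x assume x: "x \<in> Q c"
    have "x * idem c' \<doteq> x * idem c" by (rule idem_mult_cong[OF cong_sym[OF that] OM_OS[OF Q_OM[OF x]]])
    also have "\<dots> \<doteq> 0" by (rule Q_vanish[OF x])
    finally show "x \<in> Q c'" by (rule Q_I[OF Q_OM[OF x]])
  qed
  thus "[c = c'] (mod int p) \<Longrightarrow> Q c = Q c'" using cong_sym by blast
qed

lemma Q_orbit_subset: "Q c \<subseteq> Q (int (k ^ n) * c)"
proof
  fix x assume x: "x \<in> Q c"
  have xO: "x \<in> \<O>\<^sub>S" by (rule OM_OS[OF Q_OM[OF x]])
  interpret s: subfield_endo S "\<sigma> ^^ n" by (rule \<sigma>.funpow)
  have "x * idem (int (k ^ n) * c) \<doteq> x * (\<sigma> ^^ n) (idem c)"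
    by (rule res_scale[OF res_sym[OF sigma_pow_idem] xO])
  also have "\<dots> = (\<sigma> ^^ n) (x * idem c)"
    using s.mult[OF OS_in_S[OF xO] idem_in_S] OM_fixed[OF Q_OM[OF x]] by simp
  also have "\<dots> \<doteq> (\<sigma> ^^ n) 0"
    by (rule sigma_pow_res[OF Q_vanish[OF x] R.mult_closed[OF xO idem_OS] R.zero_closed])
  finally show "x \<in> Q (int (k ^ n) * c)" by (intro Q_I Q_OM[OF x]) simp
qed

lemma k_fermat: "[k ^ (p - 1) = 1] (mod p)"
proof (rule fermat_theorem[OF p_prime])
  show "\<not> p dvd k"
    using coprime_common_divisor[OF coprime_k _ dvd_refl] p_prime not_prime_unit by blast
qed

text \<open>An invariant element that vanishes at \<open>c\<close> vanishes on the orbit of \<open>c\<close>.\<close>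

lemma Q_orbit: "Q (int (k ^ n) * c) = Q c"
proof
  show "Q c \<subseteq> Q (int (k ^ n) * c)" by (rule Q_orbit_subset)
  \<comment> \<open>a complementary exponent: \<open>n + m\<close> is a multiple of \<open>p - 1\<close>\<close>
  define m where "m = n * (p - 2)"
  have "p - 1 = Suc (p - 2)" using p_gt_2 by simp
  hence "n + m = (p - 1) * n" by (simp add: m_def mult.commute)
  hence "[k ^ (n + m) = 1] (mod p)" using cong_pow[OF k_fermat, of n] by (simp add: power_mult)
  hence "[int (k ^ (n + m)) = 1] (mod int p)" by (metis cong_int_iff of_nat_1)
  hence "[int (k ^ m) * (int (k ^ n) * c) = 1 * c] (mod int p)"
    using cong_scalar_right[of "int (k ^ (n + m))" 1 "int p" c] by (simp add: power_add mult_ac)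
  hence "Q (int (k ^ m) * (int (k ^ n) * c)) = Q c" using Q_cong by simp
  thus "Q (int (k ^ n) * c) \<subseteq> Q c" using Q_orbit_subset[of "int (k ^ n) * c" m] by simp
qed

text \<open>The norm of \<open>1 - idem c\<close> is invariant; it vanishes on the orbit of \<open>c\<close> and is 1 at all other points.\<close>

lemma Q_eq_imp_orbit:
  assumes "Q c = Q c'"
  shows "\<exists>j. [c' = int (k ^ j) * c] (mod int p)"
proof (rule ccontr)
  assume no: "\<not> ?thesis"
  define x where "x = 1 - idem c"
  have x: "x \<in> \<O>\<^sub>S" unfolding x_def by (rule R.diff_closed[OF R.one_closed idem_OS])
  define y where "y = (\<Prod>j<p - 1. (\<sigma> ^^ j) x)"
  have yM: "y \<in> \<O>\<^sub>M" unfolding y_def by (rule norm_OM[OF x])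
  have x0: "x * idem c \<doteq> 0"
  proof -
    have "idem c - idem c * idem c \<doteq> idem c - idem c"
      using res_diff[OF res_refl[of "idem c"] idem_idem[of c c]] by simp
    thus ?thesis by (simp add: x_def left_diff_distrib)
  qed
  have "y = (\<Prod>j\<in>{..<p - 1} - {0}. (\<sigma> ^^ j) x) * x"
  proof -
    have "y = (\<sigma> ^^ 0) x * (\<Prod>j\<in>{..<p - 1} - {0}. (\<sigma> ^^ j) x)"
      unfolding y_def using p_gt_2 by (intro prod.remove) auto
    thus ?thesis by simp
  qed
  moreover have "(\<Prod>j\<in>{..<p - 1} - {0}. (\<sigma> ^^ j) x) \<in> \<O>\<^sub>S"
    by (rule R.prod_closed) (rule sigma_pow_OS[OF x])
  ultimately have "y * idem c \<doteq> 0" using vanish_mult[OF x0] by simp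
  hence "y \<in> Q c'" using Q_I[OF yM] assms by blast
  hence y0: "y * idem c' \<doteq> 0" by (rule Q_vanish)
  have fac: "(\<sigma> ^^ j) x * idem c' \<doteq> idem c'" for j
  proof -
    interpret s: subfield_endo S "\<sigma> ^^ j" by (rule \<sigma>.funpow)
    have "(\<sigma> ^^ j) x = 1 - (\<sigma> ^^ j) (idem c)"
      unfolding x_def using s.diff[OF S.one_closed idem_in_S] by simp
    also have "\<dots> \<doteq> 1 - idem (int (k ^ j) * c)" by (rule res_diff[OF res_refl sigma_pow_idem])
    finally have "(\<sigma> ^^ j) x * idem c' \<doteq> (1 - idem (int (k ^ j) * c)) * idem c'"
      by (rule res_mult[OF _ res_refl idem_OS R.diff_closed[OF R.one_closed idem_OS]])
    also have "\<dots> = idem c' - idem (int (k ^ j) * c) * idem c'" by (simp add: left_diff_distrib)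
    also have "\<dots> \<doteq> idem c' - 0"
      by (rule res_diff[OF res_refl]) (use idem_idem[of "int (k ^ j) * c" c'] no in auto)
    finally show ?thesis by simp
  qed
  have "(\<Prod>j<n. (\<sigma> ^^ j) x) * idem c' \<doteq> idem c'" for n
  proof (induction n)
    case (Suc n)
    have "(\<Prod>j<Suc n. (\<sigma> ^^ j) x) * idem c' = (\<sigma> ^^ n) x * ((\<Prod>j<n. (\<sigma> ^^ j) x) * idem c')"
      by simp
    also have "\<dots> \<doteq> (\<sigma> ^^ n) x * idem c'" by (rule res_scale[OF Suc sigma_pow_OS[OF x]])
    also have "\<dots> \<doteq> idem c'" by (rule fac)
    finally show ?case .
  qed simp
  hence "idem c' \<doteq> y * idem c'" unfolding y_def by (rule res_sym)
  also have "\<dots> \<doteq> 0" by (rule y0)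
  finally show False using idem_nonzero by blast
qed

lemma OM_divide_p: "x \<in> \<O>\<^sub>M \<Longrightarrow> x = of_nat p * w \<Longrightarrow> w \<in> \<O>\<^sub>S \<Longrightarrow> w \<in> \<O>\<^sub>M"
proof -
  assume x: "x \<in> \<O>\<^sub>M" "x = of_nat p * w" "w \<in> \<O>\<^sub>S"
  have "of_nat p * \<sigma> w = \<sigma> (of_nat p * w)" by (simp add: \<sigma>.mult OS_in_S[OF x(3)])
  also have "\<dots> = of_nat p * w" using x by (simp add: \<O>\<^sub>M_def)
  finally have "\<sigma> w = w" using p_gt_2 by simp
  thus ?thesis using x(3) OM_I by blast
qed

lemma u_OS: "u \<in> \<O>\<^sub>S" and u'_OS: "u' \<in> \<O>\<^sub>S"
  using u(1) u'(1) Zzeta_subset_OS by blast+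

text \<open>The product of elements of \<open>Q c\<close>, one for each point \<open>c\<close>, vanishes at all points, hence is divisible
  by \<open>lam\<close>, and its \<open>(p - 1)\<close>-st power is divisible by \<open>p\<close> in the fixed ring. So it lies in \<open>P\<close>, and one of
  the factors does; thus \<open>P\<close> contains some \<open>Q c\<close>. Equality holds because the residues of both are
  integers.\<close>

lemma prime_over_p_is_Q:
  assumes sub: "P \<subseteq> \<O>\<^sub>M" and add: "\<And>x y. x \<in> P \<Longrightarrow> y \<in> P \<Longrightarrow> x + y \<in> P"
    and mult: "\<And>x y. x \<in> P \<Longrightarrow> y \<in> \<O>\<^sub>M \<Longrightarrow> y * x \<in> P"
    and prime: "\<And>x y. x \<in> \<O>\<^sub>M \<Longrightarrow> y \<in> \<O>\<^sub>M \<Longrightarrow> x * y \<in> P \<Longrightarrow> x \<in> P \<or> y \<in> P"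
    and int: "\<And>n. of_int n \<in> P \<longleftrightarrow> int p dvd n"
  shows "\<exists>c. P = Q c"
proof -
  have one: "1 \<notin> P" using int[of 1] p_gt_2 by simp
  have pP: "of_nat p \<in> P" using int[of "int p"] by simp
  have power: "x \<in> P" if "x \<in> \<O>\<^sub>M" "x ^ n \<in> P" for x n
    using that(2)
  proof (induction n)
    case 0
    thus ?case using one by simp
  next
    case (Suc n)
    thus ?case using prime[OF that(1) OM.power_closed[OF that(1)], of n] by auto
  qed
  have "\<exists>c. Q c \<subseteq> P"
  proof (rule ccontr)
    assume "\<nexists>c. Q c \<subseteq> P"
    hence "\<forall>c. \<exists>x. x \<in> Q c \<and> x \<notin> P" by blast
    then obtain f where f: "\<And>c. f c \<in> Q c" "\<And>c. f c \<notin> P" by metis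
    define x where "x = (\<Prod>c<p. f (int c))"
    have fM: "f c \<in> \<O>\<^sub>M" for c by (rule Q_OM[OF f(1)])
    have xM: "x \<in> \<O>\<^sub>M" unfolding x_def by (rule OM.prod_closed) (rule fM)
    have "(\<Prod>c<n. f (int c)) \<notin> P" for n
    proof (induction n)
      case (Suc n)
      have "(\<Prod>c<n. f (int c)) \<in> \<O>\<^sub>M" by (rule OM.prod_closed) (rule fM)
      thus ?case using prime[OF _ fM] Suc f(2) by auto
    qed (use one in simp)
    hence xP: "x \<notin> P" by (simp add: x_def)
    have "x * idem c \<doteq> 0" for c
    proof -
      define m where "m = nat (c mod int p)"
      have m: "int m = c mod int p" "m < p" using p_gt_2 by (simp_all add: m_def nat_less_iff)
      have "x = (\<Prod>c\<in>{..<p} - {m}. f (int c)) * f (int m)"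
        unfolding x_def using m(2) by (subst prod.remove[of _ m]) (auto simp: mult.commute)
      moreover have "(\<Prod>c\<in>{..<p} - {m}. f (int c)) \<in> \<O>\<^sub>M"
        by (rule OM.prod_closed) (rule fM)
      ultimately have "x \<in> Q (int m)" using Q_mult[OF f(1)] by simp
      moreover have "[int m = c] (mod int p)" using m(1) by (simp add: Cong.cong_def)
      ultimately show ?thesis using Q_cong Q_vanish by blast
    qed
    hence "x \<doteq> 0" using res_0_if_all_idem_0[OF OM_OS[OF xM]] by blast
    then obtain z where z: "z \<in> \<O>\<^sub>S" "x = lam * z" by (auto simp: res_eq_def)
    define w where "w = u * z ^ (p - 1)"
    have w: "w \<in> \<O>\<^sub>S" unfolding w_def by (rule R.mult_closed[OF u_OS R.power_closed[OF z(1)]])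
    have xw: "x ^ (p - 1) = of_nat p * w" unfolding z(2) power_mult_distrib w_def u(2) by (simp only: mult.assoc)
    have "w \<in> \<O>\<^sub>M" by (rule OM_divide_p[OF OM.power_closed[OF xM] xw w])
    hence "w * of_nat p \<in> P" by (rule mult[OF pP])
    hence "x ^ (p - 1) \<in> P" unfolding xw by (simp only: mult.commute)
    thus False using power[OF xM] xP by blast
  qed
  then obtain c where c: "Q c \<subseteq> P" by blast
  have "P \<subseteq> Q c"
  proof
    fix x assume x: "x \<in> P"
    hence xM: "x \<in> \<O>\<^sub>M" using sub by blast
    obtain n where n: "x - of_int n \<in> Q c" using Q_residue[OF xM] by blast
    hence "x - of_int n \<in> P" using c by blast
    hence "- 1 * (x - of_int n) \<in> P" by (rule mult) (rule OM.uminus_closed[OF OM.one_closed])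
    from add[OF x this] have "of_int n \<in> P" by simp
    hence "of_int n \<in> Q c" by (simp only: int Q_int)
    from Q_add[OF n this] show "x \<in> Q c" by simp
  qed
  thus ?thesis using c by blast
qed

end

section \<open>Ramification\<close>

context kummer_galois
begin

text \<open>The elements of order at least \<open>m\<close> in \<open>lam\<close> at the point \<open>c\<close>. The \<open>m\<close>-th power of the idempotent makes
  the definition compatible with products.\<close>

definition Fil :: "int \<Rightarrow> nat \<Rightarrow> complex set" where
  "Fil c m = {x \<in> \<O>\<^sub>S. \<exists>z\<in>\<O>\<^sub>S. x * idem c ^ m = lam ^ m * z}"

lemma Fil_add: "x \<in> Fil c m \<Longrightarrow> y \<in> Fil c m \<Longrightarrow> x + y \<in> Fil c m"
proof -
  assume "x \<in> Fil c m" "y \<in> Fil c m"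
  then obtain z z' where z: "x \<in> \<O>\<^sub>S" "z \<in> \<O>\<^sub>S" "x * idem c ^ m = lam ^ m * z"
      "y \<in> \<O>\<^sub>S" "z' \<in> \<O>\<^sub>S" "y * idem c ^ m = lam ^ m * z'"
    by (auto simp: Fil_def)
  have "(x + y) * idem c ^ m = lam ^ m * (z + z')" using z by (simp add: algebra_simps)
  thus ?thesis using R.add_closed[OF z(1,4)] R.add_closed[OF z(2,5)] by (auto simp: Fil_def)
qed

lemma Fil_mult: "x \<in> Fil c m \<Longrightarrow> y \<in> Fil c n \<Longrightarrow> x * y \<in> Fil c (m + n)"
proof -
  assume "x \<in> Fil c m" "y \<in> Fil c n"
  then obtain z z' where z: "x \<in> \<O>\<^sub>S" "z \<in> \<O>\<^sub>S" "x * idem c ^ m = lam ^ m * z"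
      "y \<in> \<O>\<^sub>S" "z' \<in> \<O>\<^sub>S" "y * idem c ^ n = lam ^ n * z'"
    by (auto simp: Fil_def)
  have "x * y * idem c ^ (m + n) = (x * idem c ^ m) * (y * idem c ^ n)"
    by (simp add: power_add mult_ac)
  also have "\<dots> = lam ^ (m + n) * (z * z')" unfolding z by (simp add: power_add mult_ac)
  finally show ?thesis using R.mult_closed[OF z(1,4)] R.mult_closed[OF z(2,5)] by (auto simp: Fil_def)
qed

lemma Fil_0: "x \<in> \<O>\<^sub>S \<Longrightarrow> x \<in> Fil c 0"
  by (simp add: Fil_def)

lemma idem_power_res: "m > 0 \<Longrightarrow> idem c ^ m \<doteq> idem c"
proof (induction m rule: nat_induct_non_zero)
  case (Suc m)
  have "idem c ^ Suc m = idem c * idem c ^ m" by simp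
  also have "\<dots> \<doteq> idem c * idem c" by (rule res_scale[OF Suc.IH idem_OS])
  also have "\<dots> \<doteq> idem c" using idem_idem[of c c] by simp
  finally show ?case .
qed simp

lemma p_notin_Fil: "p \<le> m \<Longrightarrow> of_nat p \<notin> Fil c m"
proof
  assume m: "p \<le> m" and "of_nat p \<in> Fil c m"
  then obtain z where z: "z \<in> \<O>\<^sub>S" "of_nat p * idem c ^ m = lam ^ m * z" by (auto simp: Fil_def)
  \<comment> \<open>after cancelling \<open>lam\<^sup>p\<^sup>-\<^sup>1\<close> at least one factor \<open>lam\<close> is left\<close>
  have e: "m = (p - 1) + Suc (m - p)" using m p_gt_2 by simp
  have "lam ^ (p - 1) * idem c ^ m = u * (of_nat p * idem c ^ m)" by (subst u(2)) simp
  also have "\<dots> = u * (lam ^ m * z)" by (simp only: z(2))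
  also have "\<dots> = lam ^ (p - 1) * (lam * (lam ^ (m - p) * u * z))"
    by (subst e) (simp add: power_add mult_ac)
  finally have "idem c ^ m - 0 = lam * (lam ^ (m - p) * u * z)" using lam_nonzero by simp
  hence "idem c ^ m \<doteq> 0"
    by (rule res_eqI) (rule R.mult_closed[OF R.mult_closed[OF R.power_closed[OF lam_R] u_OS] z(1)])
  moreover have "idem c ^ m \<doteq> idem c" by (rule idem_power_res) (use m p_gt_2 in simp)
  ultimately show False using idem_nonzero res_trans res_sym by blast
qed

lemma v_pow_eq_1_iff: "[int (v ^ n) = 1] (mod int p) \<longleftrightarrow> (p - 1) dvd n"
proof -
  have "[int (v ^ n) = 1] (mod int p) \<longleftrightarrow> [v ^ n = 1] (mod p)" by (metis cong_int_iff of_nat_1)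
  also have "\<dots> \<longleftrightarrow> ord p v dvd n" by (rule ord_divides)
  also have "ord p v = p - 1" using v_primroot totient_prime[OF p_prime] by (simp add: residue_primroot_def)
  finally show ?thesis .
qed

text \<open>Write \<open>x = lam\<^sup>m y\<close> near \<open>c\<close>, and let \<open>r\<close> be the residue of \<open>y\<close> at \<open>c\<close>. The automorphism \<open>\<sigma>\<^sup>n\<close> fixes
  \<open>x\<close> and \<open>c\<close> and multiplies \<open>lam\<close> by \<open>v\<^sup>n\<close> modulo \<open>lam\<^sup>2\<close>; comparing residues yields \<open>v\<^sup>n\<^sup>m r \<equiv> r\<close>. Unless \<open>n m\<close> is a
  multiple of \<open>p - 1\<close> this gives \<open>r \<equiv> 0\<close>, so the order at \<open>c\<close> exceeds \<open>m\<close>.\<close>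

lemma Q_subset_Fil:
  assumes n: "n dvd p - 1" "[int (k ^ n) * c = c] (mod int p)" and x: "x \<in> Q c"
  shows "x \<in> Fil c ((p - 1) div n)"
proof -
  have n0: "n > 0" using n(1) p_gt_2 by (intro Nat.gr0I) auto
  have xM: "x \<in> \<O>\<^sub>M" by (rule Q_OM[OF x])
  have xO: "x \<in> \<O>\<^sub>S" by (rule OM_OS[OF xM])
  let ?e = "idem c"
  interpret g: subfield_endo S "\<sigma> ^^ n" by (rule \<sigma>.funpow)
  define ge where "ge = (\<sigma> ^^ n) ?e"
  have geO: "ge \<in> \<O>\<^sub>S" unfolding ge_def by (rule sigma_pow_OS[OF idem_OS])
  have "ge \<doteq> idem (int (k ^ n) * c)" unfolding ge_def by (rule sigma_pow_idem)
  also have "\<dots> \<doteq> ?e" by (rule idem_cong[OF n(2)])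
  finally have ge: "ge \<doteq> ?e" .
  have "x \<in> Fil c m" if "1 \<le> m" "m \<le> (p - 1) div n" for m
    using that
  proof (induction m rule: nat_induct_at_least)
    case base
    obtain z where "z \<in> \<O>\<^sub>S" "x * ?e = lam * z" using Q_vanish[OF x] by (auto simp: res_eq_def)
    thus ?case using xO by (auto simp: Fil_def)
  next
    case (Suc m)
    then obtain y where y: "y \<in> \<O>\<^sub>S" "x * ?e ^ m = lam ^ m * y" by (auto simp: Fil_def)
    define gy where "gy = (\<sigma> ^^ n) y"
    define w where "w = lamq n"
    have wO: "w \<in> \<O>\<^sub>S" unfolding w_def by (rule lamq_OS)
    have gyO: "gy \<in> \<O>\<^sub>S" unfolding gy_def by (rule sigma_pow_OS[OF y(1)])
    have "x * ge ^ m = (\<sigma> ^^ n) (x * ?e ^ m)"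
      using OM_fixed[OF xM, of n] unfolding ge_def
      by (simp add: g.mult g.power OS_in_S[OF xO] idem_in_S S.power_closed)
    also have "\<dots> = (lam * w) ^ m * gy"
      unfolding y(2) gy_def w_def sigma_pow_lam[symmetric]
      by (simp add: g.mult g.power OS_in_S[OF y(1)] lam_in_S S.power_closed)
    finally have xge: "x * ge ^ m = lam ^ m * (w ^ m * gy)" by (simp add: power_mult_distrib)
    have "lam ^ m * (ge ^ m * y) = ge ^ m * (x * ?e ^ m)" unfolding y(2) by simp
    also have "\<dots> = lam ^ m * (?e ^ m * (w ^ m * gy))" using xge by (simp add: mult_ac)
    finally have eq: "ge ^ m * y = ?e ^ m * (w ^ m * gy)" using lam_nonzero by simp
    obtain r where r: "y * ?e \<doteq> of_int r * ?e" using idem_integer[OF y(1)] by blast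
    have em: "?e ^ m \<doteq> ?e" using Suc.hyps by (intro idem_power_res) simp
    have gem: "ge ^ m \<doteq> ?e"
      using res_trans[OF res_power[OF ge geO idem_OS] em] .
    have gye: "gy * ?e \<doteq> of_int r * ?e"
    proof -
      have "gy * ?e \<doteq> gy * ge" by (rule res_scale[OF res_sym[OF ge] gyO])
      also have "\<dots> = (\<sigma> ^^ n) (y * ?e)"
        unfolding gy_def ge_def by (simp add: g.mult OS_in_S[OF y(1)] idem_in_S)
      also have "\<dots> \<doteq> (\<sigma> ^^ n) (of_int r * ?e)"
        by (rule sigma_pow_res[OF r R.mult_closed[OF y(1) idem_OS] R.mult_closed[OF R.of_int_closed idem_OS]])
      also have "\<dots> = of_int r * ge" unfolding ge_def by (simp add: g.mult idem_in_S)
      also have "\<dots> \<doteq> of_int r * ?e" by (rule res_scale[OF ge R.of_int_closed])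
      finally show ?thesis .
    qed
    have "of_int r * ?e \<doteq> y * ?e" by (rule res_sym[OF r])
    also have "\<dots> \<doteq> y * ge ^ m" by (rule res_scale[OF res_sym[OF gem] y(1)])
    also have "\<dots> = w ^ m * gy * ?e ^ m" using eq by (simp add: mult_ac)
    also have "\<dots> \<doteq> w ^ m * gy * ?e"
      by (rule res_scale[OF em R.mult_closed[OF R.power_closed[OF wO] gyO]])
    also have "\<dots> = w ^ m * (gy * ?e)" by simp
    also have "\<dots> \<doteq> of_int (int (v ^ n)) ^ m * (of_int r * ?e)"
      by (rule res_mult[OF res_power[OF _ wO R.of_int_closed] gye R.mult_closed[OF gyO idem_OS]
            R.power_closed[OF R.of_int_closed]])
         (simp only: w_def lamq_res)
    finally have "of_int r * ?e - of_int (int (v ^ n)) ^ m * (of_int r * ?e) \<doteq>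
        of_int (int (v ^ n)) ^ m * (of_int r * ?e) - of_int (int (v ^ n)) ^ m * (of_int r * ?e)"
      by (rule res_diff[OF _ res_refl])
    moreover have "of_int ((1 - int (v ^ (n * m))) * r) * ?e =
        of_int r * ?e - of_int (int (v ^ n)) ^ m * (of_int r * ?e)"
      by (simp only: power_mult) (simp add: algebra_simps)
    ultimately have "of_int ((1 - int (v ^ (n * m))) * r) * ?e \<doteq> 0" by simp
    hence "int p dvd (1 - int (v ^ (n * m))) * r" by (simp only: idem_integer_unique)
    moreover have "\<not> int p dvd 1 - int (v ^ (n * m))"
    proof
      assume "int p dvd 1 - int (v ^ (n * m))"
      hence "[int (v ^ (n * m)) = 1] (mod int p)" by (simp add: cong_iff_dvd_diff dvd_diff_commute)
      hence "p - 1 dvd n * m" by (simp only: v_pow_eq_1_iff)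
      moreover have "0 < n * m" using n0 Suc.hyps by simp
      moreover have "n * m < p - 1"
      proof -
        have "n * Suc m \<le> n * ((p - 1) div n)" using Suc.prems by (intro mult_le_mono2)
        also have "\<dots> = p - 1" using n(1) by simp
        finally show ?thesis using n0 by simp
      qed
      ultimately show False by (auto dest: dvd_imp_le)
    qed
    ultimately have "int p dvd r" using p_prime by (simp add: prime_dvd_mult_iff)
    hence "of_int r * ?e \<doteq> 0" by (simp only: idem_integer_unique)
    hence "y * ?e \<doteq> 0" using res_trans[OF r] by blast
    then obtain z where z: "z \<in> \<O>\<^sub>S" "y * ?e = lam * z" by (auto simp: res_eq_def)
    have "x * ?e ^ Suc m = (x * ?e ^ m) * ?e" by simp
    also have "\<dots> = lam ^ m * (y * ?e)" unfolding y(2) by (simp only: mult.assoc)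
    also have "\<dots> = lam ^ Suc m * z" unfolding z(2) by simp
    finally show ?case using z(1) xO by (auto simp: Fil_def)
  qed
  moreover have "1 \<le> (p - 1) div n"
  proof -
    have "n * ((p - 1) div n) = p - 1" using n(1) by simp
    hence "(p - 1) div n \<noteq> 0" using p_gt_2 by (intro notI) simp
    thus ?thesis by simp
  qed
  ultimately show ?thesis by blast
qed

lemma card_multiples: "n dvd N \<Longrightarrow> n > 0 \<Longrightarrow> card {j. j < N \<and> n dvd j} = N div n"
proof -
  assume n: "n dvd N" "n > 0"
  then obtain q where q: "N = n * q" by (elim dvdE)
  have "{j. j < N \<and> n dvd j} = (\<lambda>i. n * i) ` {..<q}"
    using n(2) by (auto simp: q)
  moreover have "inj_on (\<lambda>i. n * i) {..<q}" using n(2) by (auto simp: inj_on_def)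
  ultimately show ?thesis using n(2) by (simp add: card_image q)
qed

text \<open>With \<open>m = (p - 1) / n\<close>, the trace of \<open>lam\<^sup>m idem c\<close> is \<open>lam\<^sup>m y\<close>, where only the \<open>m\<close> automorphisms
  \<open>\<sigma>\<^sup>j\<close> with \<open>n\<close> dividing \<open>j\<close> contribute to the residue of \<open>y\<close> at \<open>c\<close>. Each contributes
  \<open>v\<^sup>j\<^sup>m \<equiv> 1\<close>, so this residue is \<open>m\<close>, which is prime to \<open>p\<close>.\<close>

lemma uniformizer_exists:
  assumes n: "n dvd p - 1" "\<And>j. [int (k ^ j) * c = c] (mod int p) \<longleftrightarrow> n dvd j"
  shows "\<exists>x\<in>Q c. \<exists>s\<in>\<O>\<^sub>M. s \<notin> Q c \<and> x ^ n = of_nat p * s"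
proof -
  have n0: "n > 0" using n(1) p_gt_2 by (intro Nat.gr0I) auto
  define m where "m = (p - 1) div n"
  have nm: "n * m = p - 1" using n(1) by (simp add: m_def)
  have m0: "m > 0" using nm p_gt_2 by (intro Nat.gr0I) auto
  let ?e = "idem c"
  have leO: "lam ^ m * ?e \<in> \<O>\<^sub>S" by (rule R.mult_closed[OF R.power_closed[OF lam_R] idem_OS])
  define x where "x = (\<Sum>j<p - 1. (\<sigma> ^^ j) (lam ^ m * ?e))"
  define y where "y = (\<Sum>j<p - 1. lamq j ^ m * (\<sigma> ^^ j) ?e)"
  have xM: "x \<in> \<O>\<^sub>M" unfolding x_def by (rule trace_OM[OF leO])
  have termO: "lamq j ^ m * (\<sigma> ^^ j) ?e \<in> \<O>\<^sub>S" for j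
    by (rule R.mult_closed[OF R.power_closed[OF lamq_OS] sigma_pow_OS[OF idem_OS]])
  have yO: "y \<in> \<O>\<^sub>S" unfolding y_def by (rule R.sum_closed) (rule termO)
  have xy: "x = lam ^ m * y"
  proof -
    have "(\<sigma> ^^ j) (lam ^ m * ?e) = lam ^ m * (lamq j ^ m * (\<sigma> ^^ j) ?e)" for j
    proof -
      interpret s: subfield_endo S "\<sigma> ^^ j" by (rule \<sigma>.funpow)
      have "(\<sigma> ^^ j) (lam ^ m * ?e) = ((\<sigma> ^^ j) lam) ^ m * (\<sigma> ^^ j) ?e"
        by (simp add: s.mult s.power idem_in_S lam_in_S S.power_closed)
      thus ?thesis by (simp add: sigma_pow_lam power_mult_distrib)
    qed
    thus ?thesis unfolding x_def y_def by (simp add: sum_distrib_left)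
  qed
  have xQ: "x \<in> Q c"
  proof (rule Q_I[OF xM])
    have "lam ^ m = lam * lam ^ (m - 1)" using m0 by (simp flip: power_Suc)
    hence "x * ?e - 0 = lam * (lam ^ (m - 1) * y * ?e)" by (simp add: xy)
    thus "x * ?e \<doteq> 0"
      by (rule res_eqI) (rule R.mult_closed[OF R.mult_closed[OF R.power_closed[OF lam_R] yO] idem_OS])
  qed
  have ye: "y * ?e \<doteq> of_int (int m) * ?e"
  proof -
    have "y * ?e = (\<Sum>j<p - 1. lamq j ^ m * ((\<sigma> ^^ j) ?e * ?e))"
      by (simp add: y_def sum_distrib_right mult.assoc)
    also have "\<dots> \<doteq> (\<Sum>j<p - 1. if n dvd j then ?e else 0)"
    proof (rule res_sum)
      fix j
      have "(\<sigma> ^^ j) ?e * ?e \<doteq> idem (int (k ^ j) * c) * ?e"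
        by (rule res_mult[OF sigma_pow_idem res_refl idem_OS idem_OS])
      also have "\<dots> \<doteq> (if [c = int (k ^ j) * c] (mod int p) then ?e else 0)" by (rule idem_idem)
      also have "[c = int (k ^ j) * c] (mod int p) \<longleftrightarrow> n dvd j" using n(2)[of j] by (simp only: cong_sym_eq)
      finally have 1: "(\<sigma> ^^ j) ?e * ?e \<doteq> (if n dvd j then ?e else 0)" .
      have "lamq j ^ m \<doteq> of_int (int (v ^ j)) ^ m"
        by (rule res_power[OF lamq_res lamq_OS R.of_int_closed])
      hence 2: "lamq j ^ m \<doteq> of_int (int (v ^ (j * m)))" by (simp add: power_mult)
      have "lamq j ^ m * ((\<sigma> ^^ j) ?e * ?e) \<doteq> of_int (int (v ^ (j * m))) * (if n dvd j then ?e else 0)"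
        by (rule res_mult[OF 2 1 R.mult_closed[OF sigma_pow_OS[OF idem_OS] idem_OS] R.of_int_closed])
      also have "\<dots> \<doteq> (if n dvd j then ?e else 0)"
      proof (cases "n dvd j")
        case True
        hence "p - 1 dvd j * m" unfolding nm[symmetric] by (rule mult_dvd_mono) simp
        hence "of_int (int (v ^ (j * m))) \<doteq> of_int 1" unfolding res_int by (simp only: v_pow_eq_1_iff)
        from res_mult[OF this res_refl[of ?e] idem_OS R.of_int_closed] show ?thesis using True by simp
      qed simp
      finally show "lamq j ^ m * ((\<sigma> ^^ j) ?e * ?e) \<doteq> (if n dvd j then ?e else 0)" .
    qed
    also have "(\<Sum>j<p - 1. if n dvd j then ?e else 0) = (\<Sum>j\<in>{j. j < p - 1 \<and> n dvd j}. ?e)"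
      by (rule sum.mono_neutral_cong_right) auto
    also have "\<dots> = of_int (int m) * ?e" using card_multiples[OF n(1) n0] by (simp add: m_def)
    finally show ?thesis .
  qed
  define s where "s = u * y ^ n"
  have sO: "s \<in> \<O>\<^sub>S" unfolding s_def by (rule R.mult_closed[OF u_OS R.power_closed[OF yO]])
  have xs: "x ^ n = of_nat p * s"
  proof -
    have "x ^ n = (lam ^ (m * n)) * y ^ n" by (simp add: xy power_mult_distrib power_mult)
    also have "m * n = p - 1" using nm by (simp only: mult.commute)
    also have "lam ^ (p - 1) * y ^ n = of_nat p * s" unfolding s_def u(2) by (simp only: mult.assoc)
    finally show ?thesis .
  qed
  have sM: "s \<in> \<O>\<^sub>M" by (rule OM_divide_p[OF OM.power_closed[OF xM] xs sO])
  have ynm: "y ^ i * ?e \<doteq> of_int (int m ^ i) * ?e" for i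
  proof (induction i)
    case (Suc i)
    have "y ^ Suc i * ?e = y * (y ^ i * ?e)" by simp
    also have "\<dots> \<doteq> y * (of_int (int m ^ i) * ?e)" by (rule res_scale[OF Suc yO])
    also have "\<dots> = of_int (int m ^ i) * (y * ?e)" by simp
    also have "\<dots> \<doteq> of_int (int m ^ i) * (of_int (int m) * ?e)" by (rule res_scale[OF ye R.of_int_closed])
    finally show ?case by (simp add: mult_ac)
  qed simp
  have "s \<notin> Q c"
  proof
    assume "s \<in> Q c"
    hence "s * ?e \<doteq> 0" by (rule Q_vanish)
    hence "u' * (s * ?e) \<doteq> u' * 0" by (rule res_scale[OF _ u'_OS])
    moreover have "u' * u = 1"
    proof -
      have "lam ^ (p - 1) * (u' * u) = of_nat p * u" by (subst u'(2)) simp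
      also have "\<dots> = lam ^ (p - 1) * 1" by (simp only: u(2) mult.right_neutral)
      finally show ?thesis using lam_nonzero by simp
    qed
    hence "u' * (s * ?e) = y ^ n * ?e" unfolding s_def by (metis mult.assoc mult.left_neutral)
    ultimately have "y ^ n * ?e \<doteq> 0" by simp
    hence "of_int (int m ^ n) * ?e \<doteq> 0" using res_trans[OF res_sym[OF ynm]] by blast
    hence "int p dvd int m ^ n" by (simp only: idem_integer_unique)
    hence "p dvd m ^ n" by (metis int_dvd_int_iff of_nat_power)
    hence "p dvd m" using p_prime prime_dvd_power by blast
    moreover have "m < p"
    proof -
      have "1 * m \<le> n * m" by (rule mult_le_mono1) (use n0 in simp)
      thus ?thesis using nm p_gt_2 by linarith
    qed
    ultimately show False using m0 by (auto dest: dvd_imp_le)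
  qed
  thus ?thesis using xQ sM xs by blast
qed

text \<open>From \<open>x\<^sup>n = p s\<close> with \<open>s\<close> outside \<open>Q c\<close>: choose \<open>b\<close> with \<open>b s = 1 - q\<close> and \<open>q\<close> in \<open>Q c\<close>, and multiply by
  \<open>1 + q + \<dots> + q\<^sup>n\<^sup>-\<^sup>1\<close>. Both summands visibly lie in the \<open>n\<close>-th power of \<open>Q c\<close>.\<close>

lemma p_in_powers:
  assumes n: "n dvd p - 1" "\<And>j. [int (k ^ j) * c = c] (mod int p) \<longleftrightarrow> n dvd j"
  shows "\<exists>x\<in>Q c. \<exists>q\<in>Q c. \<exists>a\<in>\<O>\<^sub>M. of_nat p = a * x ^ n + of_nat p * q ^ n"
proof -
  obtain x s where xs: "x \<in> Q c" "s \<in> \<O>\<^sub>M" "s \<notin> Q c" "x ^ n = of_nat p * s"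
    using uniformizer_exists[OF n] by blast
  obtain r where r: "s - of_int r \<in> Q c" using Q_residue[OF xs(2)] by blast
  have "\<not> int p dvd r"
  proof
    assume "int p dvd r"
    hence "of_int r \<in> Q c" by (simp only: Q_int)
    from Q_add[OF r this] show False using xs(3) by simp
  qed
  hence "coprime r (int p)" using coprime_int_prime[OF p_prime] by blast
  then obtain b where "[r * b = 1] (mod int p)" using cong_solve_coprime_int by blast
  hence "int p dvd 1 - r * b" by (simp add: cong_iff_dvd_diff dvd_diff_commute)
  hence "of_int (1 - r * b) \<in> Q c" by (simp only: Q_int)
  from Q_diff[OF this Q_mult[OF r OM.of_int_closed[of b]]]
  have qQ: "1 - of_int b * s \<in> Q c" by (simp add: algebra_simps)
  define q where "q = 1 - of_int b * s"
  have qM: "q \<in> \<O>\<^sub>M" unfolding q_def by (rule Q_OM[OF qQ])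
  define a where "a = of_int b * (\<Sum>i<n. q ^ i)"
  have "a * x ^ n = of_nat p * ((1 - q) * (\<Sum>i<n. q ^ i))"
    unfolding a_def q_def xs(4) by (simp add: mult_ac)
  also have "(1 - q) * (\<Sum>i<n. q ^ i) = 1 - q ^ n" by (simp only: one_diff_power_eq)
  finally have "of_nat p = a * x ^ n + of_nat p * q ^ n" by (simp add: algebra_simps)
  moreover have "a \<in> \<O>\<^sub>M"
    unfolding a_def by (rule OM.mult_closed[OF OM.of_int_closed OM.sum_closed]) (rule OM.power_closed[OF qM])
  ultimately show ?thesis using xs(1) qQ unfolding q_def by blast
qed

end

section \<open>The fixed field of \<open>\<sigma>\<close>\<close>

context kummer_galois
begin

definition Fix :: "complex set" where "Fix = {x \<in> S. \<sigma> x = x}"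

sublocale Fix: subfield_of_complex Fix
proof
  show "1 \<in> Fix" by (simp add: Fix_def S.one_closed)
  fix x assume "x \<in> Fix"
  hence x: "x \<in> S" "\<sigma> x = x" by (simp_all add: Fix_def)
  show "inverse x \<in> Fix"
    using S.inverse_closed[OF x(1)] \<sigma>.inverse[OF x(1)] x(2) by (simp add: Fix_def)
  fix y assume "y \<in> Fix"
  hence y: "y \<in> S" "\<sigma> y = y" by (simp_all add: Fix_def)
  show "x - y \<in> Fix" "x * y \<in> Fix"
    using x y S.diff_closed[OF x(1) y(1)] S.mult_closed[OF x(1) y(1)]
    by (simp_all add: Fix_def \<sigma>.diff \<sigma>.mult)
qed

definition \<Omega> :: complex where "\<Omega> = (\<Sum>i<p - 1. (\<sigma> ^^ i) \<omega>)"

lemma sigma_pow_omega_S: "(\<sigma> ^^ i) \<omega> \<in> S"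
  by (rule \<sigma>.funpow_closed[OF omega_in_S])

lemma Omega_in_S: "\<Omega> \<in> S"
  unfolding \<Omega>_def by (rule S.sum_closed) (rule sigma_pow_omega_S)

lemma sigma_Omega: "\<sigma> \<Omega> = \<Omega>"
proof -
  have "\<sigma> \<Omega> = (\<Sum>i<p - 1. (\<sigma> ^^ Suc i) \<omega>)"
    unfolding \<Omega>_def using sigma_pow_omega_S by (simp add: \<sigma>.sum)
  also have "\<dots> = \<Omega>"
    unfolding \<Omega>_def by (rule cyclic_sum) (use sigma_order[OF omega_in_S] in simp)
  finally show ?thesis .
qed

lemma theta_sigma_eigen:
  assumes "y \<in> S" "\<theta> y = \<zeta> ^ e * y"
  shows "\<theta> (\<sigma> y) = \<zeta> ^ (v * e * \<kappa>) * \<sigma> y"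
proof -
  have sy: "\<sigma> y \<in> S" by (rule \<sigma>.closed[OF assms(1)])
  have "(\<theta> ^^ k) (\<sigma> y) = \<sigma> (\<theta> y)" by (rule sigma_theta[OF assms(1), symmetric])
  also have "\<dots> = \<zeta> ^ (v * e) * \<sigma> y"
    unfolding assms(2)
    by (simp add: \<sigma>.mult \<sigma>.power S.power_closed zeta_in_S assms(1) sigma_zeta power_mult)
  finally have k: "(\<theta> ^^ k) (\<sigma> y) = \<zeta> ^ (v * e) * \<sigma> y" .
  have kz: "(\<theta> ^^ k) \<zeta> = \<zeta>" by (rule \<theta>.funpow_fixed[OF theta_K[OF zeta_in_K]])
  have "\<theta> (\<sigma> y) = (\<theta> ^^ (k * \<kappa>)) (\<sigma> y)"
    using theta_pow_cong[OF sy, of 1 "k * \<kappa>"] k_kap by (simp add: cong_sym_eq)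
  also have "\<dots> = ((\<theta> ^^ k) ^^ \<kappa>) (\<sigma> y)" by (simp add: funpow_mult)
  also have "\<dots> = \<zeta> ^ (v * e * \<kappa>) * \<sigma> y"
    by (rule eigen_funpow[OF \<theta>.funpow kz sy k])
  finally show ?thesis .
qed

lemma theta_sigma_pow_omega: "\<theta> ((\<sigma> ^^ i) \<omega>) = \<zeta> ^ ((v * \<kappa>) ^ i) * (\<sigma> ^^ i) \<omega>"
proof (induction i)
  case 0
  show ?case by (simp add: theta_omega)
next
  case (Suc i)
  show ?case using theta_sigma_eigen[OF sigma_pow_omega_S Suc] by (simp add: mult_ac)
qed

lemma omega_res: "(\<sigma> ^^ i) \<omega> \<doteq> 1"
proof -
  have "\<omega> - 1 = lam * \<eta>" using omega_eta by (metis add_diff_cancel_left')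
  hence w: "\<omega> \<doteq> 1" by (rule res_eqI[OF _ eta_OS])
  have "\<omega> \<in> \<O>\<^sub>S" using omega_in_S omega_algebraic_int by (simp add: integers_of_def)
  from sigma_pow_res[OF w this R.one_closed] show ?thesis
    using subfield_endo.one[OF \<sigma>.funpow] by simp
qed

text \<open>The number \<open>\<sigma>\<^sup>i \<omega>\<close> is an eigenvector of \<open>\<theta>\<close> for \<open>\<zeta>\<close> raised to \<open>(v \<kappa>)\<^sup>i\<close>. If \<open>\<Omega>\<close> were invariant, its
  component for the eigenvalue \<open>\<zeta>\<close> would vanish. This component is the sum of those \<open>\<sigma>\<^sup>i \<omega>\<close>, all
  congruent to 1, for which \<open>(v \<kappa>)\<^sup>i\<close> is congruent to 1; their number lies between 1 and \<open>p - 1\<close>.\<close>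

lemma theta_Omega: "\<theta> \<Omega> \<noteq> \<Omega>"
proof
  assume fixed: "\<theta> \<Omega> = \<Omega>"
  define e where "e = (\<lambda>i. (v * \<kappa>) ^ i)"
  define I where "I = {i. i < p - 1 \<and> p dvd p - 1 + e i}"
  have pow: "(\<theta> ^^ j) \<Omega> = (\<Sum>i<p - 1. \<zeta> ^ (e i * j) * (\<sigma> ^^ i) \<omega>)" for j
  proof -
    interpret t: subfield_endo S "\<theta> ^^ j" by (rule \<theta>.funpow)
    show ?thesis
      unfolding \<Omega>_def e_def using theta_eigen[OF sigma_pow_omega_S theta_sigma_pow_omega]
      by (simp add: t.sum sigma_pow_omega_S)
  qed
  have "\<not> p dvd p - 1" using p_gt_2 by (auto dest: dvd_imp_le)
  \<comment> \<open>\<open>\<zeta>\<^sup>p\<^sup>-\<^sup>1\<close> is the inverse of \<open>\<zeta>\<close>: this projects onto the eigenvalue \<open>\<zeta>\<close>\<close>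
  hence "0 = (\<Sum>j<p. \<zeta> ^ ((p - 1) * j)) * \<Omega>" by (simp only: sum_zeta_pow_multiple if_False mult_zero_left)
  also have "\<dots> = (\<Sum>j<p. \<zeta> ^ ((p - 1) * j) * (\<theta> ^^ j) \<Omega>)"
    using \<theta>.funpow_fixed[OF fixed] by (simp add: sum_distrib_right)
  also have "\<dots> = (\<Sum>j<p. \<Sum>i<p - 1. \<zeta> ^ ((p - 1 + e i) * j) * (\<sigma> ^^ i) \<omega>)"
    unfolding pow sum_distrib_left by (simp only: distrib_right power_add mult.assoc)
  also have "\<dots> = (\<Sum>i<p - 1. (\<Sum>j<p. \<zeta> ^ ((p - 1 + e i) * j)) * (\<sigma> ^^ i) \<omega>)"
    by (subst sum.swap) (simp only: sum_distrib_right)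
  also have "\<dots> = (\<Sum>i<p - 1. if p dvd p - 1 + e i then of_nat p * (\<sigma> ^^ i) \<omega> else 0)"
    unfolding sum_zeta_pow_multiple by (rule sum.cong) auto
  also have "\<dots> = (\<Sum>i\<in>I. of_nat p * (\<sigma> ^^ i) \<omega>)"
    unfolding I_def by (rule sum.mono_neutral_cong_right) auto
  also have "\<dots> = of_nat p * (\<Sum>i\<in>I. (\<sigma> ^^ i) \<omega>)" by (rule sum_distrib_left[symmetric])
  finally have "(\<Sum>i\<in>I. (\<sigma> ^^ i) \<omega>) = 0" using p_gt_2 by simp
  moreover have "(\<Sum>i\<in>I. (\<sigma> ^^ i) \<omega>) \<doteq> (\<Sum>i\<in>I. 1)" by (rule res_sum) (rule omega_res)
  ultimately have "of_int (int (card I)) \<doteq> 0" using res_sym by simp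
  hence "p dvd card I" by (simp only: res_int_0 int_dvd_int_iff)
  moreover have "card I > 0"
  proof -
    have "0 \<in> I" using p_gt_2 by (simp add: I_def e_def)
    moreover have "finite I" by (simp add: I_def)
    ultimately show ?thesis by (auto simp: card_gt_0_iff)
  qed
  moreover have "card I < p"
  proof -
    have "card I \<le> card {..<p - 1}" unfolding I_def by (rule card_mono) auto
    thus ?thesis using p_gt_2 by simp
  qed
  ultimately show False by (auto dest: dvd_imp_le)
qed

lemma theta_pow_Omega_eq:
  assumes "(\<theta> ^^ j) \<Omega> = \<Omega>"
  shows "p dvd j"
proof (rule ccontr)
  assume "\<not> p dvd j"
  hence "coprime j p" using coprime_nat_prime[OF p_prime] by blast
  then obtain x where "[j * x = 1] (mod p)" using cong_solve_coprime_nat by auto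
  hence "(\<theta> ^^ (j * x)) \<Omega> = (\<theta> ^^ 1) \<Omega>" by (rule theta_pow_cong[OF Omega_in_S])
  moreover have "((\<theta> ^^ j) ^^ x) \<Omega> = \<Omega>" by (induction x) (simp_all add: assms)
  ultimately show False using theta_Omega by (simp add: funpow_mult)
qed

lemma theta_pow_Omega_inj:
  assumes "i < p" "i > 0"
  shows "(\<theta> ^^ i) \<Omega> \<noteq> \<Omega>"
  using theta_pow_Omega_eq[of i] assms nat_dvd_not_less by blast

lemma sigma_reindex:
  fixes h :: "complex \<Rightarrow> 'a :: comm_monoid_mult"
  assumes "y \<in> S"
  shows "(\<Prod>j<p. h ((\<theta> ^^ (k * j)) y)) = (\<Prod>j<p. h ((\<theta> ^^ j) y))"
proof -
  have bij: "bij_betw (\<lambda>j. (k * j + 0) mod p) {..<p} {..<p}"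
    by (rule bij_betw_mult_mod[OF coprime_k]) (use p_gt_2 in simp)
  have "(\<Prod>j<p. h ((\<theta> ^^ (k * j)) y)) = (\<Prod>j<p. h ((\<theta> ^^ ((k * j + 0) mod p)) y))"
    using theta_pow_mod[OF assms] by simp
  also have "\<dots> = (\<Prod>j<p. h ((\<theta> ^^ j) y))" by (rule prod.reindex_bij_betw[OF bij])
  finally show ?thesis .
qed

lemma sigma_reindex_sum:
  assumes "y \<in> S"
  shows "(\<Sum>j<p. (\<theta> ^^ (k * j)) y) = (\<Sum>j<p. (\<theta> ^^ j) y)"
proof -
  have bij: "bij_betw (\<lambda>j. (k * j + 0) mod p) {..<p} {..<p}"
    by (rule bij_betw_mult_mod[OF coprime_k]) (use p_gt_2 in simp)
  have "(\<Sum>j<p. (\<theta> ^^ (k * j)) y) = (\<Sum>j<p. (\<theta> ^^ ((k * j + 0) mod p)) y)"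
    using theta_pow_mod[OF assms] by simp
  also have "\<dots> = (\<Sum>j<p. (\<theta> ^^ j) y)" by (rule sum.reindex_bij_betw[OF bij])
  finally show ?thesis .
qed

lemma trace_rational:
  assumes "y \<in> Fix"
  shows "(\<Sum>j<p. (\<theta> ^^ j) y) \<in> \<rat>"
proof -
  have y: "y \<in> S" "\<sigma> y = y" using assms by (simp_all add: Fix_def)
  have yj: "(\<theta> ^^ j) y \<in> S" for j by (rule \<theta>.funpow_closed[OF y(1)])
  show ?thesis
  proof (rule galois_fixed_rational)
    show "(\<Sum>j<p. (\<theta> ^^ j) y) \<in> S" by (rule S.sum_closed) (rule yj)
    have "\<theta> (\<Sum>j<p. (\<theta> ^^ j) y) = (\<Sum>j<p. (\<theta> ^^ Suc j) y)" using yj by (simp add: \<theta>.sum)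
    also have "\<dots> = (\<Sum>j<p. (\<theta> ^^ j) y)"
      by (rule cyclic_sum) (use theta_period[OF y(1)] in simp)
    finally show "\<theta> (\<Sum>j<p. (\<theta> ^^ j) y) = (\<Sum>j<p. (\<theta> ^^ j) y)" .
    have "\<sigma> (\<Sum>j<p. (\<theta> ^^ j) y) = (\<Sum>j<p. (\<theta> ^^ (k * j)) y)"
      using yj sigma_theta_pow[OF y(1)] y(2) by (simp add: \<sigma>.sum)
    thus "\<sigma> (\<Sum>j<p. (\<theta> ^^ j) y) = (\<Sum>j<p. (\<theta> ^^ j) y)"
      using sigma_reindex_sum[OF y(1)] by simp
  qed
qed

lemma char_poly_rational:
  assumes "y \<in> Fix"
  shows "coeff (\<Prod>j<p. [:- (\<theta> ^^ j) y, 1:]) i \<in> \<rat>"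
proof -
  have y: "y \<in> S" "\<sigma> y = y" using assms by (simp_all add: Fix_def)
  have yj: "(\<theta> ^^ j) y \<in> S" for j by (rule \<theta>.funpow_closed[OF y(1)])
  note tc = \<theta>.coeff_prod_linear[of "{..<p}" "\<lambda>j. (\<theta> ^^ j) y" i, OF finite_lessThan yj]
  note sc = \<sigma>.coeff_prod_linear[of "{..<p}" "\<lambda>j. (\<theta> ^^ j) y" i, OF finite_lessThan yj]
  show ?thesis
  proof (rule galois_fixed_rational)
    show "coeff (\<Prod>j<p. [:- (\<theta> ^^ j) y, 1:]) i \<in> S" using tc by blast
    have "(\<Prod>j<p. [:- \<theta> ((\<theta> ^^ j) y), 1:]) = (\<Prod>j<p. [:- (\<theta> ^^ Suc j) y, 1:])" by simp
    also have "\<dots> = (\<Prod>j<p. [:- (\<theta> ^^ j) y, 1:])"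
      by (rule cyclic_prod) (use theta_period[OF y(1)] in simp)
    finally show "\<theta> (coeff (\<Prod>j<p. [:- (\<theta> ^^ j) y, 1:]) i) = coeff (\<Prod>j<p. [:- (\<theta> ^^ j) y, 1:]) i"
      using tc by simp
    have "(\<Prod>j<p. [:- \<sigma> ((\<theta> ^^ j) y), 1:]) = (\<Prod>j<p. [:- (\<theta> ^^ (k * j)) y, 1:])"
      using sigma_theta_pow[OF y(1)] y(2) by simp
    also have "\<dots> = (\<Prod>j<p. [:- (\<theta> ^^ j) y, 1:])"
      by (rule sigma_reindex[OF y(1), of "\<lambda>z. [:- z, 1:]"])
    finally show "\<sigma> (coeff (\<Prod>j<p. [:- (\<theta> ^^ j) y, 1:]) i) = coeff (\<Prod>j<p. [:- (\<theta> ^^ j) y, 1:]) i"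
      using sc by simp
  qed
qed

text \<open>Lagrange interpolation: let \<open>g\<close> be the polynomial with roots \<open>\<theta>\<^sup>j \<Omega>\<close> and \<open>q = g / (X - \<Omega>)\<close>. For \<open>x\<close>
  fixed by \<open>\<sigma>\<close>, the sum of the \<open>\<theta>\<^sup>j (x q(\<Omega>))\<close>, with the coefficients of \<open>q\<close> kept fixed, collapses to
  \<open>x q(\<Omega>)\<close>. It is also a combination of the rational traces of \<open>x \<Omega>\<^sup>m\<close> with coefficients in \<open>\<rat>(\<Omega>)\<close>.\<close>

lemma Fix_eq_field_gen: "field_gen {\<Omega>} = Fix"
proof
  have OF: "\<Omega> \<in> Fix" using Omega_in_S sigma_Omega by (simp add: Fix_def)
  show "field_gen {\<Omega>} \<subseteq> Fix"
    by (rule field_gen_minimal[OF Fix.subfield_of_complex_axioms]) (use OF in simp)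
  interpret M: subfield_of_complex "field_gen {\<Omega>}" by (rule subfield_field_gen)
  have OM: "\<Omega> \<in> field_gen {\<Omega>}" using field_gen_incl by blast
  show "Fix \<subseteq> field_gen {\<Omega>}"
  proof
    fix x assume x: "x \<in> Fix"
    hence xS: "x \<in> S" by (simp add: Fix_def)
    let ?g = "\<Prod>j<p. [:- (\<theta> ^^ j) \<Omega>, 1:]"
    define q where "q = (\<Prod>j\<in>{..<p} - {0}. [:- (\<theta> ^^ j) \<Omega>, 1:])"
    have gq: "?g = q * [:- \<Omega>, 1:]"
      unfolding q_def using p_gt_2 by (subst prod.remove[of _ 0]) (auto simp: mult.commute)
    have lin: "coeff [:- \<Omega>, 1:] i \<in> field_gen {\<Omega>}" for i
      using M.uminus_closed[OF OM] by (simp add: coeff_pCons split: nat.split)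
    have "\<exists>q' r. ?g = q' * [:- \<Omega>, 1:] + r \<and> (\<forall>i. coeff q' i \<in> field_gen {\<Omega>}) \<and>
        (\<forall>i. coeff r i \<in> field_gen {\<Omega>}) \<and> (r = 0 \<or> degree r < degree [:- \<Omega>, 1:])"
      by (rule M.monic_division[OF lin]) (use char_poly_rational[OF OF] M.Rats_subset in auto)
    then obtain q' r where q': "?g = q' * [:- \<Omega>, 1:] + r" "\<forall>i. coeff q' i \<in> field_gen {\<Omega>}"
        "r = 0 \<or> degree r < 1" by auto
    then obtain c where c: "r = [:c:]" by (metis degree_eq_zeroE less_one pCons_0_0)
    have "poly ?g \<Omega> = 0" unfolding gq by simp
    hence "c = 0" unfolding q'(1) c by simp
    hence "q * [:- \<Omega>, 1:] = q' * [:- \<Omega>, 1:]" using gq q'(1) c by simp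
    hence "q = q'" by (simp del: mult_pCons_right)
    hence qM: "coeff q i \<in> field_gen {\<Omega>}" for i using q'(2) by blast
    have q0: "poly q \<Omega> \<noteq> 0"
    proof
      assume "poly q \<Omega> = 0"
      hence "(\<Prod>j\<in>{..<p} - {0}. \<Omega> - (\<theta> ^^ j) \<Omega>) = 0"
        unfolding q_def poly_prod by simp
      hence "\<exists>j\<in>{..<p} - {0}. \<Omega> - (\<theta> ^^ j) \<Omega> = 0"
        by (simp only: prod_zero_iff finite_Diff finite_lessThan)
      then obtain j where "j \<in> {..<p} - {0}" "\<Omega> - (\<theta> ^^ j) \<Omega> = 0" by blast
      thus False using theta_pow_Omega_inj[of j] by simp
    qed
    have tr: "(\<Sum>j<p. (\<theta> ^^ j) (x * \<Omega> ^ m)) \<in> field_gen {\<Omega>}" for m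
      using trace_rational[OF Fix.mult_closed[OF x Fix.power_closed[OF OF]]] M.Rats_subset by blast
    have "x * poly q \<Omega> = (\<Sum>j<p. (\<theta> ^^ j) x * poly q ((\<theta> ^^ j) \<Omega>))"
    proof -
      have "(\<Sum>j<p. (\<theta> ^^ j) x * poly q ((\<theta> ^^ j) \<Omega>)) =
          (\<theta> ^^ 0) x * poly q ((\<theta> ^^ 0) \<Omega>) + (\<Sum>j\<in>{..<p} - {0}. (\<theta> ^^ j) x * poly q ((\<theta> ^^ j) \<Omega>))"
        using p_gt_2 by (intro sum.remove) auto
      also have "(\<Sum>j\<in>{..<p} - {0}. (\<theta> ^^ j) x * poly q ((\<theta> ^^ j) \<Omega>)) = 0"
      proof (rule sum.neutral, rule ballI)
        fix j assume "j \<in> {..<p} - {0}"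
        hence "poly q ((\<theta> ^^ j) \<Omega>) = 0" unfolding q_def poly_prod by (intro prod_zero) auto
        thus "(\<theta> ^^ j) x * poly q ((\<theta> ^^ j) \<Omega>) = 0" by simp
      qed
      finally show ?thesis by simp
    qed
    also have "\<dots> = (\<Sum>j<p. \<Sum>m\<le>degree q. coeff q m * (\<theta> ^^ j) (x * \<Omega> ^ m))"
    proof (rule sum.cong[OF refl])
      fix j
      interpret t: subfield_endo S "\<theta> ^^ j" by (rule \<theta>.funpow)
      show "(\<theta> ^^ j) x * poly q ((\<theta> ^^ j) \<Omega>) = (\<Sum>m\<le>degree q. coeff q m * (\<theta> ^^ j) (x * \<Omega> ^ m))"
        unfolding poly_altdef sum_distrib_left
        by (simp add: t.mult t.power S.power_closed xS Omega_in_S mult_ac)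
    qed
    also have "\<dots> = (\<Sum>m\<le>degree q. coeff q m * (\<Sum>j<p. (\<theta> ^^ j) (x * \<Omega> ^ m)))"
      by (subst sum.swap) (simp add: sum_distrib_left)
    also have "\<dots> \<in> field_gen {\<Omega>}"
      by (rule M.sum_closed) (rule M.mult_closed[OF qM tr])
    finally have "x * poly q \<Omega> / poly q \<Omega> \<in> field_gen {\<Omega>}"
      by (rule M.divide_closed[OF _ M.poly_closed[OF qM OM]])
    thus "x \<in> field_gen {\<Omega>}" using q0 by simp
  qed
qed

lemma integers_of_M: "integers_of (field_gen {\<Omega>}) = \<O>\<^sub>M"
  unfolding Fix_eq_field_gen by (auto simp: integers_of_def Fix_def \<O>\<^sub>M_def)

end

section \<open>Ideals and valuations\<close>

lemma carrier_ints_of: "carrier (ints_of F) = integers_of F"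
  by (simp add: ints_of_def integers_of_def)

lemma ints_of_ops [simp]:
  "x \<otimes>\<^bsub>ints_of F\<^esub> y = x * y" "x \<oplus>\<^bsub>ints_of F\<^esub> y = x + y"
  "\<one>\<^bsub>ints_of F\<^esub> = 1" "\<zero>\<^bsub>ints_of F\<^esub> = 0"
  by (simp_all add: ints_of_def ring_of_type_algebra_def)

lemma cring_ints_of:
  assumes "subring_of_complex F"
  shows "cring (ints_of F)"
proof -
  interpret subring_of_complex "integers_of F" by (rule subring_integers_of[OF assms])
  show ?thesis
  proof (rule cringI)
    show "abelian_group (ints_of F)"
      by (rule abelian_groupI)
         (auto simp: carrier_ints_of add_ac zero_closed intro: add_closed
           intro!: bexI[of _ "- x" for x] uminus_closed)
    show "comm_monoid (ints_of F)"
      by (rule comm_monoidI) (auto simp: carrier_ints_of mult_ac one_closed intro: mult_closed)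
  qed (simp add: algebra_simps)
qed

lemma frac_ideals_ops [simp]:
  "I \<otimes>\<^bsub>frac_ideals F\<^esub> J = ideal_prod ring_of_type_algebra I J"
  "\<one>\<^bsub>frac_ideals F\<^esub> = integers_of F"
  by (simp_all add: frac_ideals_def carrier_ints_of)

lemma ideal_prod_prod: "x \<in> I \<Longrightarrow> y \<in> J \<Longrightarrow> x * y \<in> ideal_prod (ring_of_type_algebra :: complex ring) I J"
  using ideal_prod.prod[of x I y J "ring_of_type_algebra"] by simp

lemma ideal_prod_sum: 
  "x \<in> ideal_prod (ring_of_type_algebra :: complex ring) I J \<Longrightarrow> y \<in> ideal_prod ring_of_type_algebra I J \<Longrightarrow>
    x + y \<in> ideal_prod ring_of_type_algebra I J"
  using ideal_prod.sum[of x "ring_of_type_algebra" I J y] by simp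

lemma ideal_prod_least:
  assumes "\<And>x y. x \<in> I \<Longrightarrow> y \<in> J \<Longrightarrow> x * y \<in> T" "\<And>x y. x \<in> T \<Longrightarrow> y \<in> T \<Longrightarrow> x + y \<in> T"
  shows "ideal_prod (ring_of_type_algebra :: complex ring) I J \<subseteq> T"
proof
  fix x :: complex assume "x \<in> ideal_prod ring_of_type_algebra I J"
  thus "x \<in> T" by (induction rule: ideal_prod.induct) (simp_all add: assms)
qed

lemma princ_power:
  assumes "subring_of_complex F"
  shows "princ F y [^]\<^bsub>frac_ideals F\<^esub> (n :: nat) = princ F (y ^ n)"
proof -
  interpret subring_of_complex "integers_of F" by (rule subring_integers_of[OF assms])
  show ?thesis
  proof (induction n)
    case 0
    show ?case by (simp add: princ_def carrier_ints_of)
  next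
    case (Suc n)
    have "ideal_prod ring_of_type_algebra (princ F (y ^ n)) (princ F y) = princ F (y ^ Suc n)"
    proof
      show "ideal_prod ring_of_type_algebra (princ F (y ^ n)) (princ F y) \<subseteq> princ F (y ^ Suc n)"
      proof (rule ideal_prod_least)
        fix a b assume "a \<in> princ F (y ^ n)" "b \<in> princ F y"
        then obtain c e where ce: "c \<in> integers_of F" "e \<in> integers_of F" "a = y ^ n * c" "b = y * e"
          by (auto simp: princ_def carrier_ints_of)
        have "a * b = y ^ Suc n * (c * e)" by (simp add: ce)
        thus "a * b \<in> princ F (y ^ Suc n)"
          unfolding princ_def carrier_ints_of using mult_closed[OF ce(1,2)] by blast
      next
        fix a b assume "a \<in> princ F (y ^ Suc n)" "b \<in> princ F (y ^ Suc n)"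
        then obtain c e where ce: "c \<in> integers_of F" "e \<in> integers_of F" "a = y ^ Suc n * c" "b = y ^ Suc n * e"
          by (auto simp: princ_def carrier_ints_of)
        have "a + b = y ^ Suc n * (c + e)" by (simp only: ce distrib_left)
        thus "a + b \<in> princ F (y ^ Suc n)"
          unfolding princ_def carrier_ints_of using add_closed[OF ce(1,2)] by blast
      qed
      show "princ F (y ^ Suc n) \<subseteq> ideal_prod ring_of_type_algebra (princ F (y ^ n)) (princ F y)"
      proof
        fix a assume "a \<in> princ F (y ^ Suc n)"
        then obtain c where c: "c \<in> integers_of F" "a = (y ^ n * c) * (y * 1)"
          by (auto simp: princ_def carrier_ints_of)
        show "a \<in> ideal_prod ring_of_type_algebra (princ F (y ^ n)) (princ F y)"
          unfolding c(2) by (rule ideal_prod_prod)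
            (use c(1) one_closed in \<open>auto simp: princ_def carrier_ints_of\<close>)
      qed
    qed
    thus ?case using Suc by simp
  qed
qed

lemma val_geD:
  assumes F: "subring_of_complex F" and n: "n > 0" and v: "val F (princ F y) x \<ge> ereal (real n)"
    and y: "y \<in> integers_of F"
  shows "\<exists>z\<in>integers_of F. x = y ^ n * z"
proof -
  interpret subring_of_complex "integers_of F" by (rule subring_integers_of[OF F])
  let ?A = "{k :: int. x \<in> princ F y [^]\<^bsub>frac_ideals F\<^esub> k}"
  \<comment> \<open>the valuation is a supremum of integers, so it suffices to exceed \<open>n - 1\<close>\<close>
  have "ereal (real n - 1) < val F (princ F y) x"
    by (rule less_le_trans[OF _ v]) simp
  then obtain k where k: "k \<in> ?A" "ereal (real n - 1) < ereal (real_of_int k)"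
    unfolding val_def less_SUP_iff by blast
  have "int n \<le> k" using k(2) by simp
  define m where "m = nat k"
  have m: "k = int m" "n \<le> m" using \<open>int n \<le> k\<close> by (simp_all add: m_def le_nat_iff)
  have "x \<in> princ F (y ^ m)" using k(1) unfolding m(1) by (simp add: int_pow_int princ_power[OF F])
  then obtain z where z: "z \<in> integers_of F" "x = y ^ m * z" by (auto simp: princ_def carrier_ints_of)
  have "y ^ m = y ^ n * y ^ (m - n)" using m(2) by (simp flip: power_add)
  hence "x = y ^ n * (y ^ (m - n) * z)" by (simp add: z(2))
  thus ?thesis using mult_closed[OF power_closed[OF y] z(1)] by blast
qed

lemma integers_of_Rats: "integers_of \<rat> = \<int>"
  using rational_algebraic_int_is_int Ints_subset_Rats int_imp_algebraic_int
  by (auto simp: integers_of_def)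

lemma princ_Rats: "x \<in> princ \<rat> (of_nat p) \<longleftrightarrow> (\<exists>n. x = of_int n \<and> int p dvd n)"
proof
  assume "x \<in> princ \<rat> (of_nat p)"
  then obtain n where "x = of_nat p * of_int n"
    unfolding princ_def carrier_ints_of integers_of_Rats by (auto elim!: Ints_cases)
  hence "x = of_int (int p * n)" by simp
  thus "\<exists>n. x = of_int n \<and> int p dvd n" using dvd_triv_left by blast
next
  assume "\<exists>n. x = of_int n \<and> int p dvd n"
  then obtain n where "x = of_int (int p * n)" unfolding dvd_def by blast
  hence "x = of_nat p * of_int n" by simp
  thus "x \<in> princ \<rat> (of_nat p)"
    unfolding princ_def carrier_ints_of integers_of_Rats by auto
qed

lemma subfield_endo_ring_iso:
  assumes "subfield_of_complex S" "s \<in> ring_iso (fld S) (fld S)"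
  shows "subfield_endo S s"
proof -
  interpret subfield_of_complex S by fact
  have c: "carrier (fld S) = S" by (simp add: fld_def)
  have ops: "x \<otimes>\<^bsub>fld S\<^esub> y = x * y" "x \<oplus>\<^bsub>fld S\<^esub> y = x + y" "\<one>\<^bsub>fld S\<^esub> = 1" for x y
    by (simp_all add: fld_def ring_of_type_algebra_def)
  show ?thesis
    by standard (use ring_iso_memE[OF assms(2)] in \<open>simp_all add: c ops\<close>)
qed

section \<open>Primes over \<open>p\<close> in the fixed field\<close>

context kummer_galois
begin

abbreviation M :: "complex set" where "M \<equiv> field_gen {\<Omega>}"

lemma subring_M: "subring_of_complex M"
  using subfield_field_gen[of "{\<Omega>}"] by (simp add: subfield_of_complex_def)

lemma carrier_OM: "carrier (ints_of M) = \<O>\<^sub>M"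
  by (simp add: carrier_ints_of integers_of_M)

lemma OM_rational: "\<O>\<^sub>M \<inter> \<rat> = \<int>"
proof
  show "\<O>\<^sub>M \<inter> \<rat> \<subseteq> \<int>"
    using rational_algebraic_int_is_int by (auto simp: \<O>\<^sub>M_def integers_of_def)
  show "\<int> \<subseteq> \<O>\<^sub>M \<inter> \<rat>"
    using OM.of_int_closed Ints_subset_Rats by (auto elim!: Ints_cases)
qed

lemma Q_inter_Rats: "Q c \<inter> \<rat> = princ \<rat> (of_nat p)"
proof -
  have "x \<in> Q c \<inter> \<rat> \<longleftrightarrow> (\<exists>n. x = of_int n \<and> int p dvd n)" for x
  proof
    assume x: "x \<in> Q c \<inter> \<rat>"
    hence "x \<in> \<int>" using Q_OM OM_rational by blast
    thus "\<exists>n. x = of_int n \<and> int p dvd n" using x Q_int by (auto elim!: Ints_cases)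
  next
    assume "\<exists>n. x = of_int n \<and> int p dvd n"
    thus "x \<in> Q c \<inter> \<rat>" using Q_int by auto
  qed
  thus ?thesis unfolding set_eq_iff princ_Rats by blast
qed

lemma Q_primeideal: "primeideal (Q c) (ints_of M)"
proof (rule primeidealI)
  show cr: "cring (ints_of M)" by (rule cring_ints_of[OF subring_M])
  interpret cring "ints_of M" by (rule cr)
  have inv: "\<ominus>\<^bsub>ints_of M\<^esub> x = - x" if "x \<in> \<O>\<^sub>M" for x
    by (rule minus_equality) (use that OM.uminus_closed in \<open>auto simp: carrier_OM\<close>)
  show "ideal (Q c) (ints_of M)"
  proof (rule idealI)
    show "ring (ints_of M)" by (rule ring_axioms)
    show "subgroup (Q c) (add_monoid (ints_of M))"
    proof (rule add.subgroupI)
      show "Q c \<subseteq> carrier (ints_of M)" using Q_OM carrier_OM by blast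
      show "Q c \<noteq> {}" using Q_zero by blast
      show "\<ominus>\<^bsub>ints_of M\<^esub> a \<in> Q c" if "a \<in> Q c" for a
        using Q_diff[OF Q_zero that] inv[OF Q_OM[OF that]] by simp
      show "a \<oplus>\<^bsub>ints_of M\<^esub> b \<in> Q c" if "a \<in> Q c" "b \<in> Q c" for a b
        using Q_add[OF that] by simp
    qed
    show "x \<otimes>\<^bsub>ints_of M\<^esub> a \<in> Q c" if "a \<in> Q c" "x \<in> carrier (ints_of M)" for a x
      using Q_mult[of a c x] that by (simp add: carrier_OM)
    show "a \<otimes>\<^bsub>ints_of M\<^esub> x \<in> Q c" if "a \<in> Q c" "x \<in> carrier (ints_of M)" for a x
      using Q_mult[of a c x] that by (simp add: carrier_OM mult.commute)
  qed
  show "carrier (ints_of M) \<noteq> Q c"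
    using Q_int[of 1 c] OM.one_closed p_gt_2 carrier_OM by auto
  show "a \<in> Q c \<or> b \<in> Q c" if "a \<in> carrier (ints_of M)" "b \<in> carrier (ints_of M)"
      "a \<otimes>\<^bsub>ints_of M\<^esub> b \<in> Q c" for a b
    using Q_prime[of a b c] that by (simp add: carrier_OM)
qed

lemma primes_over_eq_range_Q: "primes_over M \<rat> (princ \<rat> (of_nat p)) = range Q"
proof
  show "range Q \<subseteq> primes_over M \<rat> (princ \<rat> (of_nat p))"
    unfolding primes_over_def using Q_primeideal Q_inter_Rats by auto
  show "primes_over M \<rat> (princ \<rat> (of_nat p)) \<subseteq> range Q"
  proof
    fix P assume "P \<in> primes_over M \<rat> (princ \<rat> (of_nat p))"
    hence P: "primeideal P (ints_of M)" "P \<inter> \<rat> = princ \<rat> (of_nat p)"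
      by (auto simp: primes_over_def)
    interpret primeideal P "ints_of M" by (rule P(1))
    have "\<exists>c. P = Q c"
    proof (rule prime_over_p_is_Q)
      show "P \<subseteq> \<O>\<^sub>M" using a_subset carrier_OM by blast
      show "x + y \<in> P" if "x \<in> P" "y \<in> P" for x y using additive_subgroup.a_closed[OF additive_subgroup_axioms that] by simp
      show "y * x \<in> P" if "x \<in> P" "y \<in> \<O>\<^sub>M" for x y
        using I_l_closed[OF that(1), of y] that(2) by (simp add: carrier_OM)
      show "x \<in> P \<or> y \<in> P" if "x \<in> \<O>\<^sub>M" "y \<in> \<O>\<^sub>M" "x * y \<in> P" for x y
        using I_prime[of x y] that by (simp add: carrier_OM)
      show "of_int n \<in> P \<longleftrightarrow> int p dvd n" for n
      proof -
        have "of_int n \<in> P \<longleftrightarrow> of_int n \<in> P \<inter> \<rat>" by simp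
        also have "P \<inter> \<rat> = Q 0 \<inter> \<rat>" using P(2) Q_inter_Rats[of 0] by simp
        also have "of_int n \<in> Q 0 \<inter> \<rat> \<longleftrightarrow> of_int n \<in> Q 0" by simp
        finally show ?thesis by (simp only: Q_int)
      qed
    qed
    thus "P \<in> range Q" by blast
  qed
qed

lemma ideal_power_contains:
  "x \<in> Q c \<Longrightarrow> a \<in> \<O>\<^sub>M \<Longrightarrow> a * x ^ n \<in> Q c [^]\<^bsub>frac_ideals M\<^esub> (n :: nat)"
proof (induction n)
  case 0
  thus ?case by (simp add: integers_of_M)
next
  case (Suc n)
  have "(a * x ^ n) * x \<in> ideal_prod ring_of_type_algebra (Q c [^]\<^bsub>frac_ideals M\<^esub> n) (Q c)"
    by (rule ideal_prod_prod[OF Suc.IH[OF Suc.prems] Suc.prems(1)])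
  thus ?case by (simp add: mult_ac)
qed

lemma ideal_power_add:
  assumes "(n :: nat) > 0" "x \<in> Q c [^]\<^bsub>frac_ideals M\<^esub> n" "y \<in> Q c [^]\<^bsub>frac_ideals M\<^esub> n"
  shows "x + y \<in> Q c [^]\<^bsub>frac_ideals M\<^esub> n"
proof -
  obtain m where "n = Suc m" using assms(1) by (cases n) auto
  thus ?thesis using ideal_prod_sum assms(2,3) by simp
qed

lemma ideal_power_subset_Fil:
  assumes "Q c \<subseteq> Fil c m"
  shows "Q c [^]\<^bsub>frac_ideals M\<^esub> (n :: nat) \<subseteq> Fil c (m * n)"
proof (induction n)
  case 0
  show ?case using OM_OS Fil_0 by (auto simp: integers_of_M)
next
  case (Suc n)
  have "ideal_prod ring_of_type_algebra (Q c [^]\<^bsub>frac_ideals M\<^esub> n) (Q c) \<subseteq> Fil c (m * n + m)"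
    by (rule ideal_prod_least) (use Fil_mult Fil_add Suc.IH assms in blast)+
  thus ?case by (simp add: add.commute)
qed

text \<open>The lower bound is \<open>p_in_powers\<close>. For the upper bound, the \<open>e\<close>-th power of \<open>Q c\<close> consists of elements of
  order at least \<open>e (p - 1) / n\<close> at \<open>c\<close>, whereas \<open>p\<close> has order \<open>p - 1\<close>.\<close>

lemma ram_index_Q:
  assumes n: "n dvd p - 1" "\<And>j. [int (k ^ j) * c = c] (mod int p) \<longleftrightarrow> n dvd j"
  shows "ram_index M (Q c) (princ \<rat> (of_nat p)) = n"
  unfolding ram_index_def
proof (rule Greatest_equality)
  have n0: "n > 0" using n(1) p_gt_2 by (intro Nat.gr0I) auto
  obtain x q a where xqa: "x \<in> Q c" "q \<in> Q c" "a \<in> \<O>\<^sub>M" "of_nat p = a * x ^ n + of_nat p * q ^ n"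
    using p_in_powers[OF n] by blast
  show "princ \<rat> (of_nat p) \<subseteq> Q c [^]\<^bsub>frac_ideals M\<^esub> n"
  proof
    fix y assume "y \<in> princ \<rat> (of_nat p)"
    then obtain m where "y = of_int (int p * m)" unfolding princ_Rats dvd_def by blast
    hence m: "y = of_int m * of_nat p" by simp
    have "y = (of_int m * a) * x ^ n + (of_int m * of_nat p) * q ^ n"
      unfolding m by (subst (1) xqa(4)) (simp add: algebra_simps)
    also have "\<dots> \<in> Q c [^]\<^bsub>frac_ideals M\<^esub> n"
      by (rule ideal_power_add[OF n0 ideal_power_contains[OF xqa(1) OM.mult_closed[OF OM.of_int_closed xqa(3)]]
            ideal_power_contains[OF xqa(2) OM.mult_closed[OF OM.of_int_closed OM.of_nat_closed]]])
    finally show "y \<in> Q c [^]\<^bsub>frac_ideals M\<^esub> n" .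
  qed
  fix e :: nat assume e: "princ \<rat> (of_nat p) \<subseteq> Q c [^]\<^bsub>frac_ideals M\<^esub> e"
  let ?m = "(p - 1) div n"
  have "[int (k ^ n) * c = c] (mod int p)" using n(2) by simp
  hence "Q c \<subseteq> Fil c ?m" using Q_subset_Fil[OF n(1)] by blast
  hence sub: "Q c [^]\<^bsub>frac_ideals M\<^esub> e \<subseteq> Fil c (?m * e)" by (rule ideal_power_subset_Fil)
  have "of_nat p \<in> princ \<rat> (of_nat p)" unfolding princ_Rats by (intro exI[of _ "int p"]) simp
  hence "of_nat p \<in> Fil c (?m * e)" using e sub by blast
  hence "?m * e < p" using p_notin_Fil not_le_imp_less by blast
  show "e \<le> n"
  proof (rule ccontr)
    assume "\<not> e \<le> n"
    hence "?m * Suc n \<le> ?m * e" by (intro mult_le_mono2) simp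
    moreover have mn: "?m * n = p - 1" using n(1) by simp
    moreover have "?m \<noteq> 0" using mn p_gt_2 by (intro notI) simp
    ultimately show False using \<open>?m * e < p\<close> by simp
  qed
qed

lemma ord_k_dvd: "ord p k dvd p - 1"
  using k_fermat by (simp only: ord_divides)

lemma stabilizer_nonzero:
  assumes "\<not> int p dvd c"
  shows "[int (k ^ j) * c = c] (mod int p) \<longleftrightarrow> ord p k dvd j"
proof -
  have "coprime c (int p)" using coprime_int_prime[OF p_prime] assms by blast
  hence "[int (k ^ j) * c = 1 * c] (mod int p) \<longleftrightarrow> [int (k ^ j) = 1] (mod int p)"
    by (simp only: cong_mult_rcancel)
  also have "\<dots> \<longleftrightarrow> [k ^ j = 1] (mod p)" by (metis cong_int_iff of_nat_1)
  also have "\<dots> \<longleftrightarrow> ord p k dvd j" by (rule ord_divides)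
  finally show ?thesis by simp
qed

lemma ram_index_Q_0: "ram_index M (Q 0) (princ \<rat> (of_nat p)) = 1"
  by (rule ram_index_Q) simp_all

lemma ram_index_Q_nonzero:
  "\<not> int p dvd c \<Longrightarrow> ram_index M (Q c) (princ \<rat> (of_nat p)) = ord p k"
  by (rule ram_index_Q[OF ord_k_dvd stabilizer_nonzero])

lemma ord_k_pos: "ord p k > 0"
  using coprime_k by (simp add: ord_eq_0 coprime_commute zero_less_iff_neq_zero)

lemma ord_k_gt_1: "ord p k > 1"
  using ord_k_pos k_ne_1 ord_eq_Suc_0_iff[of p k] by linarith

lemma card_Q_fibre:
  assumes c: "c \<in> {1..<int p}"
  shows "card {c' \<in> {1..<int p}. Q c' = Q c} = ord p k"
proof -
  have pc: "\<not> int p dvd c" using c by (auto dest: zdvd_imp_le)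
  let ?f = "\<lambda>j. (int (k ^ j) * c) mod int p"
  have cop: "coprime c (int p)" using coprime_int_prime[OF p_prime] pc by blast
  have "{c' \<in> {1..<int p}. Q c' = Q c} = ?f ` {..<ord p k}"
  proof
    show "{c' \<in> {1..<int p}. Q c' = Q c} \<subseteq> ?f ` {..<ord p k}"
    proof
      fix c' assume c': "c' \<in> {c' \<in> {1..<int p}. Q c' = Q c}"
      then obtain j where j: "[c' = int (k ^ j) * c] (mod int p)" using Q_eq_imp_orbit[of c c'] by auto
      have "[k ^ j = k ^ (j mod ord p k)] (mod p)"
        using order_divides_expdiff[of p k] coprime_k by (simp add: coprime_commute)
      hence "[int (k ^ j) * c = int (k ^ (j mod ord p k)) * c] (mod int p)"
        by (metis cong_int_iff cong_scalar_right)
      hence "[c' = int (k ^ (j mod ord p k)) * c] (mod int p)" using j cong_trans by blast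
      hence "c' = ?f (j mod ord p k)" using c' by (simp add: Cong.cong_def)
      thus "c' \<in> ?f ` {..<ord p k}" by (rule image_eqI) (use ord_k_pos in simp)
    qed
    show "?f ` {..<ord p k} \<subseteq> {c' \<in> {1..<int p}. Q c' = Q c}"
    proof
      fix c' assume "c' \<in> ?f ` {..<ord p k}"
      then obtain j where j: "c' = ?f j" by blast
      have cc: "[c' = int (k ^ j) * c] (mod int p)" by (simp add: j Cong.cong_def)
      have "Q c' = Q c" using Q_cong[OF cc] Q_orbit by simp
      moreover have "\<not> int p dvd c'"
      proof
        assume "int p dvd c'"
        have "int p dvd int (k ^ j) * c" using cong_dvd_iff[OF cc] \<open>int p dvd c'\<close> by simp
        hence "int p dvd int (k ^ j)" using pc p_prime by (simp add: prime_dvd_mult_iff)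
        hence "p dvd k ^ j" by (simp only: int_dvd_int_iff)
        hence "p dvd k" using p_prime prime_dvd_power by blast
        thus False using coprime_common_divisor[OF coprime_k _ dvd_refl] p_prime not_prime_unit by blast
      qed
      moreover have "0 \<le> c'" "c' < int p" using p_gt_2 by (simp_all add: j)
      ultimately show "c' \<in> {c' \<in> {1..<int p}. Q c' = Q c}"
        by (cases "c' = 0") auto
    qed
  qed
  moreover have "inj_on ?f {..<ord p k}"
  proof (rule inj_onI)
    fix i j assume ij: "i \<in> {..<ord p k}" "j \<in> {..<ord p k}" "?f i = ?f j"
    hence "[int (k ^ i) * c = int (k ^ j) * c] (mod int p)" by (simp add: Cong.cong_def)
    hence "[int (k ^ i) = int (k ^ j)] (mod int p)" by (simp only: cong_mult_rcancel[OF cop])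
    hence "[k ^ i = k ^ j] (mod p)" by (simp only: cong_int_iff)
    hence "[i = j] (mod ord p k)"
      using order_divides_expdiff[of p k i j] coprime_k by (simp add: coprime_commute)
    thus "i = j" using ij by (simp add: Cong.cong_def)
  qed
  ultimately show ?thesis by (simp add: card_image)
qed

text \<open>The points different from the origin fall into orbits of length \<open>ord p k\<close>.\<close>

lemma card_nonzero_Q: "card (Q ` {1..<int p}) = (p - 1) div ord p k"
proof -
  have "int (p - 1) = int (card {1..<int p})" using p_gt_2 by simp
  also have "card {1..<int p} = (\<Sum>c\<in>{1..<int p}. 1)" by simp
  also have "\<dots> = (\<Sum>P\<in>Q ` {1..<int p}. \<Sum>c\<in>{c \<in> {1..<int p}. Q c = P}. 1)"
    by (rule sum.image_gen) simp
  also have "\<dots> = (\<Sum>P\<in>Q ` {1..<int p}. ord p k)"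
    by (rule sum.cong[OF refl]) (use card_Q_fibre in auto)
  also have "\<dots> = card (Q ` {1..<int p}) * ord p k" by simp
  finally have "p - 1 = card (Q ` {1..<int p}) * ord p k" by (simp only: of_nat_eq_iff)
  thus ?thesis using ord_k_pos by simp
qed

lemma range_Q: "range Q = insert (Q 0) (Q ` {1..<int p})"
proof
  show "range Q \<subseteq> insert (Q 0) (Q ` {1..<int p})"
  proof
    fix P assume "P \<in> range Q"
    then obtain c where c: "P = Q c" by blast
    have "P = Q (c mod int p)" unfolding c by (rule Q_cong) (simp add: Cong.cong_def)
    moreover have "0 \<le> c mod int p" "c mod int p < int p" using p_gt_2 by simp_all
    ultimately show "P \<in> insert (Q 0) (Q ` {1..<int p})"
      by (cases "c mod int p = 0") auto
  qed
qed auto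

lemma Q_0_distinct: "Q 0 \<notin> Q ` {1..<int p}"
proof
  assume "Q 0 \<in> Q ` {1..<int p}"
  then obtain c where c: "c \<in> {1..<int p}" "Q 0 = Q c" by blast
  then obtain j where "[c = int (k ^ j) * 0] (mod int p)" using Q_eq_imp_orbit[of 0 c] by blast
  hence "int p dvd c" by (simp add: cong_0_iff)
  thus False using c(1) by (auto dest: zdvd_imp_le)
qed

lemma primes_and_ramification:
  "card (primes_over M \<rat> (princ \<rat> (of_nat p))) = (p - 1) div ord p k + 1 \<and>
    (\<exists>\<PP> :: nat \<Rightarrow> complex set.
       bij_betw \<PP> {0..(p - 1) div ord p k} (primes_over M \<rat> (princ \<rat> (of_nat p))) \<and>
       ram_index M (\<PP> 0) (princ \<rat> (of_nat p)) = 1 \<and>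
       (\<forall>j \<in> {1..(p - 1) div ord p k}. ram_index M (\<PP> j) (princ \<rat> (of_nat p)) = ord p k) \<and>
       ord p k > 1)"
proof -
  let ?N = "Q ` {1..<int p}" and ?r = "(p - 1) div ord p k"
  have primes: "primes_over M \<rat> (princ \<rat> (of_nat p)) = insert (Q 0) ?N"
    by (simp only: primes_over_eq_range_Q range_Q)
  have card: "card (primes_over M \<rat> (princ \<rat> (of_nat p))) = ?r + 1"
    unfolding primes using Q_0_distinct card_nonzero_Q by simp
  obtain h where h: "bij_betw h {0..<?r} ?N"
    using ex_bij_betw_nat_finite[of ?N] card_nonzero_Q by auto
  define \<PP> where "\<PP> = (\<lambda>j. if j = 0 then Q 0 else h (j - 1))"
  have "bij_betw \<PP> {1..?r} ?N"
  proof -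
    have "bij_betw (\<lambda>j. j - 1) {1..?r} {0..<?r}"
      by (rule bij_betwI[of _ _ _ Suc]) auto
    from bij_betw_trans[OF this h] have "bij_betw (h \<circ> (\<lambda>j. j - 1)) {1..?r} ?N" .
    thus ?thesis by (rule bij_betw_cong[THEN iffD1, rotated]) (auto simp: \<PP>_def)
  qed
  moreover have "bij_betw \<PP> {0} {Q 0}" by (simp add: \<PP>_def bij_betw_def)
  ultimately have "bij_betw \<PP> ({0} \<union> {1..?r}) ({Q 0} \<union> ?N)"
    using Q_0_distinct by (intro bij_betw_combine) auto
  moreover have "{0} \<union> {1..?r} = {0..?r}" by auto
  ultimately have bij: "bij_betw \<PP> {0..?r} (primes_over M \<rat> (princ \<rat> (of_nat p)))"
    by (simp add: primes)
  have "ram_index M (\<PP> j) (princ \<rat> (of_nat p)) = ord p k" if "j \<in> {1..?r}" for j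
  proof -
    have "\<PP> j \<in> ?N" using bij_betwE[OF \<open>bij_betw \<PP> {1..?r} ?N\<close>] that by blast
    then obtain c where c: "c \<in> {1..<int p}" "\<PP> j = Q c" by blast
    have "\<not> int p dvd c" using c(1) by (auto dest: zdvd_imp_le)
    thus ?thesis unfolding c(2) by (rule ram_index_Q_nonzero)
  qed
  moreover have "ram_index M (\<PP> 0) (princ \<rat> (of_nat p)) = 1"
    using ram_index_Q_0 by (simp add: \<PP>_def)
  ultimately show ?thesis using card bij ord_k_gt_1 by blast
qed

end

section \<open>Primary numbers and singular fields\<close>

context kummer
begin

text \<open>Reduction modulo \<open>lam\<close> shows \<open>a\<^sup>p \<equiv> 1\<close>, hence \<open>a \<equiv> 1\<close> modulo \<open>p\<close>, and then \<open>a\<^sup>p \<equiv> 1\<close> even modulo \<open>p\<^sup>2\<close>,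
  which is divisible by \<open>lam\<^sup>p\<close>. So \<open>a\<^sup>p\<close> may be replaced by 1.\<close>

lemma primary_imp_principal_unit:
  assumes z: "A - 1 = lam ^ 2 * z" "z \<in> integers_of K"
    and y: "A - of_nat a ^ p = lam ^ p * y" "y \<in> integers_of K"
  shows "\<exists>t\<in>integers_of K. A = 1 + lam ^ p * t"
proof -
  have lamO: "lam \<in> integers_of K" and u'O: "u' \<in> integers_of K"
    using lam_in_Zzeta u'(1) Zzeta_subset_K Zzeta_algebraic_int by (auto simp: integers_of_def)
  have lamp: "lam ^ p = lam * lam ^ (p - 1)" using p_gt_2 by (simp flip: power_Suc)
  have "of_int (int a ^ p - 1) = (A - 1) - (A - of_nat a ^ p)" by simp
  also have "\<dots> = lam * (lam * z - lam ^ (p - 1) * y)"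
    unfolding z(1) y(1) lamp by (simp add: power2_eq_square algebra_simps)
  finally have "of_int (int a ^ p - 1) = lam * (lam * z - lam ^ (p - 1) * y)" .
  moreover have "lam * z - lam ^ (p - 1) * y \<in> integers_of K"
    by (rule OK.diff_closed[OF OK.mult_closed[OF lamO z(2)] OK.mult_closed[OF OK.power_closed[OF lamO] y(2)]])
  ultimately have "int p dvd int a ^ p - 1"
    using p_dvd_if_lam_dvd by (simp only: integers_of_def mem_Collect_eq)
  hence "[int a ^ p = 1] (mod int p)" by (simp add: cong_iff_dvd_diff)
  hence a1: "[int a = 1] (mod int p)" using int_fermat[OF p_prime, of "int a"] cong_sym cong_trans by blast
  have "[(\<Sum>i<p. int a ^ i) = (\<Sum>i<p. 1 ^ i)] (mod int p)"
    by (intro cong_sum cong_pow a1)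
  hence "int p dvd (\<Sum>i<p. int a ^ i)" by (simp add: cong_dvd_iff)
  moreover have "int p dvd int a - 1" using a1 by (simp add: cong_iff_dvd_diff)
  ultimately have "int p * int p dvd (int a - 1) * (\<Sum>i<p. int a ^ i)" by (intro mult_dvd_mono)
  hence "int p * int p dvd int a ^ p - 1" by (simp only: power_diff_1_eq)
  then obtain m where m: "int a ^ p - 1 = int p * int p * m" by (elim dvdE)
  have "lam ^ (p - 1) * lam ^ (p - 1) = lam ^ p * lam ^ (p - 2)"
  proof -
    have "(p - 1) + (p - 1) = p + (p - 2)" using p_gt_2 by linarith
    thus ?thesis by (simp only: power_add[symmetric])
  qed
  moreover have "of_int (int a ^ p - 1) = lam ^ (p - 1) * lam ^ (p - 1) * (u' * u' * of_int m)"
    unfolding m of_int_mult of_int_of_nat_eq by (subst (1 2) u'(2)) simp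
  ultimately have am: "of_nat a ^ p - 1 = lam ^ p * (lam ^ (p - 2) * (u' * u' * of_int m))"
    by (simp add: mult.assoc)
  have "A = 1 + ((A - of_nat a ^ p) + (of_nat a ^ p - 1))" by simp
  also have "\<dots> = 1 + lam ^ p * (y + lam ^ (p - 2) * (u' * u' * of_int m))"
    unfolding y(1) am by (simp only: distrib_left)
  finally have "A = 1 + lam ^ p * (y + lam ^ (p - 2) * (u' * u' * of_int m))" .
  moreover have "y + lam ^ (p - 2) * (u' * u' * of_int m) \<in> integers_of K"
    by (rule OK.add_closed[OF y(2) OK.mult_closed[OF OK.power_closed[OF lamO]
          OK.mult_closed[OF OK.mult_closed[OF u'O u'O] OK.of_int_closed]]])
  ultimately show ?thesis by blast
qed

end

theorem theorem5p5:
  fixes p v \<mu> d :: nat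
    and \<zeta> lam A \<alpha> \<omega> \<Omega> :: complex
    and K S M \<pi> \<aa> :: "complex set"
    and \<sigma> \<sigma>\<^sub>\<mu> :: "complex \<Rightarrow> complex"
    and \<D> :: "complex set set set set"
    and \<Gamma> :: "complex set set set"
  assumes p: "odd p" "irregular_prime p"
    and \<zeta>: "\<zeta> ^ p = 1" "\<zeta> \<noteq> 1"
    and K: "K = field_gen {\<zeta>}"
    and \<pi>: "lam = \<zeta> - 1" "\<pi> = princ K lam"
    and v: "residue_primroot p v"
    and \<sigma>: "\<sigma> \<in> ring_iso (fld K) (fld K)" "\<sigma> \<zeta> = \<zeta> ^ v"
    and \<Gamma>: "eigen_decomposition K \<sigma> p \<D>" "\<Gamma> \<in> \<D>"
    and \<mu>: "\<not> p dvd \<mu>" "annihilated_by K \<sigma> \<mu> \<Gamma>"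
    and A: "singular p K \<pi> A" "semi_primary K \<pi> A"
    and \<aa>: "ideal \<aa> (ints_of K)" "princ K A = \<aa> [^]\<^bsub>frac_ideals K\<^esub> p"
      "\<aa> \<notin> princ_ideals K" "ideal_class K \<aa> \<in> \<Gamma>"
      "ideal_class K
         (\<sigma> ` \<aa> \<otimes>\<^bsub>frac_ideals K\<^esub> inv\<^bsub>frac_ideals K\<^esub> (\<aa> [^]\<^bsub>frac_ideals K\<^esub> \<mu>))
       = \<one>\<^bsub>class_group K\<^esub>"
    and \<alpha>: "\<alpha> \<in> K" "\<sigma> A = A ^ \<mu> * \<alpha> ^ p"
    and negative_or_positive:
      "(\<Gamma> \<subseteq> class_torsion_minus K p \<and>
        (\<exists>m \<in> {1..(p - 3) div 2}. [\<mu> = v ^ (2 * m + 1)] (mod p) \<and>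
          (\<exists>a \<in> {1..p - 1}. A - of_nat a ^ p \<in> \<pi> [^]\<^bsub>frac_ideals K\<^esub> (2 * m + 1)))) \<or>
       (\<Gamma> \<subseteq> class_torsion_plus K p \<and>
        (\<exists>m \<in> {1..(p - 3) div 2}. [\<mu> = v ^ (2 * m)] (mod p) \<and>
          (\<exists>a \<in> {1..p - 1}. A - of_nat a ^ p \<in> \<pi> [^]\<^bsub>frac_ideals K\<^esub> (2 * m))))"
    and A_norm: "val K \<pi> (A - 1) \<ge> 2"
    and A_primitive: "field_gen {A} = K"
    and A_primary: "primary p K \<pi> A"
    and \<omega>: "\<omega> ^ p = A"
    and S: "S = field_gen (insert \<omega> K)"
    and \<sigma>\<^sub>\<mu>: "\<sigma>\<^sub>\<mu> \<in> ring_iso (fld S) (fld S)" "\<forall>x \<in> K. \<sigma>\<^sub>\<mu> x = \<sigma> x"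
      "\<forall>P \<in> primes_over S K \<pi>. val S P (\<sigma>\<^sub>\<mu> \<omega> / \<omega> ^ \<mu> - 1) \<ge> 2 * val S P lam"
    and \<Omega>: "\<Omega> = (\<Sum>i = 0..p - 2. (\<sigma>\<^sub>\<mu> ^^ i) \<omega>)"
    and M: "M = field_gen {\<Omega>}"
    and d: "d = ord p (nat (int v * modular_inverse (int p) (int \<mu>)))"
  shows "card (primes_over M \<rat> (princ \<rat> (of_nat p))) = (p - 1) div d + 1 \<and>
    (\<exists>\<PP> :: nat \<Rightarrow> complex set.
       bij_betw \<PP> {0..(p - 1) div d} (primes_over M \<rat> (princ \<rat> (of_nat p))) \<and>
       ram_index M (\<PP> 0) (princ \<rat> (of_nat p)) = 1 \<and>
       (\<forall>j \<in> {1..(p - 1) div d}. ram_index M (\<PP> j) (princ \<rat> (of_nat p)) = d) \<and>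
       d > 1)"
proof -
  have prime: "prime p" using p(2) by (simp add: irregular_prime_def)
  interpret cyc: cyclotomic p \<zeta> lam
    by (rule cyclotomic.intro) (use prime p(1) \<zeta> \<pi>(1) in auto)
  have K_eq: "K = cyc.K" unfolding K by (rule cyc.K_eq_field_gen)
  interpret kum: kummer p \<zeta> lam A \<omega>
  proof (intro kummer.intro kummer_axioms.intro cyc.cyclotomic_axioms)
    show "A \<in> integers_of cyc.K" using A(1) unfolding singular_def carrier_ints_of K_eq by blast
    show "\<not> (\<exists>x\<in>cyc.K. x ^ p = A)" using A(1) unfolding singular_def K_eq by blast
    show "\<omega> ^ p = A" by (rule \<omega>)
  qed
  have S_eq: "S = kum.S" unfolding S K_eq by (rule kum.S_eq_field_gen)
  have endo: "subfield_endo kum.S \<sigma>\<^sub>\<mu>"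
    using subfield_endo_ring_iso[OF kum.S.subfield_of_complex_axioms] \<sigma>\<^sub>\<mu>(1) unfolding S_eq by blast
  have ext: "\<sigma>\<^sub>\<mu> x = \<sigma> x" if "x \<in> cyc.K" for x using \<sigma>\<^sub>\<mu>(2) that unfolding K_eq by blast
  have lamO: "lam \<in> integers_of cyc.K"
    using cyc.lam_in_Zzeta cyc.Zzeta_subset_K cyc.Zzeta_algebraic_int by (auto simp: integers_of_def)
  note valD = val_geD[OF cyc.K.subring_of_complex_axioms _ _ lamO]
  have "ereal (real 2) \<le> val cyc.K (princ cyc.K lam) (A - 1)"
    using A_norm unfolding \<pi>(2) K_eq by simp
  then obtain z where z: "z \<in> integers_of cyc.K" "A - 1 = lam ^ 2 * z"
    using valD[of 2 "A - 1"] by auto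
  obtain a where "val K \<pi> (A - of_nat a ^ p) \<ge> ereal (real p)"
    using A_primary unfolding primary_def by blast
  then obtain y where y: "y \<in> integers_of cyc.K" "A - of_nat a ^ p = lam ^ p * y"
    using valD[of p "A - of_nat a ^ p"] prime_gt_0_nat[OF prime] unfolding \<pi>(2) K_eq by blast
  obtain t where t: "t \<in> integers_of cyc.K" "A = 1 + lam ^ p * t"
    using kum.primary_imp_principal_unit[OF z(2,1) y(2,1)] by blast
  define k where "k = nat (int v * modular_inverse (int p) (int \<mu>))"
  have "coprime (int \<mu>) (int p)"
    using \<mu>(1) prime by (metis coprime_commute coprime_int_iff prime_imp_coprime)
  hence "[int v * (modular_inverse (int p) (int \<mu>) * int \<mu>) = int v * 1] (mod int p)"
    by (intro cong_scalar_left cong_modular_inverse2)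
  moreover have "int k = int v * modular_inverse (int p) (int \<mu>)"
    unfolding k_def using modular_inverse_int_nonneg[of "int p" "int \<mu>"] prime_gt_0_nat[OF prime] by simp
  ultimately have "[int (k * \<mu>) = int v] (mod int p)" by (simp add: mult.assoc)
  hence k_mu: "[k * \<mu> = v] (mod p)" by (simp only: cong_int_iff)
  have "\<not> p dvd v"
    using v prime coprime_common_divisor[of p v p] not_prime_unit by (auto simp: residue_primroot_def)
  hence "\<not> p dvd k" using cong_dvd_iff[OF k_mu] by auto
  hence "coprime k p" using prime by (metis coprime_commute prime_imp_coprime)
  then obtain \<kappa> where k_kap: "[k * \<kappa> = 1] (mod p)" using cong_solve_coprime_nat by auto
  have k_ne_1: "\<not> [k = 1] (mod p)"
  proof
    assume "[k = 1] (mod p)"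
    hence "[k * \<mu> = 1 * \<mu>] (mod p)" by (rule cong_scalar_right)
    hence mu_v: "[\<mu> = v] (mod p)" using k_mu cong_sym cong_trans by (metis mult_1)
    obtain e where e: "[\<mu> = v ^ e] (mod p)" "2 \<le> e" "e \<le> p - 2"
    proof -
      from negative_or_positive consider
        m where "m \<in> {1..(p - 3) div 2}" "[\<mu> = v ^ (2 * m + 1)] (mod p)"
        | m where "m \<in> {1..(p - 3) div 2}" "[\<mu> = v ^ (2 * m)] (mod p)" by blast
      thus ?thesis
      proof cases
        case 1
        thus ?thesis by (intro that[of "2 * m + 1"]) auto
      next
        case 2
        thus ?thesis by (intro that[of "2 * m"]) auto
      qed
    qed
    \<comment> \<open>the order of \<open>v\<close> is \<open>p - 1\<close>, too large for the exponent \<open>e - 1\<close>\<close>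
    have "[v * v ^ (e - 1) = v * 1] (mod p)"
      using cong_trans[OF cong_sym[OF e(1)] mu_v] e(2) by (simp flip: power_Suc)
    moreover have "coprime v p" using v by (simp add: residue_primroot_def coprime_commute)
    ultimately have "[v ^ (e - 1) = 1] (mod p)" by (simp only: cong_mult_lcancel_nat)
    hence "ord p v dvd e - 1" by (simp only: ord_divides)
    moreover have "ord p v = p - 1" using v totient_prime[OF prime] by (simp add: residue_primroot_def)
    ultimately have "p - 1 \<le> e - 1" using e(2) by (auto dest: dvd_imp_le)
    thus False using e(2,3) by linarith
  qed
  interpret kg: kummer_galois p \<zeta> lam A \<omega> \<sigma>\<^sub>\<mu> v \<mu> k \<kappa> \<alpha> t
  proof (intro kummer_galois.intro kummer_galois_axioms.intro kum.kummer_axioms endo k_mu k_kap k_ne_1 v t)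
    show "\<sigma>\<^sub>\<mu> \<zeta> = \<zeta> ^ v" using ext[OF cyc.zeta_in_K] \<sigma>(2) by simp
    show "\<alpha> \<in> cyc.K" using \<alpha>(1) unfolding K_eq .
    show "\<sigma>\<^sub>\<mu> A = A ^ \<mu> * \<alpha> ^ p" using ext[OF kum.A_in_K] \<alpha>(2) by simp
  qed
  have "{0..p - 2} = {..<p - 1}" using cyc.p_gt_2 by auto
  hence "\<Omega> = kg.\<Omega>" unfolding \<Omega> kg.\<Omega>_def by simp
  hence M_eq: "M = kg.M" unfolding M by simp
  have d_eq: "d = ord p k" unfolding d k_def ..
  show ?thesis
    unfolding M_eq d_eq by (rule kg.primes_and_ramification)
qed

end
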